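(* Let $\mathcal P$ be a finite connected poset, and let $\mathcal X$ be one of the following two posets on $\{1,2,3\}$: $\mathcal X_3'$, whose only strict relations are $1<2$ and $1<3$; or $\mathcal X_3''$, whose only strict relations are $1<3$ and $2<3$. Assume that for any $a<b$ in $\mathcal P$ there exists $f\in \mathrm{Emb}_{\mathcal X}^{\mathcal P}$ with $\{a,b\}\subseteq \mathrm{Im} f$. Then the set (of isomorphism classes) $$\mathcal R=\{\Theta_f(U)\mid (f,U)\in \mathrm{Emb}_{\mathcal X}^{\mathcal P}\times \mathrm{Ind}\,\mathcal X\}$$ is a basis of the invariant $\mathbf{mult}_{\mathcal X,\mathcal P}$.
   Context: Fix a field $k$. For a finite poset $\mathcal P$, $\mathrm{mod}\,\mathcal P$ is the category of functors from $\mathcal P$ to finite-dimensional $k$-vector spaces ($\mathcal P$-modules); $\mathrm{Ind}\,\mathcal P$ is a set of representatives of isomorphism classes of indecomposable $\mathcal P$-modules. $\mathrm K_0^{\mathrm{sp}}(\mathcal P)$ is the split Grothendieck group: generated by isoclasses $[M]$ with relations $[M\oplus N]=[M]+[N]$ (free abelian on $\mathrm{Ind}\,\mathcal P$). An invariant is a $\mathbb Z$-linear map $\Psi:\mathrm K_0^{\mathrm{sp}}(\mathcal P)\to\mathbb Z^N$ ($N$ a set); write $\Psi(M)=\Psi([M])$. It is finite if its image is finitely generated. A basis of a finite invariant $\Psi$ is a set $\mathcal B$ of (pairwise non-isomorphic) indecomposable $\mathcal P$-modules such that $\Psi$ restricts to an isomorphism of abelian groups $\langle [U]\mid U\in\mathcal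 B\rangle\to \mathrm{Im}\,\Psi$, where $\langle [U]\mid U\in\mathcal B\rangle$ is the free subgroup of $\mathrm K_0^{\mathrm{sp}}(\mathcal P)$ generated by the $[U]$. An order-embedding $f:\mathcal X\to\mathcal P$ is a map with $x\le x'\iff f(x)\le f(x')$. $\mathrm{Emb}_{\mathcal X}^{\mathcal P}$ is the set of order-embeddings up to precomposition with automorphisms of $\mathcal X$ (fix one representative for each class). $f^*:\mathrm{mod}\,\mathcal P\to\mathrm{mod}\,\mathcal X$ is restriction along $f$. If $\mathcal X$ is representation-finite ($\mathrm{Ind}\,\mathcal X$ finite), $\mathbf{mult}_{\mathcal X,\mathcal P}:\mathrm K_0^{\mathrm{sp}}(\mathcal P)\to\mathbb Z^{\mathrm{Emb}_{\mathcal X}^{\mathcal P}\times\mathrm{Ind}\,\mathcal X}$ is the invariant with $(\mathbf{mult}_{\mathcal X,\mathcal P}(M))_{(f,U)}=$ multiplicity of $U$ as a direct summand of $f^*M$. The posets $\mathcal X_3',\mathcal X_3''$ are representation-finite. The functor $f^*$ has a left adjoint $f_!$ and a right adjoint $f_*$, with $f^*f_!=\mathrm{Id}=f^*f_*$. For $U\in\mathrm{mod}\,\mathcal X$ there is a natural isomorphism $\mathrm{Hom}_{\mathcal P}(f_!U,f_*U)\cong\mathrm{End}_{\mathcal X}(U)$; let $\theta_fU:f_!U\to f_*U$ correspond to the identity $1_U$, and set $\Theta_fU=\mathrm{Im}(\theta_fU)$. *)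

theory Defs
  imports Complex_Main "HOL-Algebra.Free_Abelian_Groups" "HOL-Library.Function_Algebras"
    "HOL-Library.Nat_Bijection"
begin

section \<open>Posets\<close>

text \<open>A poset is given by its reflexive order relation \<open>P\<close> with \<open>Partial_order P\<close>; its
  underlying set is \<open>Field P\<close>.\<close>

definition connected_poset :: "'p rel \<Rightarrow> bool" where
  "connected_poset P \<longleftrightarrow> (\<forall>a\<in>Field P. \<forall>b\<in>Field P. (a, b) \<in> (P \<union> P\<inverse>)\<^sup>*)"

definition X3' :: "nat rel" where
  "X3' = {(1, 1), (2, 2), (3, 3), (1, 2), (1, 3)}"

definition X3'' :: "nat rel" where
  "X3'' = {(1, 1), (2, 2), (3, 3), (1, 3), (2, 3)}"

definition order_embeddings :: "'x rel \<Rightarrow> 'p rel \<Rightarrow> ('x \<Rightarrow> 'p) set" where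
  "order_embeddings X P =
    {f \<in> Field X \<rightarrow>\<^sub>E Field P.
       \<forall>x\<in>Field X. \<forall>x'\<in>Field X. (x, x') \<in> X \<longleftrightarrow> (f x, f x') \<in> P}"

definition poset_auts :: "'x rel \<Rightarrow> ('x \<Rightarrow> 'x) set" where
  "poset_auts X = {s \<in> order_embeddings X X. bij_betw s (Field X) (Field X)}"

definition emb_rep :: "'x rel \<Rightarrow> 'p rel \<Rightarrow> ('x \<Rightarrow> 'p) \<Rightarrow> ('x \<Rightarrow> 'p)" where
  "emb_rep X P f =
    (SOME g. g \<in> order_embeddings X P \<and> (\<exists>s\<in>poset_auts X. g = compose (Field X) f s))"

text \<open>\<open>emb_rep X P\<close> is constant on the orbits of \<open>poset_auts X\<close>, so its image contains exactly
  one order-embedding from each orbit.\<close>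

definition Emb :: "'x rel \<Rightarrow> 'p rel \<Rightarrow> ('x \<Rightarrow> 'p) set" where
  "Emb X P = emb_rep X P ` order_embeddings X P"


section \<open>Modules over a poset\<close>

text \<open>The finite-dimensional vector spaces over \<open>'k\<close> are taken to be the finite-dimensional
  subspaces of the space of all sequences in \<open>'k\<close>. Every finite-dimensional vector space is
  isomorphic to one of these, and they form a set.\<close>

type_synonym 'k seq = "nat \<Rightarrow> 'k"

definition seq_scale :: "'k::field \<Rightarrow> 'k seq \<Rightarrow> 'k seq" where
  "seq_scale c v = (\<lambda>n. c * v n)"

interpretation seqv: vector_space "seq_scale :: 'k::field \<Rightarrow> 'k seq \<Rightarrow> 'k seq"
  by unfold_locales (auto simp: seq_scale_def fun_eq_iff algebra_simps)

definition fd_space :: "'k::field seq set \<Rightarrow> bool" where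
  "fd_space V \<longleftrightarrow> (\<exists>B. finite B \<and> V = seqv.span B)"

definition lin_map :: "'k::field seq set \<Rightarrow> 'k seq set \<Rightarrow> ('k seq \<Rightarrow> 'k seq) \<Rightarrow> bool" where
  "lin_map V W h \<longleftrightarrow> h ` V \<subseteq> W \<and> (\<forall>u\<in>V. \<forall>v\<in>V. h (u + v) = h u + h v) \<and>
     (\<forall>c. \<forall>v\<in>V. h (seq_scale c v) = seq_scale c (h v))"

text \<open>\<open>sp M p\<close> is the space at \<open>p\<close> and \<open>tr M p q\<close> the map \<open>sp M p \<rightarrow> sp M q\<close> for \<open>(p, q) \<in> P\<close>.
  Other values of \<open>sp M\<close> and \<open>tr M\<close>, and values of \<open>tr M p q\<close> outside \<open>sp M p\<close>, carry no
  information; modules are only ever compared up to isomorphism.\<close>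

record ('p, 'k) pmod =
  sp :: "'p \<Rightarrow> 'k seq set"
  tr :: "'p \<Rightarrow> 'p \<Rightarrow> 'k seq \<Rightarrow> 'k seq"

definition is_pmod :: "'p rel \<Rightarrow> ('p, 'k::field) pmod \<Rightarrow> bool" where
  "is_pmod P M \<longleftrightarrow>
     (\<forall>p\<in>Field P. fd_space (sp M p)) \<and>
     (\<forall>(p, q)\<in>P. lin_map (sp M p) (sp M q) (tr M p q)) \<and>
     (\<forall>p\<in>Field P. \<forall>v\<in>sp M p. tr M p p v = v) \<and>
     (\<forall>p q r. (p, q) \<in> P \<longrightarrow> (q, r) \<in> P \<longrightarrow>
        (\<forall>v\<in>sp M p. tr M q r (tr M p q v) = tr M p r v))"

type_synonym ('p, 'k) pmap = "'p \<Rightarrow> 'k seq \<Rightarrow> 'k seq"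

definition pmod_hom ::
  "'p rel \<Rightarrow> ('p, 'k::field) pmod \<Rightarrow> ('p, 'k) pmod \<Rightarrow> ('p, 'k) pmap \<Rightarrow> bool" where
  "pmod_hom P M N h \<longleftrightarrow>
     (\<forall>p\<in>Field P. lin_map (sp M p) (sp N p) (h p)) \<and>
     (\<forall>(p, q)\<in>P. \<forall>v\<in>sp M p. h q (tr M p q v) = tr N p q (h p v))"

definition pmod_iso :: "'p rel \<Rightarrow> ('p, 'k::field) pmod \<Rightarrow> ('p, 'k) pmod \<Rightarrow> bool" where
  "pmod_iso P M N \<longleftrightarrow>
     (\<exists>h. pmod_hom P M N h \<and> (\<forall>p\<in>Field P. bij_betw (h p) (sp M p) (sp N p)))"

definition isoclass :: "'p rel \<Rightarrow> ('p, 'k::field) pmod \<Rightarrow> ('p, 'k) pmod set" where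
  "isoclass P M = {N. is_pmod P N \<and> pmod_iso P M N}"

definition zero_pmod :: "('p, 'k::field) pmod" where
  "zero_pmod = \<lparr>sp = (\<lambda>p. {0}), tr = (\<lambda>p q v. 0)\<rparr>"

text \<open>External direct sum: a pair of sequences is encoded as one sequence through the bijection
  \<open>sum_decode\<close> from \<open>nat\<close> to \<open>nat + nat\<close>.\<close>

definition seq_pair :: "'k seq \<Rightarrow> 'k seq \<Rightarrow> 'k seq" where
  "seq_pair v w = (\<lambda>n. case sum_decode n of Inl i \<Rightarrow> v i | Inr j \<Rightarrow> w j)"

definition seq_fst :: "'k seq \<Rightarrow> 'k seq" where
  "seq_fst u = (\<lambda>i. u (sum_encode (Inl i)))"

definition seq_snd :: "'k seq \<Rightarrow> 'k seq" where
  "seq_snd u = (\<lambda>j. u (sum_encode (Inr j)))"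

definition pmod_sum :: "('p, 'k::field) pmod \<Rightarrow> ('p, 'k) pmod \<Rightarrow> ('p, 'k) pmod" where
  "pmod_sum M N =
     \<lparr>sp = (\<lambda>p. {seq_pair v w | v w. v \<in> sp M p \<and> w \<in> sp N p}),
      tr = (\<lambda>p q u. seq_pair (tr M p q (seq_fst u)) (tr N p q (seq_snd u)))\<rparr>"

primrec pmod_power :: "('p, 'k::field) pmod \<Rightarrow> nat \<Rightarrow> ('p, 'k) pmod" where
  "pmod_power U 0 = zero_pmod"
| "pmod_power U (Suc n) = pmod_sum U (pmod_power U n)"

definition indecomposable :: "'p rel \<Rightarrow> ('p, 'k::field) pmod \<Rightarrow> bool" where
  "indecomposable P M \<longleftrightarrow> is_pmod P M \<and> \<not> pmod_iso P M zero_pmod \<and>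
     (\<forall>A B. is_pmod P A \<longrightarrow> is_pmod P B \<longrightarrow> pmod_iso P M (pmod_sum A B) \<longrightarrow>
        pmod_iso P A zero_pmod \<or> pmod_iso P B zero_pmod)"

definition Ind :: "'p rel \<Rightarrow> ('p, 'k::field) pmod set" where
  "Ind P = (\<lambda>M. SOME N. N \<in> isoclass P M) ` {M. indecomposable P M}"

definition multiplicity :: "'p rel \<Rightarrow> ('p, 'k::field) pmod \<Rightarrow> ('p, 'k) pmod \<Rightarrow> nat" where
  "multiplicity P U M = Max {n. \<exists>N. is_pmod P N \<and> pmod_iso P M (pmod_sum (pmod_power U n) N)}"


section \<open>The split Grothendieck group, invariants and bases\<close>

type_synonym ('p, 'k) k0_elem = "(('p, 'k) pmod set \<Rightarrow>\<^sub>0 int) set"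

definition k0_gens :: "'p rel \<Rightarrow> (('p, 'k::field) pmod set \<Rightarrow>\<^sub>0 int) monoid" where
  "k0_gens P = free_Abelian_group (isoclass P ` {M. is_pmod P M})"

definition k0_rels :: "'p rel \<Rightarrow> (('p, 'k::field) pmod set \<Rightarrow>\<^sub>0 int) set" where
  "k0_rels P = generate (k0_gens P)
     {frag_of (isoclass P (pmod_sum M N)) - (frag_of (isoclass P M) + frag_of (isoclass P N)) | M N.
        is_pmod P M \<and> is_pmod P N}"

definition K0sp :: "'p rel \<Rightarrow> ('p, 'k::field) k0_elem monoid" where
  "K0sp P = k0_gens P Mod k0_rels P"

text \<open>The element of \<open>K0sp P\<close> given by an isomorphism class of modules.\<close>

definition k0_class :: "'p rel \<Rightarrow> ('p, 'k::field) pmod set \<Rightarrow> ('p, 'k) k0_elem" where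
  "k0_class P C = k0_rels P #>\<^bsub>k0_gens P\<^esub> frag_of C"

definition Zpow :: "'n set \<Rightarrow> ('n \<Rightarrow> int) monoid" where
  "Zpow N = product_group N (\<lambda>_. integer_group)"

definition is_invariant ::
  "'p rel \<Rightarrow> 'n set \<Rightarrow> (('p, 'k::field) k0_elem \<Rightarrow> 'n \<Rightarrow> int) \<Rightarrow> bool" where
  "is_invariant P N \<Psi> \<longleftrightarrow> \<Psi> \<in> hom (K0sp P) (Zpow N)"

definition finite_invariant ::
  "'p rel \<Rightarrow> 'n set \<Rightarrow> (('p, 'k::field) k0_elem \<Rightarrow> 'n \<Rightarrow> int) \<Rightarrow> bool" where
  "finite_invariant P N \<Psi> \<longleftrightarrow> is_invariant P N \<Psi> \<and>
     (\<exists>S. finite S \<and> S \<subseteq> carrier (Zpow N) \<and> generate (Zpow N) S = \<Psi> ` carrier (K0sp P))"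

text \<open>A basis is a set of isomorphism classes of indecomposable modules, so that its members are
  pairwise non-isomorphic by construction.\<close>

definition is_basis ::
  "'p rel \<Rightarrow> 'n set \<Rightarrow> (('p, 'k::field) k0_elem \<Rightarrow> 'n \<Rightarrow> int) \<Rightarrow> ('p, 'k) pmod set set \<Rightarrow> bool" where
  "is_basis P N \<Psi> \<B> \<longleftrightarrow> finite_invariant P N \<Psi> \<and>
     \<B> \<subseteq> isoclass P ` {M. indecomposable P M} \<and>
     \<Psi> \<in> iso (subgroup_generated (K0sp P) (k0_class P ` \<B>))
            (Zpow N \<lparr>carrier := \<Psi> ` carrier (K0sp P)\<rparr>)"


section \<open>Restriction along an order-embedding and its adjoints\<close>

definition restr :: "('x \<Rightarrow> 'p) \<Rightarrow> ('p, 'k) pmod \<Rightarrow> ('x, 'k) pmod" where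
  "restr f M = \<lparr>sp = (\<lambda>x. sp M (f x)), tr = (\<lambda>x y. tr M (f x) (f y))\<rparr>"

text \<open>The multiplicity invariant: the homomorphism determined by its values on the classes of
  modules. It is unique on the carrier of \<open>K0sp P\<close>, which these classes generate.\<close>

definition mult_inv ::
  "'x rel \<Rightarrow> 'p rel \<Rightarrow> ('p, 'k::field) k0_elem \<Rightarrow> ('x \<Rightarrow> 'p) \<times> ('x, 'k) pmod \<Rightarrow> int" where
  "mult_inv X P = (SOME \<Psi>. is_invariant P (Emb X P \<times> Ind X) \<Psi> \<and>
     (\<forall>M. is_pmod P M \<longrightarrow> (\<forall>f\<in>Emb X P. \<forall>U\<in>Ind X.
        \<Psi> (k0_class P (isoclass P M)) (f, U) = int (multiplicity X U (restr f M)))))"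

text \<open>\<open>L\<close> is the value at \<open>U\<close> of the left adjoint of \<open>restr f\<close>, and \<open>\<eta> : U \<rightarrow> restr f L\<close> is the
  unit of the adjunction.\<close>

definition is_left_adj :: "'x rel \<Rightarrow> 'p rel \<Rightarrow> ('x \<Rightarrow> 'p) \<Rightarrow> ('x, 'k::field) pmod \<Rightarrow>
    ('p, 'k) pmod \<Rightarrow> ('x, 'k) pmap \<Rightarrow> bool" where
  "is_left_adj X P f U L \<eta> \<longleftrightarrow> is_pmod P L \<and> pmod_hom X U (restr f L) \<eta> \<and>
     (\<forall>N g. is_pmod P N \<longrightarrow> pmod_hom X U (restr f N) g \<longrightarrow>
        (\<exists>h. pmod_hom P L N h \<and> (\<forall>x\<in>Field X. \<forall>u\<in>sp U x. h (f x) (\<eta> x u) = g x u) \<and>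
           (\<forall>h'. pmod_hom P L N h' \<longrightarrow> (\<forall>x\<in>Field X. \<forall>u\<in>sp U x. h' (f x) (\<eta> x u) = g x u) \<longrightarrow>
              (\<forall>p\<in>Field P. \<forall>v\<in>sp L p. h' p v = h p v))))"

text \<open>Dually, \<open>R\<close> is the value at \<open>U\<close> of the right adjoint of \<open>restr f\<close>, with counit
  \<open>\<epsilon> : restr f R \<rightarrow> U\<close>.\<close>

definition is_right_adj :: "'x rel \<Rightarrow> 'p rel \<Rightarrow> ('x \<Rightarrow> 'p) \<Rightarrow> ('x, 'k::field) pmod \<Rightarrow>
    ('p, 'k) pmod \<Rightarrow> ('x, 'k) pmap \<Rightarrow> bool" where
  "is_right_adj X P f U R \<epsilon> \<longleftrightarrow> is_pmod P R \<and> pmod_hom X (restr f R) U \<epsilon> \<and>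
     (\<forall>N g. is_pmod P N \<longrightarrow> pmod_hom X (restr f N) U g \<longrightarrow>
        (\<exists>h. pmod_hom P N R h \<and> (\<forall>x\<in>Field X. \<forall>v\<in>sp N (f x). \<epsilon> x (h (f x) v) = g x v) \<and>
           (\<forall>h'. pmod_hom P N R h' \<longrightarrow>
              (\<forall>x\<in>Field X. \<forall>v\<in>sp N (f x). \<epsilon> x (h' (f x) v) = g x v) \<longrightarrow>
              (\<forall>p\<in>Field P. \<forall>v\<in>sp N p. h' p v = h p v))))"

definition left_adj :: "'x rel \<Rightarrow> 'p rel \<Rightarrow> ('x \<Rightarrow> 'p) \<Rightarrow> ('x, 'k::field) pmod \<Rightarrow>
    ('p, 'k) pmod \<times> ('x, 'k) pmap" where
  "left_adj X P f U = (SOME (L, \<eta>). is_left_adj X P f U L \<eta>)"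

definition right_adj :: "'x rel \<Rightarrow> 'p rel \<Rightarrow> ('x \<Rightarrow> 'p) \<Rightarrow> ('x, 'k::field) pmod \<Rightarrow>
    ('p, 'k) pmod \<times> ('x, 'k) pmap" where
  "right_adj X P f U = (SOME (R, \<epsilon>). is_right_adj X P f U R \<epsilon>)"

text \<open>The isomorphism from \<open>Hom (f\<^sub>! U) (f\<^sub>* U)\<close> to \<open>End U\<close> sends \<open>h\<close> to the composite
  \<open>\<epsilon> \<circ> restr f h \<circ> \<eta>\<close>; \<open>theta\<close> is the preimage of the identity.\<close>

definition theta :: "'x rel \<Rightarrow> 'p rel \<Rightarrow> ('x \<Rightarrow> 'p) \<Rightarrow> ('x, 'k::field) pmod \<Rightarrow> ('p, 'k) pmap" where
  "theta X P f U =
     (let (L, \<eta>) = left_adj X P f U; (R, \<epsilon>) = right_adj X P f U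
      in SOME h. pmod_hom P L R h \<and> (\<forall>x\<in>Field X. \<forall>u\<in>sp U x. \<epsilon> x (h (f x) (\<eta> x u)) = u))"

definition image_pmod ::
  "('p, 'k) pmod \<Rightarrow> ('p, 'k) pmod \<Rightarrow> ('p, 'k) pmap \<Rightarrow> ('p, 'k) pmod" where
  "image_pmod M N h = \<lparr>sp = (\<lambda>p. h p ` sp M p), tr = tr N\<rparr>"

definition Theta :: "'x rel \<Rightarrow> 'p rel \<Rightarrow> ('x \<Rightarrow> 'p) \<Rightarrow> ('x, 'k::field) pmod \<Rightarrow> ('p, 'k) pmod" where
  "Theta X P f U =
     image_pmod (fst (left_adj X P f U)) (fst (right_adj X P f U)) (theta X P f U)"

end

theory Submission
  imports Defs
begin

text \<open>
  A star of a poset is a subset with a centre, an element comparable to all the others. For both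
  posets \<open>X\<close> the indecomposable modules are the interval modules \<open>k\<^sub>S\<close>, one-dimensional on a star \<open>S\<close>
  with identity maps and zero elsewhere: a nonzero \<open>X\<close>-module has a direct summand \<open>k\<^sub>S\<close>
  (\<open>split_X3'\<close>, \<open>split_X3''\<close>), which is found by exhibiting a family of vectors and a dual family of
  linear forms (\<open>interval_split_off\<close>).

  For an embedding \<open>f\<close> and a star \<open>S\<close> of \<open>X\<close>, count in \<open>f\<^sup>* M\<close> the summands \<open>k\<^sub>T\<close> with \<open>S \<subseteq> T\<close>. By
  inversion over inclusion of stars these counts carry the same information as the multiplicities.
  Two facts make them better suited than the multiplicities themselves.

  First, the count depends only on the subset \<open>A = f(S)\<close> of \<open>P\<close>. A section of \<open>M\<close> over \<open>A\<close> is a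
  compatible family of vectors \<open>u\<^sub>p\<close>, a cosection a compatible family of linear forms \<open>\<phi>\<^sub>p\<close> (\<open>p \<in> A\<close>),
  and the number \<open>\<phi>\<^sub>p(u\<^sub>p)\<close> is the same for all \<open>p \<in> A\<close>. The count is the rank of this pairing, that
  is, the largest size of a dual system (\<open>decomposes_rank\<close>, \<open>rank_ge_restr\<close>). On the interval module of
  a convex set \<open>J\<close> this rank is \<open>1\<close> if \<open>A \<subseteq> J\<close> and \<open>0\<close> otherwise (\<open>rank_ge_interval\<close>).

  Second, \<open>\<Theta>\<^sub>f(k\<^sub>S)\<close> is the interval module of the convex closure of \<open>f(S)\<close> (\<open>Theta_interval\<close>). Indeed,
  the image of \<open>f\<^sub>! U \<rightarrow> f\<^sub>* U\<close> is characterised by its restriction \<open>U\<close> and by being generated and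
  cogenerated over the image of \<open>f\<close> (\<open>Theta_unique\<close>), and these properties are visible for the interval
  module.

  Hence the counts of the modules in the proposed basis form the matrix with entry \<open>1\<close> where the convex
  closure of \<open>A\<close> is contained in that of \<open>A'\<close>, and \<open>0\<close> elsewhere. As \<open>X\<close> has no chain of three elements,
  \<open>A\<close> consists of minimal and maximal elements of its convex closure and is determined by it
  (\<open>convex_closure_extremal\<close>), so this is the zeta matrix of a finite family of sets ordered by
  inclusion. It is unitriangular, hence invertible over the integers (\<open>zeta_inj\<close>, \<open>zeta_surj\<close>):
  the proposed basis is independent under the invariant, and the value at any module is an integral
  combination of the values on it.

  Sections and cosections are exchanged by duality, so that one argument covers both posets; only the
  splitting of \<open>X\<close>-modules distinguishes between a centre below and a centre above.
\<close>

section \<open>Linear algebra in the space of sequences\<close>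

text \<open>Sequences are vectors here, so the pointwise laws are kept away from the simplifier.\<close>

declare plus_fun_apply [simp del] zero_fun_apply [simp del] minus_apply [simp del]

interpretation seqend: vector_space_pair "seq_scale :: 'k::field \<Rightarrow> 'k seq \<Rightarrow> 'k seq"
    "seq_scale :: 'k \<Rightarrow> 'k seq \<Rightarrow> 'k seq"
  by unfold_locales

interpretation seqform: vector_space_pair "seq_scale :: 'k::field \<Rightarrow> 'k seq \<Rightarrow> 'k seq"
    "(*) :: 'k \<Rightarrow> 'k \<Rightarrow> 'k"
  by unfold_locales (auto simp: algebra_simps)

text \<open>Like \<open>lin_map\<close>, linearity is only required on \<open>V\<close>: the forms that occur are composites with
  structure maps of modules, which are meaningless outside their spaces.\<close>

definition lin_form :: "'k::field seq set \<Rightarrow> ('k seq \<Rightarrow> 'k) \<Rightarrow> bool" where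
  "lin_form V \<phi> \<longleftrightarrow> (\<forall>u\<in>V. \<forall>v\<in>V. \<phi> (u + v) = \<phi> u + \<phi> v) \<and>
     (\<forall>c. \<forall>v\<in>V. \<phi> (seq_scale c v) = c * \<phi> v)"

lemma lin_form_add: "lin_form V \<phi> \<Longrightarrow> u \<in> V \<Longrightarrow> v \<in> V \<Longrightarrow> \<phi> (u + v) = \<phi> u + \<phi> v"
  and lin_form_scale: "lin_form V \<phi> \<Longrightarrow> v \<in> V \<Longrightarrow> \<phi> (seq_scale c v) = c * \<phi> v"
  by (auto simp: lin_form_def)

lemma lin_form_subset: "lin_form V \<phi> \<Longrightarrow> W \<subseteq> V \<Longrightarrow> lin_form W \<phi>"
  unfolding lin_form_def by blast

lemma lin_map_add: "lin_map V W h \<Longrightarrow> u \<in> V \<Longrightarrow> v \<in> V \<Longrightarrow> h (u + v) = h u + h v"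
  and lin_map_scale: "lin_map V W h \<Longrightarrow> v \<in> V \<Longrightarrow> h (seq_scale c v) = seq_scale c (h v)"
  and lin_map_in: "lin_map V W h \<Longrightarrow> v \<in> V \<Longrightarrow> h v \<in> W"
  by (auto simp: lin_map_def)

lemma lin_map_comp: "lin_map U V g \<Longrightarrow> lin_map V W h \<Longrightarrow> lin_map U W (\<lambda>v. h (g v))"
  by (auto simp: lin_map_def image_subset_iff)

lemma lin_form_comp: "lin_map U V g \<Longrightarrow> lin_form V \<phi> \<Longrightarrow> lin_form U (\<lambda>v. \<phi> (g v))"
  by (auto simp: lin_map_def lin_form_def image_subset_iff)

lemma seq_scale_0 [simp]: "seq_scale 0 v = 0" "seq_scale c 0 = 0"
  and seq_scale_1 [simp]: "seq_scale 1 v = v"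
  by (auto simp: seq_scale_def fun_eq_iff zero_fun_apply)

context
  fixes V :: "'k::field seq set"
  assumes V: "seqv.subspace V"
begin

lemma lin_map_0: "lin_map V W h \<Longrightarrow> h 0 = 0"
  using lin_map_scale[of V W h 0 0] seqv.subspace_0[OF V] by simp

lemma lin_map_diff:
  assumes "lin_map V W h" "u \<in> V" "v \<in> V" shows "h (u - v) = h u - h v"
  using lin_map_add[OF assms(1), of "u - v" v] assms seqv.subspace_diff[OF V] by simp

lemma lin_map_sum:
  assumes "lin_map V W h" "\<And>i. i \<in> I \<Longrightarrow> g i \<in> V"
  shows "h (\<Sum>i\<in>I. g i) = (\<Sum>i\<in>I. h (g i))"
  using assms(2)
proof (induction I rule: infinite_finite_induct)
  case (insert i I)
  then have "(\<Sum>i\<in>I. g i) \<in> V" using seqv.subspace_sum[OF V] by blast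
  with insert lin_map_add[OF assms(1)] show ?case by simp
qed (use lin_map_0[OF assms(1)] in auto)

lemma lin_form_0: "lin_form V \<phi> \<Longrightarrow> \<phi> 0 = 0"
  using lin_form_scale[of V \<phi> 0 0] seqv.subspace_0[OF V] by simp

lemma lin_form_diff:
  assumes "lin_form V \<phi>" "u \<in> V" "v \<in> V" shows "\<phi> (u - v) = \<phi> u - \<phi> v"
  using lin_form_add[OF assms(1), of "u - v" v] assms seqv.subspace_diff[OF V] by simp

lemma lin_form_sum:
  assumes "lin_form V \<phi>" "\<And>i. i \<in> I \<Longrightarrow> g i \<in> V"
  shows "\<phi> (\<Sum>i\<in>I. g i) = (\<Sum>i\<in>I. \<phi> (g i))"
  using assms(2)
proof (induction I rule: infinite_finite_induct)
  case (insert i I)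
  then have "(\<Sum>i\<in>I. g i) \<in> V" using seqv.subspace_sum[OF V] by blast
  with insert lin_form_add[OF assms(1)] show ?case by simp
qed (use lin_form_0[OF assms(1)] in auto)

lemma subspace_image:
  assumes h: "lin_map V W h" shows "seqv.subspace (h ` V)"
  unfolding seqv.subspace_def
proof (intro conjI ballI allI)
  show "0 \<in> h ` V" using lin_map_0[OF h] seqv.subspace_0[OF V] by (metis image_eqI)
next
  fix x y assume "x \<in> h ` V" "y \<in> h ` V"
  then obtain u v where "u \<in> V" "v \<in> V" "x = h u" "y = h v" by blast
  then show "x + y \<in> h ` V"
    using lin_map_add[OF h] seqv.subspace_add[OF V] by (metis image_eqI)
next
  fix c x assume "x \<in> h ` V"
  then obtain u where "u \<in> V" "x = h u" by blast
  then show "seq_scale c x \<in> h ` V"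
    using lin_map_scale[OF h] seqv.subspace_scale[OF V] by (metis image_eqI)
qed

lemma subspace_ker: "lin_map V W h \<Longrightarrow> seqv.subspace {v \<in> V. h v = 0}"
  using lin_map_0[of W h] V unfolding seqv.subspace_def by (auto simp: lin_map_def)

lemma subspace_form_ker: "lin_form V \<phi> \<Longrightarrow> seqv.subspace {v \<in> V. \<phi> v = 0}"
  using lin_form_0[of \<phi>] V unfolding seqv.subspace_def by (auto simp: lin_form_def)

end

lemma fd_space_subspace: "fd_space V \<Longrightarrow> seqv.subspace V"
  by (auto simp: fd_space_def)

lemma fd_space_if_spanned:
  assumes "seqv.subspace W" "W \<subseteq> seqv.span B" "finite B" shows "fd_space W"
proof -
  obtain C where C: "C \<subseteq> W" "seqv.independent C" "W \<subseteq> seqv.span C"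
    using seqv.maximal_independent_subset by blast
  have "finite C" using seqv.independent_span_bound[OF assms(3) C(2)] C(1) assms(2) by blast
  moreover have "seqv.span C \<subseteq> W" using seqv.span_minimal[OF C(1) assms(1)] .
  ultimately show ?thesis unfolding fd_space_def using C(3) by blast
qed

lemma fd_space_subset: "fd_space V \<Longrightarrow> seqv.subspace W \<Longrightarrow> W \<subseteq> V \<Longrightarrow> fd_space W"
  by (metis fd_space_def fd_space_if_spanned)


lemma lin_form_extend:
  assumes "seqv.subspace V" "lin_form V \<chi>"
  obtains \<psi> where "lin_form UNIV \<psi>" "\<And>v. v \<in> V \<Longrightarrow> \<psi> v = \<chi> v"
proof -
  obtain B where B: "B \<subseteq> V" "seqv.independent B" "V \<subseteq> seqv.span B"
    using seqv.maximal_independent_subset by blast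
  obtain \<psi> where \<psi>: "Vector_Spaces.linear seq_scale (*) \<psi>" "\<forall>x\<in>B. \<psi> x = \<chi> x"
    using seqform.linear_independent_extend[OF B(2)] by blast
  interpret \<psi>: Vector_Spaces.linear seq_scale "(*)" \<psi> by (rule \<psi>(1))
  have "lin_form UNIV \<psi>" by (auto simp: lin_form_def \<psi>.add \<psi>.scale)
  moreover have "v \<in> V \<and> \<psi> v = \<chi> v" if "v \<in> seqv.span B" for v
    using that
  proof (induction rule: seqv.span_induct_alt)
    case base
    then show ?case by (simp add: lin_form_0[OF assms] \<psi>.zero seqv.subspace_0 assms(1))
  next
    case (step c x y)
    then have "x \<in> V" "\<psi> x = \<chi> x" using B \<psi>(2) by auto
    with step assms(1) show ?case
      by (simp add: \<psi>.add \<psi>.scale lin_form_add[OF assms(2)] lin_form_scale[OF assms(2)]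
          seqv.subspace_add seqv.subspace_scale)
  qed
  ultimately show ?thesis using that B(3) by blast
qed

lemma fd_space_image:
  assumes "fd_space V" "lin_map V W h" shows "fd_space (h ` V)"
proof -
  obtain B where B: "finite B" "V = seqv.span B" using assms(1) by (auto simp: fd_space_def)
  have V: "seqv.subspace V" using B by simp
  have "v \<in> V \<and> h v \<in> seqv.span (h ` B)" if "v \<in> seqv.span B" for v
    using that
  proof (induction rule: seqv.span_induct_alt)
    case base
    then show ?case by (simp add: lin_map_0[OF V assms(2)] seqv.span_zero seqv.subspace_0 V)
  next
    case (step c x y)
    then have x: "x \<in> V" using B seqv.span_base by blast
    with step V show ?case
      by (simp add: lin_map_add[OF assms(2)] lin_map_scale[OF assms(2)] seqv.subspace_add
          seqv.subspace_scale seqv.span_add seqv.span_scale seqv.span_base)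
  qed
  then have "h ` V \<subseteq> seqv.span (h ` B)" using B by blast
  then show ?thesis
    using fd_space_if_spanned[OF subspace_image[OF V assms(2)]] B(1) by blast
qed

lemma lin_form_separating:
  assumes "seqv.subspace W" "v \<notin> W"
  obtains \<phi> where "lin_form UNIV \<phi>" "\<phi> v = 1" "\<And>w. w \<in> W \<Longrightarrow> \<phi> w = 0"
proof -
  obtain B where B: "B \<subseteq> W" "seqv.independent B" "W \<subseteq> seqv.span B"
    using seqv.maximal_independent_subset by blast
  have BW: "seqv.span B = W" using seqv.span_minimal[OF B(1) assms(1)] B(3) by blast
  then have "seqv.independent (insert v B)" using B(2) assms(2) by (simp add: seqv.independent_insert)
  then obtain \<phi> where \<phi>: "Vector_Spaces.linear seq_scale (*) \<phi>"
      "\<forall>x\<in>insert v B. \<phi> x = (if x = v then 1 else 0)"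
    using seqform.linear_independent_extend[of "insert v B" "\<lambda>x. if x = v then 1 else 0"] by blast
  interpret \<phi>: Vector_Spaces.linear seq_scale "(*)" \<phi> by (rule \<phi>(1))
  have form: "lin_form UNIV \<phi>" by (auto simp: lin_form_def \<phi>.add \<phi>.scale)
  have "v \<notin> B" using BW assms(2) seqv.span_base by blast
  have "\<phi> w = 0" if "w \<in> seqv.span B" for w
    using that
  proof (induction rule: seqv.span_induct_alt)
    case (step c x y)
    then have "\<phi> x = 0" using \<phi>(2) \<open>v \<notin> B\<close> by auto
    with step show ?case by (simp add: \<phi>.add \<phi>.scale)
  qed (simp add: \<phi>.zero)
  with form \<phi>(2) that BW show ?thesis by auto
qed

text \<open>A form that vanishes on the kernel of \<open>\<alpha>\<close> is well defined on the image of \<open>\<alpha>\<close>, and extends from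
  there.\<close>

lemma lin_form_factor:
  assumes V: "seqv.subspace V" and \<alpha>: "lin_map V W \<alpha>" and \<phi>: "lin_form V \<phi>"
    and ker: "\<And>v. v \<in> V \<Longrightarrow> \<alpha> v = 0 \<Longrightarrow> \<phi> v = 0"
  obtains \<psi> where "lin_form UNIV \<psi>" "\<And>v. v \<in> V \<Longrightarrow> \<psi> (\<alpha> v) = \<phi> v"
proof -
  define s where "s w = (SOME v. v \<in> V \<and> \<alpha> v = w)" for w
  have s: "s w \<in> V \<and> \<alpha> (s w) = w" if "w \<in> \<alpha> ` V" for w
    unfolding s_def using someI_ex[of "\<lambda>v. v \<in> V \<and> \<alpha> v = w"] that by auto
  have eq: "\<phi> (s (\<alpha> v)) = \<phi> v" if "v \<in> V" for v
  proof -
    have "\<phi> (s (\<alpha> v) - v) = 0"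
      using s[of "\<alpha> v"] that by (intro ker) (auto simp: lin_map_diff[OF V \<alpha>] seqv.subspace_diff[OF V])
    then show ?thesis using s[of "\<alpha> v"] that by (simp add: lin_form_diff[OF V \<phi>])
  qed
  have "lin_form (\<alpha> ` V) (\<lambda>w. \<phi> (s w))"
    unfolding lin_form_def
  proof (intro conjI ballI allI)
    fix w w' assume "w \<in> \<alpha> ` V" "w' \<in> \<alpha> ` V"
    then obtain v v' where "v \<in> V" "w = \<alpha> v" "v' \<in> V" "w' = \<alpha> v'" by blast
    then show "\<phi> (s (w + w')) = \<phi> (s w) + \<phi> (s w')"
      using eq[of "v + v'"]
      by (simp add: eq lin_map_add[OF \<alpha>] lin_form_add[OF \<phi>] seqv.subspace_add[OF V])
  next
    fix c w assume "w \<in> \<alpha> ` V"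
    then obtain v where "v \<in> V" "w = \<alpha> v" by blast
    then show "\<phi> (s (seq_scale c w)) = c * \<phi> (s w)"
      using eq[of "seq_scale c v"]
      by (simp add: eq lin_map_scale[OF \<alpha>] lin_form_scale[OF \<phi>] seqv.subspace_scale[OF V])
  qed
  then obtain \<psi> where "lin_form UNIV \<psi>" "\<And>w. w \<in> \<alpha> ` V \<Longrightarrow> \<psi> w = \<phi> (s w)"
    using lin_form_extend[OF subspace_image[OF V \<alpha>]] by blast
  with eq that show ?thesis by auto
qed

text \<open>Quotients of spaces of sequences are again realised by sequences: \<open>\<pi>\<close> is the identity minus a
  projection onto \<open>W\<close>.\<close>

lemma quotient_map:
  assumes "seqv.subspace W"
  obtains \<pi> where "lin_map UNIV UNIV \<pi>" "\<And>v. \<pi> v = 0 \<longleftrightarrow> v \<in> W"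
proof -
  obtain B where B: "B \<subseteq> W" "seqv.independent B" "W \<subseteq> seqv.span B"
    using seqv.maximal_independent_subset by blast
  have BW: "seqv.span B = W" using seqv.span_minimal[OF B(1) assms(1)] B(3) by blast
  obtain g where g: "Vector_Spaces.linear seq_scale seq_scale g" "\<forall>x\<in>B. g x = x" "range g = W"
    using seqend.linear_independent_extend_subspace[OF B(2), of "\<lambda>x. x"] BW by auto
  interpret g: Vector_Spaces.linear seq_scale seq_scale g by (rule g(1))
  have gW: "g w = w" if "w \<in> seqv.span B" for w
    using that
  proof (induction rule: seqv.span_induct_alt)
    case (step c x y)
    then show ?case using g(2) by (simp add: g.add g.scale)
  qed (simp add: g.zero)
  have "lin_map UNIV UNIV (\<lambda>v. v - g v)"
    by (auto simp: lin_map_def g.add g.scale seqv.scale_right_diff_distrib)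
  moreover have "v - g v = 0 \<longleftrightarrow> v \<in> W" for v
    using gW BW g(3) by (metis eq_iff_diff_eq_0 rangeI)
  ultimately show ?thesis using that by blast
qed

text \<open>Vectors with a dual family of forms are linearly independent. This bound makes the repeated
  splitting of a module terminate.\<close>

lemma dual_family_bounded:
  fixes V :: "'k::field seq set"
  assumes "fd_space V"
  obtains d where "\<And>(R :: nat set) u \<phi>. finite R \<Longrightarrow> (\<And>r. r \<in> R \<Longrightarrow> u r \<in> V) \<Longrightarrow>
      (\<And>r. r \<in> R \<Longrightarrow> lin_form V (\<phi> r)) \<Longrightarrow>
      (\<And>r s. r \<in> R \<Longrightarrow> s \<in> R \<Longrightarrow> \<phi> r (u s) = (if r = s then 1 else 0)) \<Longrightarrow> card R \<le> d"
proof -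
  obtain B where B: "finite B" "V = seqv.span B" using assms by (auto simp: fd_space_def)
  have V: "seqv.subspace V" using B by simp
  have "card R \<le> card B" if R: "finite R" and u: "\<And>r. r \<in> R \<Longrightarrow> u r \<in> V"
    and \<phi>: "\<And>r. r \<in> R \<Longrightarrow> lin_form V (\<phi> r)"
    and dual: "\<And>r s. r \<in> R \<Longrightarrow> s \<in> R \<Longrightarrow> \<phi> r (u s) = (if r = s then 1 else 0)"
    for R :: "nat set" and u \<phi>
  proof -
    have inj: "inj_on u R" using dual by (metis (full_types) inj_on_def zero_neq_one)
    have "seqv.independent (u ` R)"
    proof (rule seqv.independent_if_scalars_zero)
      fix f x assume sum: "(\<Sum>x\<in>u ` R. seq_scale (f x) x) = 0" and "x \<in> u ` R"
      then obtain r where r: "r \<in> R" "x = u r" by blast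
      have "0 = \<phi> r (\<Sum>s\<in>R. seq_scale (f (u s)) (u s))"
        using sum lin_form_0[OF V \<phi>[OF r(1)]] by (simp add: sum.reindex[OF inj])
      also have "\<dots> = (\<Sum>s\<in>R. \<phi> r (seq_scale (f (u s)) (u s)))"
        using u by (intro lin_form_sum[OF V \<phi>[OF r(1)]] seqv.subspace_scale[OF V]) auto
      also have "\<dots> = (\<Sum>s\<in>R. if s = r then f (u s) else 0)"
        using u dual r(1) by (intro sum.cong) (auto simp: lin_form_scale[OF \<phi>[OF r(1)]])
      also have "\<dots> = f x" using R r by simp
      finally show "f x = 0" by simp
    qed (use R in simp)
    moreover have "u ` R \<subseteq> seqv.span B" using u B by blast
    ultimately have "card (u ` R) \<le> card B" using seqv.independent_span_bound[OF B(1)] by blast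
    then show ?thesis using card_image[OF inj] by simp
  qed
  then show ?thesis using that by blast
qed


section \<open>Modules over a poset\<close>

lemma pmod_fd: "is_pmod P M \<Longrightarrow> p \<in> Field P \<Longrightarrow> fd_space (sp M p)"
  and pmod_lin: "is_pmod P M \<Longrightarrow> (p, q) \<in> P \<Longrightarrow> lin_map (sp M p) (sp M q) (tr M p q)"
  and pmod_tr_id: "is_pmod P M \<Longrightarrow> p \<in> Field P \<Longrightarrow> v \<in> sp M p \<Longrightarrow> tr M p p v = v"
  and pmod_tr_tr: "is_pmod P M \<Longrightarrow> (p, q) \<in> P \<Longrightarrow> (q, r) \<in> P \<Longrightarrow> v \<in> sp M p \<Longrightarrow>
     tr M q r (tr M p q v) = tr M p r v"
  by (auto simp: is_pmod_def)

lemma pmod_subspace: "is_pmod P M \<Longrightarrow> p \<in> Field P \<Longrightarrow> seqv.subspace (sp M p)"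
  by (simp add: pmod_fd fd_space_subspace)

lemma pmod_tr_in: "is_pmod P M \<Longrightarrow> (p, q) \<in> P \<Longrightarrow> v \<in> sp M p \<Longrightarrow> tr M p q v \<in> sp M q"
  by (meson pmod_lin lin_map_in)

lemma pmod_0_in: "is_pmod P M \<Longrightarrow> p \<in> Field P \<Longrightarrow> 0 \<in> sp M p"
  by (simp add: pmod_subspace seqv.subspace_0)

lemma pmod_tr_0: "is_pmod P M \<Longrightarrow> (p, q) \<in> P \<Longrightarrow> tr M p q 0 = 0"
  by (meson FieldI1 lin_map_0 pmod_lin pmod_subspace)

lemma hom_lin: "pmod_hom P M N h \<Longrightarrow> p \<in> Field P \<Longrightarrow> lin_map (sp M p) (sp N p) (h p)"
  and hom_tr: "pmod_hom P M N h \<Longrightarrow> (p, q) \<in> P \<Longrightarrow> v \<in> sp M p \<Longrightarrow>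
     h q (tr M p q v) = tr N p q (h p v)"
  by (auto simp: pmod_hom_def)

lemma hom_in: "pmod_hom P M N h \<Longrightarrow> p \<in> Field P \<Longrightarrow> v \<in> sp M p \<Longrightarrow> h p v \<in> sp N p"
  by (meson hom_lin lin_map_in)

lemma hom_0: "is_pmod P M \<Longrightarrow> pmod_hom P M N h \<Longrightarrow> p \<in> Field P \<Longrightarrow> h p 0 = 0"
  by (meson hom_lin lin_map_0 pmod_subspace)

lemma hom_comp:
  "pmod_hom P L M g \<Longrightarrow> pmod_hom P M N h \<Longrightarrow> pmod_hom P L N (\<lambda>p v. h p (g p v))"
  unfolding pmod_hom_def[of P L N]
  by (auto intro: lin_map_comp[OF hom_lin hom_lin] simp: hom_tr hom_in FieldI1)

lemma hom_id: "pmod_hom P M M (\<lambda>p v. v)"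
  by (auto simp: pmod_hom_def lin_map_def)

lemma pmod_isoI:
  assumes "pmod_hom P M N h" "pmod_hom P N M g"
    and "\<And>p v. p \<in> Field P \<Longrightarrow> v \<in> sp M p \<Longrightarrow> g p (h p v) = v"
    and "\<And>p v. p \<in> Field P \<Longrightarrow> v \<in> sp N p \<Longrightarrow> h p (g p v) = v"
  shows "pmod_iso P M N"
  unfolding pmod_iso_def
proof (intro exI[of _ h] conjI ballI)
  fix p assume "p \<in> Field P"
  then show "bij_betw (h p) (sp M p) (sp N p)"
    using assms by (intro bij_betw_byWitness[where f' = "g p"]) (auto simp: hom_in)
qed (rule assms(1))

lemma pmod_isoE:
  assumes "is_pmod P M" "pmod_iso P M N"
  obtains h g where "pmod_hom P M N h" "pmod_hom P N M g"
    "\<And>p v. p \<in> Field P \<Longrightarrow> v \<in> sp M p \<Longrightarrow> g p (h p v) = v"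
    "\<And>p v. p \<in> Field P \<Longrightarrow> v \<in> sp N p \<Longrightarrow> h p (g p v) = v"
proof -
  obtain h where h: "pmod_hom P M N h" and bij: "\<And>p. p \<in> Field P \<Longrightarrow> bij_betw (h p) (sp M p) (sp N p)"
    using assms(2) unfolding pmod_iso_def by blast
  define g where "g p = inv_into (sp M p) (h p)" for p
  have gin: "g p v \<in> sp M p" and hg: "h p (g p v) = v" if "p \<in> Field P" "v \<in> sp N p" for p v
    using bij[OF that(1)] that(2) unfolding g_def
    by (metis bij_betw_def inv_into_into, metis bij_betw_inv_into_right)
  have gh: "g p (h p v) = v" if "p \<in> Field P" "v \<in> sp M p" for p v
    using bij[OF that(1)] that(2) unfolding g_def by (metis bij_betw_inv_into_left)
  have "lin_map (sp N p) (sp M p) (g p)" if p: "p \<in> Field P" for p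
    unfolding lin_map_def
  proof (intro conjI ballI allI)
    show "g p ` sp N p \<subseteq> sp M p" using gin[OF p] by blast
  next
    fix u v assume "u \<in> sp N p" "v \<in> sp N p"
    then show "g p (u + v) = g p u + g p v"
      using gh[OF p, of "g p u + g p v"] gin[OF p] hg[OF p] lin_map_add[OF hom_lin[OF h p]]
        seqv.subspace_add[OF pmod_subspace[OF assms(1) p]] by simp
  next
    fix c v assume "v \<in> sp N p"
    then show "g p (seq_scale c v) = seq_scale c (g p v)"
      using gh[OF p, of "seq_scale c (g p v)"] gin[OF p] hg[OF p] lin_map_scale[OF hom_lin[OF h p]]
        seqv.subspace_scale[OF pmod_subspace[OF assms(1) p]] by simp
  qed
  moreover have "g q (tr N p q v) = tr M p q (g p v)" if pq: "(p, q) \<in> P" and v: "v \<in> sp N p" for p q v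
  proof -
    have f: "p \<in> Field P" "q \<in> Field P" using pq by (auto simp: Field_def)
    have "tr N p q v = h q (tr M p q (g p v))"
      using hom_tr[OF h pq gin[OF f(1) v]] hg[OF f(1) v] by simp
    then show ?thesis using gh[OF f(2)] pmod_tr_in[OF assms(1) pq] gin[OF f(1) v] by simp
  qed
  ultimately have "pmod_hom P N M g" by (auto simp: pmod_hom_def)
  with h gh hg that show ?thesis by blast
qed

lemma pmod_iso_refl: "pmod_iso P M M"
  by (rule pmod_isoI[OF hom_id hom_id]) auto

lemma pmod_iso_sym: "is_pmod P M \<Longrightarrow> pmod_iso P M N \<Longrightarrow> pmod_iso P N M"
  by (erule (1) pmod_isoE) (rule pmod_isoI)

lemma pmod_iso_trans: "pmod_iso P L M \<Longrightarrow> pmod_iso P M N \<Longrightarrow> pmod_iso P L N"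
  unfolding pmod_iso_def
proof (elim exE conjE)
  fix g h assume "pmod_hom P L M g" "pmod_hom P M N h"
    and b: "\<forall>p\<in>Field P. bij_betw (g p) (sp L p) (sp M p)" "\<forall>p\<in>Field P. bij_betw (h p) (sp M p) (sp N p)"
  then have "pmod_hom P L N (\<lambda>p v. h p (g p v))" by (simp add: hom_comp)
  moreover have "bij_betw (\<lambda>v. h p (g p v)) (sp L p) (sp N p)" if "p \<in> Field P" for p
    using bij_betw_trans[OF b(1)[rule_format, OF that] b(2)[rule_format, OF that]] by (simp add: comp_def)
  ultimately show "\<exists>h. pmod_hom P L N h \<and> (\<forall>p\<in>Field P. bij_betw (h p) (sp L p) (sp N p))" by blast
qed

lemma isoclass_eq_iff:
  assumes "is_pmod P M" "is_pmod P N"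
  shows "isoclass P M = isoclass P N \<longleftrightarrow> pmod_iso P M N"
proof
  assume "isoclass P M = isoclass P N"
  moreover have "N \<in> isoclass P N" using assms by (simp add: isoclass_def pmod_iso_refl)
  ultimately show "pmod_iso P M N" unfolding isoclass_def by blast
next
  assume iso: "pmod_iso P M N"
  then have iso': "pmod_iso P N M" using assms pmod_iso_sym by blast
  show "isoclass P M = isoclass P N"
    unfolding isoclass_def using pmod_iso_trans[OF iso] pmod_iso_trans[OF iso'] by blast
qed

lemma seq_fst_pair [simp]: "seq_fst (seq_pair v w) = v"
  and seq_snd_pair [simp]: "seq_snd (seq_pair v w) = w"
  by (auto simp: seq_fst_def seq_snd_def seq_pair_def)

lemma seq_pair_collapse [simp]: "seq_pair (seq_fst u) (seq_snd u) = u"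
proof
  fix n show "seq_pair (seq_fst u) (seq_snd u) n = u n"
    by (auto simp: seq_fst_def seq_snd_def seq_pair_def split: sum.split)
      (metis sum_decode_inverse)+
qed

lemma seq_fst_add [simp]: "seq_fst (u + v) = seq_fst u + seq_fst v"
  and seq_snd_add [simp]: "seq_snd (u + v) = seq_snd u + seq_snd v"
  and seq_fst_scale [simp]: "seq_fst (seq_scale c u) = seq_scale c (seq_fst u)"
  and seq_snd_scale [simp]: "seq_snd (seq_scale c u) = seq_scale c (seq_snd u)"
  and seq_fst_0 [simp]: "seq_fst 0 = (0 :: 'k::field seq)"
  and seq_snd_0 [simp]: "seq_snd 0 = (0 :: 'k::field seq)"
  for u v :: "'k::field seq"
  by (auto simp: seq_fst_def seq_snd_def seq_scale_def fun_eq_iff plus_fun_apply zero_fun_apply)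

lemma seq_fst_diff [simp]: "seq_fst (u - v) = seq_fst u - seq_fst v"
  and seq_snd_diff [simp]: "seq_snd (u - v) = seq_snd u - seq_snd v"
  for u v :: "'k::field seq"
  by (auto simp: seq_fst_def seq_snd_def fun_eq_iff minus_apply)

lemma seq_eqI: "seq_fst u = seq_fst v \<Longrightarrow> seq_snd u = seq_snd v \<Longrightarrow> u = v"
  by (metis seq_pair_collapse)

lemma seq_pair_add: "seq_pair (v + v') (w + w') = seq_pair v w + seq_pair v' w'"
  and seq_pair_scale: "seq_pair (seq_scale c v) (seq_scale c w) = seq_scale c (seq_pair v w)"
  and seq_pair_0 [simp]: "seq_pair 0 0 = (0 :: 'k::field seq)"
  for v w :: "'k::field seq"
  by (auto intro: seq_eqI)

lemma seq_pair_add_simp [simp]: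
  "seq_pair v w + seq_pair v' w' = seq_pair (v + v') (w + w')"
  "seq_scale c (seq_pair v w) = seq_pair (seq_scale c v) (seq_scale c w)"
  for v w :: "'k::field seq"
  by (simp_all add: seq_pair_add seq_pair_scale)

lemma in_sp_sum [simp]:
  "u \<in> sp (pmod_sum M N) p \<longleftrightarrow> seq_fst u \<in> sp M p \<and> seq_snd u \<in> sp N p"
  by (auto simp: pmod_sum_def) (metis seq_pair_collapse)

lemma tr_sum [simp]:
  "tr (pmod_sum M N) p q u = seq_pair (tr M p q (seq_fst u)) (tr N p q (seq_snd u))"
  by (simp add: pmod_sum_def)

lemma fd_space_pair:
  assumes "fd_space V" "fd_space W"
  shows "fd_space {u. seq_fst u \<in> V \<and> seq_snd u \<in> W}"
proof -
  obtain B C where B: "finite B" "V = seqv.span B" and C: "finite C" "W = seqv.span C"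
    using assms by (auto simp: fd_space_def)
  let ?i = "\<lambda>v. seq_pair v 0" and ?j = "\<lambda>w. seq_pair 0 w"
  let ?S = "seqv.span (?i ` B \<union> ?j ` C)"
  have i: "?i v \<in> ?S" if "v \<in> seqv.span B" for v
    using that
  proof (induction rule: seqv.span_induct_alt)
    case (step c x y)
    have "seq_scale c (?i x) + ?i y \<in> ?S"
      using step(1,2) by (intro seqv.span_add seqv.span_scale) (blast intro: seqv.span_base)+
    then show ?case by simp
  qed (simp add: seqv.span_zero)
  have j: "?j v \<in> ?S" if "v \<in> seqv.span C" for v
    using that
  proof (induction rule: seqv.span_induct_alt)
    case (step c x y)
    have "seq_scale c (?j x) + ?j y \<in> ?S"
      using step(1,2) by (intro seqv.span_add seqv.span_scale) (blast intro: seqv.span_base)+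
    then show ?case by simp
  qed (simp add: seqv.span_zero)
  have "u \<in> ?S" if "seq_fst u \<in> V" "seq_snd u \<in> W" for u
  proof -
    have "u = ?i (seq_fst u) + ?j (seq_snd u)" by simp
    also have "\<dots> \<in> ?S" using that i j B C by (metis seqv.span_add)
    finally show ?thesis .
  qed
  moreover have "seqv.subspace {u. seq_fst u \<in> V \<and> seq_snd u \<in> W}"
    using assms[THEN fd_space_subspace] by (auto simp: seqv.subspace_def)
  ultimately show ?thesis
    using B C by (intro fd_space_if_spanned[where B = "?i ` B \<union> ?j ` C"]) auto
qed

lemma is_pmod_sum:
  assumes "is_pmod P M" "is_pmod P N" shows "is_pmod P (pmod_sum M N)"
  unfolding is_pmod_def
proof (intro conjI ballI allI impI)
  fix p assume "p \<in> Field P"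
  moreover have "sp (pmod_sum M N) p = {u. seq_fst u \<in> sp M p \<and> seq_snd u \<in> sp N p}" by auto
  ultimately show "fd_space (sp (pmod_sum M N) p)"
    using fd_space_pair[of "sp M p" "sp N p"] assms by (simp add: pmod_fd)
next
  fix x assume "x \<in> P"
  then obtain p q where x: "x = (p, q)" "(p, q) \<in> P" by (cases x) auto
  show "case x of (p, q) \<Rightarrow> lin_map (sp (pmod_sum M N) p) (sp (pmod_sum M N) q) (tr (pmod_sum M N) p q)"
    using pmod_lin[OF assms(1) x(2)] pmod_lin[OF assms(2) x(2)]
    by (auto simp: x(1) lin_map_def image_subset_iff)
qed (use assms in \<open>auto simp: pmod_tr_id pmod_tr_tr\<close>)

lemma is_pmod_zero: "is_pmod P zero_pmod"
proof -
  have "fd_space {0}" unfolding fd_space_def by (intro exI[of _ "{}"]) auto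
  then show ?thesis by (auto simp: is_pmod_def zero_pmod_def lin_map_def zero_fun_apply)
qed

lemma iso_zero_iff:
  assumes "is_pmod P M"
  shows "pmod_iso P M zero_pmod \<longleftrightarrow> (\<forall>p\<in>Field P. sp M p = {0})"
proof
  assume iso: "pmod_iso P M zero_pmod"
  show "\<forall>p\<in>Field P. sp M p = {0}"
  proof
    fix p assume p: "p \<in> Field P"
    then obtain h where "bij_betw h (sp M p) (sp (zero_pmod :: ('a,'b) pmod) p)"
      using iso unfolding pmod_iso_def by blast
    then have "is_singleton (sp M p)"
      by (metis (no_types) bij_betw_same_card is_singleton_altdef card_1_singleton_iff
          zero_pmod_def pmod.select_convs(1) card.empty card_insert_disjoint finite.emptyI emptyE One_nat_def)
    then show "sp M p = {0}" using pmod_0_in[OF assms p] by (auto simp: is_singleton_def)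
  qed
next
  assume 0: "\<forall>p\<in>Field P. sp M p = {0}"
  have "pmod_hom P M zero_pmod (\<lambda>p v. 0)" "pmod_hom P zero_pmod M (\<lambda>p v. 0)"
    using pmod_0_in[OF assms] pmod_tr_0[OF assms]
    by (auto simp: pmod_hom_def lin_map_def zero_pmod_def zero_fun_apply Field_def)
  then show "pmod_iso P M zero_pmod"
    by (rule pmod_isoI) (use 0 in \<open>auto simp: zero_pmod_def\<close>)
qed

lemma iso_sum_cong:
  assumes "is_pmod P M" "is_pmod P N" "pmod_iso P M M'" "pmod_iso P N N'"
  shows "pmod_iso P (pmod_sum M N) (pmod_sum M' N')"
proof -
  obtain h g where hg: "pmod_hom P M M' h" "pmod_hom P M' M g"
    "\<And>p v. p \<in> Field P \<Longrightarrow> v \<in> sp M p \<Longrightarrow> g p (h p v) = v"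
    "\<And>p v. p \<in> Field P \<Longrightarrow> v \<in> sp M' p \<Longrightarrow> h p (g p v) = v"
    using pmod_isoE[OF assms(1,3)] by metis
  obtain h' g' where hg': "pmod_hom P N N' h'" "pmod_hom P N' N g'"
    "\<And>p v. p \<in> Field P \<Longrightarrow> v \<in> sp N p \<Longrightarrow> g' p (h' p v) = v"
    "\<And>p v. p \<in> Field P \<Longrightarrow> v \<in> sp N' p \<Longrightarrow> h' p (g' p v) = v"
    using pmod_isoE[OF assms(2,4)] by metis
  have *: "pmod_hom P (pmod_sum A B) (pmod_sum A' B')
      (\<lambda>p u. seq_pair (a p (seq_fst u)) (b p (seq_snd u)))"
    if "pmod_hom P A A' a" "pmod_hom P B B' b" for A A' B B' :: "('a, 'b) pmod" and a b
    unfolding pmod_hom_def[of P "pmod_sum A B"]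
    using that[THEN hom_lin] that[THEN hom_tr]
    by (auto simp: lin_map_def image_subset_iff)
  show ?thesis
    by (rule pmod_isoI[OF *[OF hg(1) hg'(1)] *[OF hg(2) hg'(2)]]) (use hg hg' in auto)
qed

lemma iso_sum_assoc: "pmod_iso P (pmod_sum (pmod_sum A B) C) (pmod_sum A (pmod_sum B C))"
  by (rule pmod_isoI[where
        h = "\<lambda>p u. seq_pair (seq_fst (seq_fst u)) (seq_pair (seq_snd (seq_fst u)) (seq_snd u))" and
        g = "\<lambda>p u. seq_pair (seq_pair (seq_fst u) (seq_fst (seq_snd u))) (seq_snd (seq_snd u))"])
    (auto simp: pmod_hom_def lin_map_def image_subset_iff)

lemma iso_sum_comm: "pmod_iso P (pmod_sum A B) (pmod_sum B A)"
  by (rule pmod_isoI[where h = "\<lambda>p u. seq_pair (seq_snd u) (seq_fst u)" and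
        g = "\<lambda>p u. seq_pair (seq_snd u) (seq_fst u)"])
    (auto simp: pmod_hom_def lin_map_def image_subset_iff)

lemma iso_sum_zero:
  assumes "is_pmod P M" "is_pmod P N" "pmod_iso P N zero_pmod"
  shows "pmod_iso P (pmod_sum M N) M"
proof -
  have N: "sp N p = {0}" if "p \<in> Field P" for p using assms iso_zero_iff that by blast
  show ?thesis
    by (rule pmod_isoI[where h = "\<lambda>p u. seq_fst u" and g = "\<lambda>p u. seq_pair u 0"])
      (use N in \<open>auto simp: pmod_hom_def lin_map_def image_subset_iff pmod_tr_0[OF assms(2)]
        FieldI1 intro: seq_eqI\<close>)
qed

lemma iso_sum_left_commute:
  assumes "is_pmod P A" "is_pmod P B" "is_pmod P C"
  shows "pmod_iso P (pmod_sum A (pmod_sum B C)) (pmod_sum B (pmod_sum A C))"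
proof -
  have "pmod_iso P (pmod_sum A (pmod_sum B C)) (pmod_sum (pmod_sum A B) C)"
    using assms by (intro pmod_iso_sym[OF _ iso_sum_assoc] is_pmod_sum)
  also have "pmod_iso P \<dots> (pmod_sum (pmod_sum B A) C)"
    using assms by (intro iso_sum_cong is_pmod_sum iso_sum_comm pmod_iso_refl)
  also (pmod_iso_trans) have "pmod_iso P \<dots> (pmod_sum B (pmod_sum A C))"
    by (rule iso_sum_assoc)
  finally (pmod_iso_trans) show ?thesis .
qed

lemma is_pmod_power: "is_pmod P U \<Longrightarrow> is_pmod P (pmod_power U n)"
  by (induction n) (auto simp: is_pmod_zero is_pmod_sum)

lemma iso_power_cong: "is_pmod P U \<Longrightarrow> pmod_iso P U U' \<Longrightarrow> pmod_iso P (pmod_power U n) (pmod_power U' n)"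
  by (induction n) (auto simp: pmod_iso_refl iso_sum_cong is_pmod_power)

section \<open>Interval modules\<close>

definition unit_seq :: "'k::field seq" where
  "unit_seq = (\<lambda>n. if n = 0 then 1 else 0)"

text \<open>The ground field, realised as a space of sequences.\<close>

definition line :: "'k::field seq set" where
  "line = range (\<lambda>c. seq_scale c unit_seq)"

lemma unit_seq_0 [simp]: "unit_seq 0 = 1"
  by (simp add: unit_seq_def)

lemma seq_scale_at: "seq_scale c v n = c * v n"
  by (simp add: seq_scale_def)

lemma line_scale [simp]: "seq_scale c unit_seq \<in> line"
  unfolding line_def by (rule rangeI)

lemma unit_in_line [simp]: "unit_seq \<in> line"
  using line_scale[of 1] by simp

lemma in_lineD: "v \<in> line \<Longrightarrow> v = seq_scale (v 0) unit_seq"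
  by (auto simp: line_def seq_scale_at)

lemma fd_space_line: "fd_space line"
  unfolding fd_space_def line_def by (intro exI[of _ "{unit_seq}"]) (auto simp: seqv.span_singleton)

lemma unit_seq_neq_0 [simp]: "unit_seq \<noteq> 0"
  by (metis unit_seq_0 zero_fun_apply zero_neq_one)

definition interval_pmod :: "'p set \<Rightarrow> ('p, 'k::field) pmod" where
  "interval_pmod I = \<lparr>sp = (\<lambda>p. if p \<in> I then line else {0}),
     tr = (\<lambda>p q v. if p \<in> I \<and> q \<in> I then v else 0)\<rparr>"

definition convex_in :: "'p rel \<Rightarrow> 'p set \<Rightarrow> bool" where
  "convex_in P I \<longleftrightarrow> (\<forall>p q r. (p, q) \<in> P \<longrightarrow> (q, r) \<in> P \<longrightarrow> p \<in> I \<longrightarrow> r \<in> I \<longrightarrow> q \<in> I)"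

lemma sp_interval: "sp (interval_pmod I) p = (if p \<in> I then line else {0})"
  and tr_interval: "tr (interval_pmod I) p q v = (if p \<in> I \<and> q \<in> I then v else 0)"
  by (simp_all add: interval_pmod_def)

lemma is_pmod_interval:
  assumes "convex_in P I" shows "is_pmod P (interval_pmod I)"
proof -
  have "fd_space {0}" unfolding fd_space_def by (intro exI[of _ "{}"]) auto
  moreover have "0 \<in> line" using line_scale[of 0] by simp
  ultimately show ?thesis
    using assms
    by (auto simp: is_pmod_def interval_pmod_def fd_space_line lin_map_def convex_in_def)
qed

text \<open>The \<open>u p\<close> form a homomorphism from the interval module to \<open>M\<close>, the \<open>\<phi> p\<close> a homomorphism back, and
  the composite is the identity. So the interval module is a direct summand, with complement the kernel
  of \<open>\<phi>\<close>.\<close>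

lemma interval_split_off:
  assumes M: "is_pmod P M" and I: "I \<subseteq> Field P"
    and u: "\<And>p. p \<in> I \<Longrightarrow> u p \<in> sp M p"
    and tr_u: "\<And>p q. (p, q) \<in> P \<Longrightarrow> p \<in> I \<Longrightarrow> tr M p q (u p) = (if q \<in> I then u q else 0)"
    and \<phi>: "\<And>p. p \<in> I \<Longrightarrow> lin_form (sp M p) (\<phi> p)"
    and \<phi>_tr: "\<And>p q v. (p, q) \<in> P \<Longrightarrow> q \<in> I \<Longrightarrow> v \<in> sp M p \<Longrightarrow>
       \<phi> q (tr M p q v) = (if p \<in> I then \<phi> p v else 0)"
    and one: "\<And>p. p \<in> I \<Longrightarrow> \<phi> p (u p) = 1"
  obtains N where "is_pmod P N" "pmod_iso P M (pmod_sum (interval_pmod I) N)"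
proof
  define N where "N = \<lparr>sp = (\<lambda>p. {v \<in> sp M p. p \<in> I \<longrightarrow> \<phi> p v = 0}), tr = tr M\<rparr>"
  have spN: "v \<in> sp N p \<longleftrightarrow> v \<in> sp M p \<and> (p \<in> I \<longrightarrow> \<phi> p v = 0)" and trN: "tr N = tr M" for p v
    by (auto simp: N_def)
  show "is_pmod P N"
    unfolding is_pmod_def
  proof (intro conjI ballI allI impI)
    fix p assume p: "p \<in> Field P"
    have "seqv.subspace (sp N p)"
    proof (cases "p \<in> I")
      case True
      then show ?thesis
        using subspace_form_ker[OF pmod_subspace[OF M p] \<phi>[OF True]] by (simp add: N_def)
    qed (simp add: N_def pmod_subspace[OF M p])
    then show "fd_space (sp N p)"
      using fd_space_subset[OF pmod_fd[OF M p]] spN by blast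
  next
    fix x assume "x \<in> P"
    then obtain p q where x: "x = (p, q)" and pq: "(p, q) \<in> P" by (cases x) auto
    have "tr M p q v \<in> sp N q" if "v \<in> sp N p" for v
      using that \<phi>_tr[OF pq] pmod_tr_in[OF M pq] by (auto simp: spN)
    then show "case x of (p, q) \<Rightarrow> lin_map (sp N p) (sp N q) (tr N p q)"
      using pmod_lin[OF M pq] by (auto simp: x trN lin_map_def spN)
  qed (use M in \<open>auto simp: spN trN pmod_tr_id pmod_tr_tr\<close>)
  define a where "a p v = (if p \<in> I then \<phi> p v else 0)" for p v
  define w where "w p = (if p \<in> I then u p else 0)" for p
  have w: "w p \<in> sp M p" if "p \<in> Field P" for p
    using that u pmod_0_in[OF M] by (auto simp: w_def)
  have a: "lin_form (sp M p) (a p)" if "p \<in> Field P" for p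
    using \<phi>[of p] by (auto simp: a_def lin_form_def)
  have aw: "p \<in> I \<Longrightarrow> a p (w p) = 1" and nI: "p \<notin> I \<Longrightarrow> w p = 0 \<and> a p v = 0" for p v
    using one by (auto simp: a_def w_def)
  have tr_w: "tr M p q (seq_scale (a p v) (w p)) = seq_scale (a q (tr M p q v)) (w q)"
    and a_tr: "p \<in> I \<Longrightarrow> q \<in> I \<Longrightarrow> a q (tr M p q v) = a p v"
    and a_tr': "p \<notin> I \<or> q \<notin> I \<Longrightarrow> a q (tr M p q v) = 0"
    if pq: "(p, q) \<in> P" and v: "v \<in> sp M p" for p q v
  proof -
    have p: "p \<in> Field P" using pq by (auto simp: Field_def)
    show "p \<in> I \<Longrightarrow> q \<in> I \<Longrightarrow> a q (tr M p q v) = a p v"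
      and "p \<notin> I \<or> q \<notin> I \<Longrightarrow> a q (tr M p q v) = 0"
      using \<phi>_tr[OF pq] v by (auto simp: a_def)
    then show "tr M p q (seq_scale (a p v) (w p)) = seq_scale (a q (tr M p q v)) (w q)"
      using lin_map_scale[OF pmod_lin[OF M pq] w[OF p]] tr_u[OF pq] pmod_tr_0[OF M pq]
      by (cases "p \<in> I"; cases "q \<in> I") (auto simp: nI w_def)
  qed
  show "pmod_iso P M (pmod_sum (interval_pmod I) N)"
  proof (rule pmod_isoI)
    let ?h = "\<lambda>p v. seq_pair (seq_scale (a p v) unit_seq) (v - seq_scale (a p v) (w p))"
    let ?g = "\<lambda>p x. seq_scale (seq_fst x 0) (w p) + seq_snd x"
    show "pmod_hom P M (pmod_sum (interval_pmod I) N) ?h"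
      unfolding pmod_hom_def
    proof (intro conjI ballI)
      fix p assume p: "p \<in> Field P"
      note sub = pmod_subspace[OF M p]
      have in_N: "v - seq_scale (a p v) (w p) \<in> sp N p" if "v \<in> sp M p" for v
      proof -
        have "seq_scale (a p v) (w p) \<in> sp M p" using w[OF p] sub seqv.subspace_scale by blast
        then have "v - seq_scale (a p v) (w p) \<in> sp M p"
          and "a p (v - seq_scale (a p v) (w p)) = a p v - a p v * a p (w p)"
          using that sub w[OF p]
          by (simp_all add: seqv.subspace_diff lin_form_diff[OF sub a[OF p]] lin_form_scale[OF a[OF p]])
        then show ?thesis using aw[of p] by (auto simp: spN a_def)
      qed
      show "lin_map (sp M p) (sp (pmod_sum (interval_pmod I) N) p) (?h p)"
        unfolding lin_map_def
      proof (intro conjI ballI allI)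
        show "?h p ` sp M p \<subseteq> sp (pmod_sum (interval_pmod I) N) p"
          using in_N nI[of p] by (auto simp: sp_interval)
      qed (simp_all add: lin_form_add[OF a[OF p]] lin_form_scale[OF a[OF p]] seqv.scale_left_distrib
          seqv.scale_right_diff_distrib add_diff_add)
    next
      fix x assume "x \<in> P"
      then obtain p q where x: "x = (p, q)" and pq: "(p, q) \<in> P" by (cases x) auto
      have p: "p \<in> Field P" using pq by (auto simp: Field_def)
      note sub = pmod_subspace[OF M p]
      have "?h q (tr M p q v) = tr (pmod_sum (interval_pmod I) N) p q (?h p v)" if v: "v \<in> sp M p" for v
      proof -
        have "seq_scale (a p v) (w p) \<in> sp M p" using w[OF p] sub seqv.subspace_scale by blast
        then have "tr M p q (v - seq_scale (a p v) (w p)) = tr M p q v - seq_scale (a q (tr M p q v)) (w q)"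
          using lin_map_diff[OF sub pmod_lin[OF M pq] v] tr_w[OF pq v] by simp
        moreover have "seq_scale (a q (tr M p q v)) unit_seq
            = tr (interval_pmod I) p q (seq_scale (a p v) unit_seq)"
          using a_tr[OF pq v] a_tr'[OF pq v] by (auto simp: tr_interval)
        ultimately show ?thesis by (simp add: trN)
      qed
      then show "case x of (p, q) \<Rightarrow> \<forall>v\<in>sp M p. ?h q (tr M p q v) =
          tr (pmod_sum (interval_pmod I) N) p q (?h p v)" by (simp add: x)
    qed
    show "pmod_hom P (pmod_sum (interval_pmod I) N) M ?g"
      unfolding pmod_hom_def
    proof (intro conjI ballI)
      fix p assume p: "p \<in> Field P"
      note sub = pmod_subspace[OF M p]
      show "lin_map (sp (pmod_sum (interval_pmod I) N) p) (sp M p) (?g p)"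
        unfolding lin_map_def
        using w[OF p] sub
        by (auto simp: spN seqv.subspace_add seqv.subspace_scale plus_fun_apply seq_scale_at
            seqv.scale_left_distrib seqv.scale_right_distrib)
    next
      fix x assume "x \<in> P"
      then obtain p q where x: "x = (p, q)" and pq: "(p, q) \<in> P" by (cases x) auto
      have p: "p \<in> Field P" using pq by (auto simp: Field_def)
      note sub = pmod_subspace[OF M p]
      have "?g q (tr (pmod_sum (interval_pmod I) N) p q y) = tr M p q (?g p y)"
        if y: "seq_fst y \<in> sp (interval_pmod I) p" "seq_snd y \<in> sp N p" for y
      proof -
        let ?c = "seq_fst y 0"
        have "tr M p q (?g p y) = seq_scale ?c (tr M p q (w p)) + tr M p q (seq_snd y)"
          using y w[OF p] sub lin_map_add[OF pmod_lin[OF M pq]] lin_map_scale[OF pmod_lin[OF M pq]]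
          by (simp add: spN seqv.subspace_scale)
        moreover have "seq_scale ?c (tr M p q (w p)) =
            seq_scale (tr (interval_pmod I) p q (seq_fst y) 0) (w q)"
          using y(1) tr_u[OF pq] pmod_tr_0[OF M pq]
          by (auto simp: tr_interval sp_interval w_def zero_fun_apply)
        ultimately show ?thesis by (simp add: trN)
      qed
      then show "case x of (p, q) \<Rightarrow> \<forall>v\<in>sp (pmod_sum (interval_pmod I) N) p.
          ?g q (tr (pmod_sum (interval_pmod I) N) p q v) = tr M p q (?g p v)" by (simp add: x)
    qed
    show "?g p (?h p v) = v" if "p \<in> Field P" "v \<in> sp M p" for p v
      by (simp add: seq_scale_at)
    show "?h p (?g p y) = y" if p: "p \<in> Field P" and "y \<in> sp (pmod_sum (interval_pmod I) N) p" for p y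
    proof -
      note sub = pmod_subspace[OF M p]
      from that have y: "seq_fst y \<in> sp (interval_pmod I) p" "seq_snd y \<in> sp N p" by auto
      then have s: "seq_snd y \<in> sp M p" and s0: "a p (seq_snd y) = 0" by (auto simp: spN a_def)
      have "a p (?g p y) = seq_fst y 0 * a p (w p)"
        using s s0 w[OF p] sub
        by (simp add: lin_form_add[OF a[OF p]] lin_form_scale[OF a[OF p]] seqv.subspace_scale)
      also have "\<dots> = seq_fst y 0"
        using aw[of p] y(1) by (cases "p \<in> I") (auto simp: sp_interval zero_fun_apply)
      finally have eq: "a p (?g p y) = seq_fst y 0" .
      have "seq_scale (seq_fst y 0) unit_seq = seq_fst y"
        using y(1) in_lineD by (fastforce simp: sp_interval zero_fun_apply split: if_splits)
      then show ?thesis unfolding eq by simp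
    qed
  qed
qed

text \<open>The structure maps of \<open>A \<oplus> B\<close> inside a connected \<open>I\<close> are bijective, hence so are those of \<open>A\<close>, and
  the vanishing of \<open>A\<close> at \<open>z\<close> spreads over \<open>I\<close>.\<close>

lemma interval_summand_zero:
  fixes A B :: "('p, 'k::field) pmod"
  assumes A: "is_pmod P A" and B: "is_pmod P B" and I: "convex_in P I"
    and iso: "pmod_iso P (interval_pmod I) (pmod_sum A B)"
    and conn: "\<And>p. p \<in> I \<Longrightarrow> (z, p) \<in> ((P \<union> P\<inverse>) \<inter> I \<times> I)\<^sup>*"
    and z: "sp A z = {0}"
  shows "pmod_iso P A zero_pmod"
proof -
  let ?K = "interval_pmod I :: ('p, 'k) pmod"
  obtain h g where h: "pmod_hom P ?K (pmod_sum A B) h" and g: "pmod_hom P (pmod_sum A B) ?K g"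
    and gh: "\<And>p v. p \<in> Field P \<Longrightarrow> v \<in> sp ?K p \<Longrightarrow> g p (h p v) = v"
    and hg: "\<And>p v. p \<in> Field P \<Longrightarrow> v \<in> sp (pmod_sum A B) p \<Longrightarrow> h p (g p v) = v"
    using pmod_isoE[OF is_pmod_interval[OF I] iso] by metis
  have step: "sp A q = {0}" if "sp A p = {0}" "(p, q) \<in> P \<union> P\<inverse>" "p \<in> I" "q \<in> I" for p q
  proof -
    have F: "p \<in> Field P" "q \<in> Field P" using that(2) by (auto simp: Field_def)
    have "a = 0" if a: "a \<in> sp A q" for a
    proof -
      let ?v = "seq_pair a 0" and ?x = "g q (seq_pair a 0)"
      have v: "?v \<in> sp (pmod_sum A B) q" using a pmod_0_in[OF B F(2)] by simp
      have x: "?x \<in> sp ?K q" using hom_in[OF g F(2) v] .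
      have x': "?x \<in> sp ?K p" using x \<open>p \<in> I\<close> \<open>q \<in> I\<close> by (simp add: sp_interval)
      show "a = 0"
      proof (cases "(p, q) \<in> P")
        case True
        have "?v = h q (tr ?K p q ?x)"
          using hg[OF F(2) v] \<open>p \<in> I\<close> \<open>q \<in> I\<close> by (simp add: tr_interval)
        also have "\<dots> = tr (pmod_sum A B) p q (h p ?x)" using hom_tr[OF h True x'] .
        finally have "a = tr A p q (seq_fst (h p ?x))" by (metis tr_sum seq_fst_pair)
        moreover have "seq_fst (h p ?x) = 0" using hom_in[OF h F(1) x'] \<open>sp A p = {0}\<close> by simp
        ultimately show ?thesis using pmod_tr_0[OF A True] by simp
      next
        case False
        then have qp: "(q, p) \<in> P" using \<open>(p, q) \<in> P \<union> P\<inverse>\<close> by blast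
        have "tr A q p a = 0" using pmod_tr_in[OF A qp a] \<open>sp A p = {0}\<close> by simp
        then have "tr (pmod_sum A B) q p ?v = 0" using pmod_tr_0[OF B qp] by simp
        then have "g p (tr (pmod_sum A B) q p ?v) = 0"
          using hom_0[OF is_pmod_sum[OF A B] g F(1)] by simp
        then have "tr ?K q p ?x = 0" using hom_tr[OF g qp v] by simp
        then have "?x = 0" using \<open>p \<in> I\<close> \<open>q \<in> I\<close> by (simp add: tr_interval)
        then have "?v = 0" using hg[OF F(2) v] hom_0[OF is_pmod_interval[OF I] h F(2)] by metis
        then show ?thesis by (metis seq_fst_0 seq_fst_pair)
      qed
    qed
    then show ?thesis using pmod_0_in[OF A F(2)] by blast
  qed
  have in_I: "sp A p = {0}" if "p \<in> I" for p
    using conn[OF that] by induction (use z step in auto)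
  have "sp A p = {0}" if p: "p \<in> Field P" for p
  proof (cases "p \<in> I")
    case False
    have "a = 0" if "a \<in> sp A p" for a
    proof -
      have v: "seq_pair a 0 \<in> sp (pmod_sum A B) p" using that pmod_0_in[OF B p] by simp
      then have "g p (seq_pair a 0) = 0" using hom_in[OF g p v] False by (simp add: sp_interval)
      then have "seq_pair a 0 = 0" using hg[OF p v] hom_0[OF is_pmod_interval[OF I] h p] by metis
      then show ?thesis by (metis seq_fst_0 seq_fst_pair)
    qed
    then show ?thesis using pmod_0_in[OF A p] by blast
  qed (rule in_I)
  then show ?thesis using iso_zero_iff[OF A] by blast
qed

text \<open>At \<open>z\<close> the module is a line, so one of two summands vanishes there, and then everywhere.\<close>

lemma indecomposable_interval:
  assumes I: "convex_in P I" and "z \<in> I" "z \<in> Field P"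
    and conn: "\<And>p. p \<in> I \<Longrightarrow> (z, p) \<in> ((P \<union> P\<inverse>) \<inter> I \<times> I)\<^sup>*"
  shows "indecomposable P (interval_pmod I :: ('p, 'k::field) pmod)"
proof -
  let ?K = "interval_pmod I :: ('p, 'k) pmod"
  have K: "is_pmod P ?K" using is_pmod_interval[OF I] .
  have "sp ?K z \<noteq> {0}"
    using \<open>z \<in> I\<close> unit_in_line unit_seq_neq_0 by (metis sp_interval singletonD)
  then have "\<not> pmod_iso P ?K zero_pmod" using iso_zero_iff[OF K] assms by blast
  moreover have "pmod_iso P A zero_pmod \<or> pmod_iso P B zero_pmod"
    if A: "is_pmod P A" and B: "is_pmod P B" and iso: "pmod_iso P ?K (pmod_sum A B)" for A B
  proof -
    obtain h g where h: "pmod_hom P ?K (pmod_sum A B) h" and g: "pmod_hom P (pmod_sum A B) ?K g"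
      and gh: "\<And>p v. p \<in> Field P \<Longrightarrow> v \<in> sp ?K p \<Longrightarrow> g p (h p v) = v"
      and hg: "\<And>p v. p \<in> Field P \<Longrightarrow> v \<in> sp (pmod_sum A B) p \<Longrightarrow> h p (g p v) = v"
      using pmod_isoE[OF K iso] by metis
    have "a = 0 \<or> b = 0" if a: "a \<in> sp A z" and b: "b \<in> sp B z" for a b
    proof -
      note F = \<open>z \<in> Field P\<close>
      have va: "seq_pair a 0 \<in> sp (pmod_sum A B) z" and vb: "seq_pair 0 b \<in> sp (pmod_sum A B) z"
        using a b pmod_0_in[OF A F] pmod_0_in[OF B F] by auto
      define c d where "c = g z (seq_pair a 0) 0" and "d = g z (seq_pair 0 b) 0"
      have c: "g z (seq_pair a 0) = seq_scale c unit_seq" and d: "g z (seq_pair 0 b) = seq_scale d unit_seq"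
        using hom_in[OF g F va] hom_in[OF g F vb] \<open>z \<in> I\<close> in_lineD
        by (auto simp: c_def d_def sp_interval)
      have u: "unit_seq \<in> sp ?K z" using \<open>z \<in> I\<close> by (simp add: sp_interval)
      have "seq_pair a 0 = seq_scale c (h z unit_seq)" "seq_pair 0 b = seq_scale d (h z unit_seq)"
        using hg[OF F va] hg[OF F vb] lin_map_scale[OF hom_lin[OF h F] u] by (simp_all add: c d)
      then have "a = seq_scale c (seq_fst (h z unit_seq))" "0 = seq_scale c (seq_snd (h z unit_seq))"
        "b = seq_scale d (seq_snd (h z unit_seq))"
        by (metis seq_fst_pair seq_fst_scale seq_snd_pair seq_snd_scale)+
      then show ?thesis by (cases "c = 0") auto
    qed
    then have "sp A z = {0} \<or> sp B z = {0}"
      using pmod_0_in[OF A \<open>z \<in> Field P\<close>] pmod_0_in[OF B \<open>z \<in> Field P\<close>] by blast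
    then show ?thesis
      using interval_summand_zero[OF A B I iso conn]
        interval_summand_zero[OF B A I pmod_iso_trans[OF iso iso_sum_comm] conn] by blast
  qed
  ultimately show ?thesis using K by (auto simp: indecomposable_def)
qed

section \<open>Sections, cosections and the rank over a star\<close>

text \<open>Sections are the elements of the limit of \<open>M\<close> over \<open>A\<close>; cosections are the linear forms on the
  colimit.\<close>

definition section_on :: "'p rel \<Rightarrow> 'p set \<Rightarrow> ('p, 'k::field) pmod \<Rightarrow> ('p \<Rightarrow> 'k seq) \<Rightarrow> bool" where
  "section_on P A M u \<longleftrightarrow> (\<forall>p\<in>A. u p \<in> sp M p) \<and>
     (\<forall>p\<in>A. \<forall>q\<in>A. (p, q) \<in> P \<longrightarrow> tr M p q (u p) = u q)"

definition cosection_on :: "'p rel \<Rightarrow> 'p set \<Rightarrow> ('p, 'k::field) pmod \<Rightarrow> ('p \<Rightarrow> 'k seq \<Rightarrow> 'k) \<Rightarrow> bool" where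
  "cosection_on P A M \<phi> \<longleftrightarrow> (\<forall>p\<in>A. lin_form (sp M p) (\<phi> p)) \<and>
     (\<forall>p\<in>A. \<forall>q\<in>A. (p, q) \<in> P \<longrightarrow> (\<forall>v\<in>sp M p. \<phi> q (tr M p q v) = \<phi> p v))"

definition dual_system :: "'p rel \<Rightarrow> 'p set \<Rightarrow> ('p, 'k::field) pmod \<Rightarrow> nat set \<Rightarrow>
    (nat \<Rightarrow> 'p \<Rightarrow> 'k seq) \<Rightarrow> (nat \<Rightarrow> 'p \<Rightarrow> 'k seq \<Rightarrow> 'k) \<Rightarrow> bool" where
  "dual_system P A M R u \<phi> \<longleftrightarrow>
     (\<forall>r\<in>R. section_on P A M (u r)) \<and> (\<forall>r\<in>R. cosection_on P A M (\<phi> r)) \<and>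
     (\<forall>p\<in>A. \<forall>r\<in>R. \<forall>s\<in>R. \<phi> r p (u s p) = (if r = s then 1 else 0))"

text \<open>The rank over \<open>A\<close> is the rank of the pairing between sections and cosections. Stating only lower
  bounds avoids the dimension theory of the spaces involved.\<close>

definition rank_ge :: "'p rel \<Rightarrow> 'p set \<Rightarrow> ('p, 'k::field) pmod \<Rightarrow> nat \<Rightarrow> bool" where
  "rank_ge P A M n \<longleftrightarrow> (\<exists>R u \<phi>. finite R \<and> card R = n \<and> dual_system P A M R u \<phi>)"

lemma dual_systemD:
  assumes "dual_system P A M R u \<phi>"
  shows "r \<in> R \<Longrightarrow> section_on P A M (u r)" "r \<in> R \<Longrightarrow> cosection_on P A M (\<phi> r)"
    and "p \<in> A \<Longrightarrow> r \<in> R \<Longrightarrow> s \<in> R \<Longrightarrow> \<phi> r p (u s p) = (if r = s then 1 else 0)"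
  using assms by (simp_all add: dual_system_def)

lemma rank_geI:
  fixes R :: "nat set"
  assumes "finite R" "card R = n"
    "\<And>r. r \<in> R \<Longrightarrow> section_on P A M (u r)" "\<And>r. r \<in> R \<Longrightarrow> cosection_on P A M (\<phi> r)"
    "\<And>p r s. p \<in> A \<Longrightarrow> r \<in> R \<Longrightarrow> s \<in> R \<Longrightarrow> \<phi> r p (u s p) = (if r = s then 1 else 0)"
  shows "rank_ge P A M n"
  unfolding rank_ge_def dual_system_def
  using assms by (intro exI[of _ R] exI[of _ u] exI[of _ \<phi>]) simp

lemma rank_ge_0: "rank_ge P A M 0"
  by (rule rank_geI[of "{}"]) auto

definition star :: "'p rel \<Rightarrow> 'p set \<Rightarrow> 'p \<Rightarrow> bool" where
  "star P A z \<longleftrightarrow> A \<subseteq> Field P \<and> z \<in> A \<and> (\<forall>p\<in>A. (p, z) \<in> P \<or> (z, p) \<in> P)"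

definition stars :: "'p rel \<Rightarrow> 'p set set" where
  "stars P = {A. \<exists>z. star P A z}"

lemma section_hom:
  "section_on P A M u \<Longrightarrow> pmod_hom P M N h \<Longrightarrow> A \<subseteq> Field P \<Longrightarrow> section_on P A N (\<lambda>p. h p (u p))"
  unfolding section_on_def by (auto simp: hom_in subset_iff simp flip: hom_tr)

lemma cosection_hom:
  "cosection_on P A N \<phi> \<Longrightarrow> pmod_hom P M N h \<Longrightarrow> A \<subseteq> Field P \<Longrightarrow>
   cosection_on P A M (\<lambda>p v. \<phi> p (h p v))"
  unfolding cosection_on_def by (auto simp: hom_tr hom_in subset_iff intro: lin_form_comp[OF hom_lin])

lemma section_diff:
  assumes "is_pmod P M" "A \<subseteq> Field P" "section_on P A M u" "section_on P A M w"
  shows "section_on P A M (\<lambda>p. u p - seq_scale c (w p))"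
  unfolding section_on_def
proof (intro conjI ballI impI)
  fix p assume p: "p \<in> A"
  then have F: "p \<in> Field P" and u: "u p \<in> sp M p" and w: "w p \<in> sp M p"
    using assms by (auto simp: section_on_def)
  note sub = pmod_subspace[OF assms(1) F]
  have cw: "seq_scale c (w p) \<in> sp M p" using sub w seqv.subspace_scale by blast
  then show "u p - seq_scale c (w p) \<in> sp M p" using sub u seqv.subspace_diff by blast
  fix q assume q: "q \<in> A" and pq: "(p, q) \<in> P"
  show "tr M p q (u p - seq_scale c (w p)) = u q - seq_scale c (w q)"
    using lin_map_diff[OF sub pmod_lin[OF assms(1) pq] u cw]
      lin_map_scale[OF pmod_lin[OF assms(1) pq] w] assms(3,4) p q pq
    by (simp add: section_on_def)
qed

lemma hom_seq_fst: "pmod_hom P (pmod_sum M N) M (\<lambda>p. seq_fst)"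
  and hom_seq_snd: "pmod_hom P (pmod_sum M N) N (\<lambda>p. seq_snd)"
  by (auto simp: pmod_hom_def lin_map_def)

lemma hom_inl: "is_pmod P N \<Longrightarrow> pmod_hom P M (pmod_sum M N) (\<lambda>p v. seq_pair v 0)"
  and hom_inr: "is_pmod P M \<Longrightarrow> pmod_hom P N (pmod_sum M N) (\<lambda>p v. seq_pair 0 v)"
  by (auto simp: pmod_hom_def lin_map_def pmod_0_in pmod_tr_0)

text \<open>The value is preserved along each relation between elements of \<open>A\<close>, and every element is related
  to the centre.\<close>

lemma pairing_const:
  assumes "star P A z" "section_on P A M u" "cosection_on P A M \<phi>" "p \<in> A"
  shows "\<phi> p (u p) = \<phi> z (u z)"
proof -
  have along: "\<phi> x (u x) = \<phi> y (u y)" if "(x, y) \<in> P" "x \<in> A" "y \<in> A" for x y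
  proof -
    have "\<phi> y (tr M x y (u x)) = \<phi> x (u x)" "tr M x y (u x) = u y"
      using assms(2,3) that unfolding section_on_def cosection_on_def by blast+
    then show ?thesis by simp
  qed
  have "z \<in> A" "(p, z) \<in> P \<or> (z, p) \<in> P" using assms(1,4) by (auto simp: star_def)
  then show ?thesis using along[of p z] along[of z p] assms(4) by auto
qed

lemma rank_ge_iso:
  assumes "is_pmod P M" "pmod_iso P M N" "A \<subseteq> Field P"
  shows "rank_ge P A M n \<longleftrightarrow> rank_ge P A N n"
proof -
  have *: "rank_ge P A N n" if rk: "rank_ge P A M n" and "A \<subseteq> Field P"
    and h: "pmod_hom P M N h" and g: "pmod_hom P N M g"
    and gh: "\<And>p v. p \<in> Field P \<Longrightarrow> v \<in> sp M p \<Longrightarrow> g p (h p v) = v" for M N :: "('a, 'b) pmod" and h g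
  proof -
    from rk obtain R u \<phi> where R: "finite R" "card R = n" and dual: "dual_system P A M R u \<phi>"
      unfolding rank_ge_def by blast
      note s = dual_systemD(1)[OF dual] and c = dual_systemD(2)[OF dual] and d = dual_systemD(3)[OF dual]
    have "\<phi> r p (g p (h p (u t p))) = (if r = t then 1 else 0)" if "p \<in> A" "r \<in> R" "t \<in> R" for p r t
      using that \<open>A \<subseteq> Field P\<close> d gh s[OF that(3)] by (auto simp: section_on_def subset_iff)
    then show ?thesis
      by (intro rank_geI[OF R, of P A N "\<lambda>r p. h p (u r p)" "\<lambda>r p v. \<phi> r p (g p v)"]
          section_hom[OF s h \<open>A \<subseteq> Field P\<close>] cosection_hom[OF c g \<open>A \<subseteq> Field P\<close>])
  qed
  obtain h g where "pmod_hom P M N h" "pmod_hom P N M g"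
    "\<And>p v. p \<in> Field P \<Longrightarrow> v \<in> sp M p \<Longrightarrow> g p (h p v) = v"
    "\<And>p v. p \<in> Field P \<Longrightarrow> v \<in> sp N p \<Longrightarrow> h p (g p v) = v"
    using pmod_isoE[OF assms(1,2)] by metis
  then show ?thesis using *[of M N h g] *[of N M g h] assms(3) by blast
qed

lemma rank_ge_zero:
  assumes "is_pmod P M" "pmod_iso P M zero_pmod" "A \<subseteq> Field P" "z \<in> A"
  shows "rank_ge P A M n \<longleftrightarrow> n = 0"
proof
  assume "rank_ge P A M n"
  then obtain R u \<phi> where R: "finite R" "card R = n" and dual: "dual_system P A M R u \<phi>"
    unfolding rank_ge_def by blast
    note s = dual_systemD(1)[OF dual] and c = dual_systemD(2)[OF dual] and d = dual_systemD(3)[OF dual]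
  have False if r: "r \<in> R" for r
  proof -
    have "sp M z = {0}" using assms iso_zero_iff by blast
    then have "u r z = 0" using s[OF r] assms(4) by (auto simp: section_on_def)
    moreover have "\<phi> r z 0 = 0"
      using lin_form_0[OF pmod_subspace[OF assms(1)]] c[OF r] assms(3,4)
      by (auto simp: cosection_on_def)
    ultimately show False using d[OF assms(4) r r] by simp
  qed
  then show "n = 0" using R by (metis card.empty equals0I)
next
  assume "n = 0"
  then show "rank_ge P A M n" by (simp add: rank_ge_0)
qed

text \<open>A dual system of the sum splits its identity matrix as \<open>C + D\<close>, with contributions \<open>C\<close> of the
  interval module and \<open>D\<close> of \<open>N\<close>. If \<open>A\<close> is not contained in \<open>I\<close>, then \<open>C = 0\<close>, because a pairing is
  constant on \<open>A\<close> and vanishes outside \<open>I\<close>. If \<open>A \<subseteq> I\<close>, then \<open>C\<close> is a product \<open>x\<^sub>r y\<^sub>s\<close>; after dropping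
  one index and subtracting multiples of its section from the others all \<open>y\<^sub>s\<close> are zero, and the rest is
  a dual system of \<open>N\<close>.\<close>

lemma rank_ge_interval_sum:
  fixes N :: "('p, 'k::field) pmod"
  assumes A: "star P A z" and N: "is_pmod P N" and I: "convex_in P I"
  shows "rank_ge P A (pmod_sum (interval_pmod I) N) n \<longleftrightarrow>
    (if A \<subseteq> I then n = 0 \<or> rank_ge P A N (n - 1) else rank_ge P A N n)"
    (is "rank_ge P A ?S n \<longleftrightarrow> _")
proof -
  let ?K = "interval_pmod I :: ('p, 'k) pmod"
  have AF: "A \<subseteq> Field P" and zA: "z \<in> A" using A by (auto simp: star_def)
  have K: "is_pmod P ?K" using is_pmod_interval[OF I] .
  note inl = hom_inl[OF N, of ?K] and inr = hom_inr[OF K, of N]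
  show ?thesis
  proof
    assume "rank_ge P A ?S n"
    then obtain R u \<phi> where R: "finite R" "card R = n" and dual: "dual_system P A ?S R u \<phi>"
      unfolding rank_ge_def by blast
      note s = dual_systemD(1)[OF dual] and c = dual_systemD(2)[OF dual] and d = dual_systemD(3)[OF dual]
    have split: "\<phi> r p (seq_pair 0 (seq_snd x)) = \<phi> r p x - \<phi> r p (seq_pair (seq_fst x) 0)"
      if "r \<in> R" "p \<in> A" "x \<in> sp ?S p" for r p x
    proof -
      have F: "p \<in> Field P" using that AF by blast
      have "lin_form (sp ?S p) (\<phi> r p)" using c that by (auto simp: cosection_on_def)
      moreover have "seq_pair 0 (seq_snd x) \<in> sp ?S p" "seq_pair (seq_fst x) 0 \<in> sp ?S p"
        using that pmod_0_in[OF K F] pmod_0_in[OF N F] by auto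
      ultimately have "\<phi> r p (seq_pair 0 (seq_snd x) + seq_pair (seq_fst x) 0) =
          \<phi> r p (seq_pair 0 (seq_snd x)) + \<phi> r p (seq_pair (seq_fst x) 0)"
        using lin_form_add by blast
      then show ?thesis by simp
    qed
    have cN: "cosection_on P A N (\<lambda>p v. \<phi> r p (seq_pair 0 v))" if "r \<in> R" for r
      using cosection_hom[OF c[OF that] inr AF] .
    have cK: "cosection_on P A ?K (\<lambda>p v. \<phi> r p (seq_pair v 0))" if "r \<in> R" for r
      using cosection_hom[OF c[OF that] inl AF] .
    have sK: "section_on P A ?K (\<lambda>p. seq_fst (u r p))" if "r \<in> R" for r
      using section_hom[OF s[OF that] hom_seq_fst AF] .
    have in_S: "u r p \<in> sp ?S p" if "r \<in> R" "p \<in> A" for r p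
      using s[OF that(1)] that(2) unfolding section_on_def by blast
    show "if A \<subseteq> I then n = 0 \<or> rank_ge P A N (n - 1) else rank_ge P A N n"
    proof (cases "A \<subseteq> I")
      case False
      then obtain q where q: "q \<in> A" "q \<notin> I" by blast
      have "\<phi> r p (seq_pair (seq_fst (u t p)) 0) = 0" if "r \<in> R" "t \<in> R" "p \<in> A" for r t p
      proof -
        have "\<phi> r p (seq_pair (seq_fst (u t p)) 0) = \<phi> r q (seq_pair (seq_fst (u t q)) 0)"
          using pairing_const[OF A sK[OF that(2)] cK[OF that(1)]] that(3) q(1) by metis
        also have "seq_fst (u t q) = 0" using in_S[OF that(2) q(1)] q(2) by (simp add: sp_interval)
        also have "\<phi> r q (seq_pair 0 0) = 0"
          using lin_form_0[OF pmod_subspace[OF is_pmod_sum[OF K N]]] c[OF that(1)] q(1) AF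
          by (auto simp: cosection_on_def)
        finally show ?thesis .
      qed
      then have "\<phi> r p (seq_pair 0 (seq_snd (u t p))) = (if r = t then 1 else 0)"
        if "r \<in> R" "t \<in> R" "p \<in> A" for r t p
        using split[OF that(1,3) in_S[OF that(2,3)]] d that by simp
      then have "rank_ge P A N n"
        by (intro rank_geI[OF R, of P A N "\<lambda>r p. seq_snd (u r p)" "\<lambda>r p v. \<phi> r p (seq_pair 0 v)"]
            cN section_hom[OF s hom_seq_snd AF])
      with False show ?thesis by simp
    next
      case True
      have id_form: "cosection_on P A ?K (\<lambda>p v. v 0)"
        using True by (auto simp: cosection_on_def lin_form_def sp_interval tr_interval
            plus_fun_apply seq_scale_at subset_iff)
      have sK_line: "seq_fst (u r p) \<in> line" if "r \<in> R" "p \<in> A" for r p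
        using in_S[OF that] that(2) True by (auto simp: sp_interval subset_iff)
      define y where "y r = seq_fst (u r z) 0" for r
      have fst: "seq_fst (u r p) = seq_scale (y r) unit_seq" if "r \<in> R" "p \<in> A" for r p
      proof -
        have "seq_fst (u r p) = seq_fst (u r z)"
          using pairing_const[OF A sK[OF that(1)] id_form that(2)] sK_line[OF that(1)] that(2) zA
          by (metis in_lineD)
        then show ?thesis using in_lineD[OF sK_line[OF that(1) zA]] by (simp add: y_def)
      qed
      show ?thesis
      proof (cases "R = {}")
        case False
        \<comment> \<open>A nonzero \<open>y t\<close> serves to clear the others. If all are zero, any index will do, since
          then \<open>y r / y t = 0 / 0 = 0\<close> and nothing is subtracted.\<close>
        define t where "t = (if \<exists>t\<in>R. y t \<noteq> 0 then SOME t. t \<in> R \<and> y t \<noteq> 0 else SOME t. t \<in> R)"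
        have t: "t \<in> R" "y t = 0 \<Longrightarrow> r \<in> R \<Longrightarrow> y r = 0" for r
          using someI_ex[of "\<lambda>t. t \<in> R \<and> y t \<noteq> 0"] someI_ex[of "\<lambda>t. t \<in> R"] False
          unfolding t_def by (auto split: if_splits)
        define w where "w r = (\<lambda>p. u r p - seq_scale (y r / y t) (u t p))" for r
        have sw: "section_on P A ?S (w r)" if "r \<in> R" for r
          unfolding w_def using section_diff[OF is_pmod_sum[OF K N] AF s[OF that] s[OF t(1)]] .
        have fst_w: "seq_fst (w r p) = 0" if "r \<in> R" "p \<in> A" for r p
        proof -
          have "y r / y t * y t = y r" using t(2)[OF _ that(1)] by auto
          then show ?thesis using fst that t(1) by (simp add: w_def)
        qed
        have "\<phi> r p (seq_pair 0 (seq_snd (w q p))) = (if r = q then 1 else 0)"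
          if "r \<in> R - {t}" "q \<in> R - {t}" "p \<in> A" for r q p
        proof -
          have F: "p \<in> Field P" and r: "r \<in> R" and q: "q \<in> R" using that AF by blast+
          have form: "lin_form (sp ?S p) (\<phi> r p)" using c r that(3) by (auto simp: cosection_on_def)
          note sub = pmod_subspace[OF is_pmod_sum[OF K N] F]
          have "seq_pair 0 (seq_snd (w q p)) = w q p" using fst_w[OF q that(3)] by (metis seq_pair_collapse)
          moreover have "\<phi> r p (w q p) = \<phi> r p (u q p) - y q / y t * \<phi> r p (u t p)"
            using in_S[OF q that(3)] in_S[OF t(1) that(3)]
            by (simp only: w_def lin_form_diff[OF sub form] lin_form_scale[OF form] seqv.subspace_scale[OF sub])
          ultimately show ?thesis using d[OF that(3) r q] d[OF that(3) r t(1)] that by simp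
        qed
        then have "rank_ge P A N (n - 1)"
          using R cN section_hom[OF sw hom_seq_snd AF] t(1)
          by (intro rank_geI[of "R - {t}" _ P A N "\<lambda>r p. seq_snd (w r p)"
                "\<lambda>r p v. \<phi> r p (seq_pair 0 v)"]) (simp_all add: card_Diff_singleton)
        with True show ?thesis by simp
      qed (use True R in simp)
    qed
  next
    assume *: "if A \<subseteq> I then n = 0 \<or> rank_ge P A N (n - 1) else rank_ge P A N n"
    show "rank_ge P A ?S n"
    proof (cases "A \<subseteq> I \<and> n = 0")
      case False
      define m where "m = (if A \<subseteq> I then n - 1 else n)"
      have "rank_ge P A N m" using * False by (auto simp: m_def split: if_splits)
      then obtain R u \<phi> where R: "finite R" "card R = m" and dual: "dual_system P A N R u \<phi>"
        unfolding rank_ge_def by blast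
        note s = dual_systemD(1)[OF dual] and c = dual_systemD(2)[OF dual] and d = dual_systemD(3)[OF dual]
      have s': "section_on P A ?S (\<lambda>p. seq_pair 0 (u r p))" if "r \<in> R" for r
        using section_hom[OF s[OF that] inr AF] .
      have c': "cosection_on P A ?S (\<lambda>p x. \<phi> r p (seq_snd x))" if "r \<in> R" for r
        using cosection_hom[OF c[OF that] hom_seq_snd AF] .
      show ?thesis
      proof (cases "A \<subseteq> I")
        case False
        then show ?thesis
          using R s' c' d
          by (intro rank_geI[of R _ P A ?S "\<lambda>r p. seq_pair 0 (u r p)" "\<lambda>r p x. \<phi> r p (seq_snd x)"])
            (simp_all add: m_def)
      next
        case True
        obtain t where t: "t \<notin> R" using R(1) ex_new_if_finite infinite_UNIV_nat by blast
        have "section_on P A ?K (\<lambda>p. unit_seq)"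
          using True by (auto simp: section_on_def sp_interval tr_interval)
        from section_hom[OF this inl AF] have s1: "section_on P A ?S (\<lambda>p. seq_pair unit_seq 0)" .
        have "cosection_on P A ?K (\<lambda>p v. v 0)"
          using True by (auto simp: cosection_on_def lin_form_def sp_interval tr_interval
              plus_fun_apply seq_scale_at subset_iff)
        from cosection_hom[OF this hom_seq_fst AF] have c1: "cosection_on P A ?S (\<lambda>p x. seq_fst x 0)" .
        have z0: "\<phi> r p 0 = 0" if "r \<in> R" "p \<in> A" for r p
          using lin_form_0[OF pmod_subspace[OF N]] c[OF that(1)] that(2) AF
          by (auto simp: cosection_on_def)
        have "card (insert t R) = n" using R t False \<open>\<not> (A \<subseteq> I \<and> n = 0)\<close> True by (simp add: m_def)
        then show ?thesis
          using R s' c' d t s1 c1 z0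
          by (intro rank_geI[of "insert t R" _ P A ?S
                "\<lambda>r. if r = t then (\<lambda>p. seq_pair unit_seq 0) else (\<lambda>p. seq_pair 0 (u r p))"
                "\<lambda>r. if r = t then (\<lambda>p x. seq_fst x 0) else (\<lambda>p x. \<phi> r p (seq_snd x))"])
            (auto simp: zero_fun_apply)
      qed
    qed (simp add: rank_ge_0)
  qed
qed

lemma rank_ge_interval:
  assumes "star P A z" "convex_in P I"
  shows "rank_ge P A (interval_pmod I :: ('p, 'k::field) pmod) n \<longleftrightarrow> n \<le> (if A \<subseteq> I then 1 else 0)"
proof -
  let ?Z = "zero_pmod :: ('p, 'k) pmod" and ?K = "interval_pmod I :: ('p, 'k) pmod"
  have AF: "A \<subseteq> Field P" and zA: "z \<in> A" using assms by (auto simp: star_def)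
  have K: "is_pmod P ?K" using is_pmod_interval[OF assms(2)] .
  have "rank_ge P A ?K n \<longleftrightarrow> rank_ge P A (pmod_sum ?K ?Z) n"
    using iso_sum_zero[OF K is_pmod_zero pmod_iso_refl]
    by (rule rank_ge_iso[OF is_pmod_sum[OF K is_pmod_zero] _ AF, symmetric])
  moreover have "rank_ge P A ?Z m \<longleftrightarrow> m = 0" for m
    by (rule rank_ge_zero[OF is_pmod_zero pmod_iso_refl AF zA])
  moreover have "rank_ge P A (pmod_sum ?K ?Z) n \<longleftrightarrow>
      (if A \<subseteq> I then n = 0 \<or> rank_ge P A ?Z (n - 1) else rank_ge P A ?Z n)"
    by (rule rank_ge_interval_sum[OF assms(1) is_pmod_zero assms(2)])
  ultimately show ?thesis by (simp, linarith)
qed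

section \<open>Decomposition into interval modules\<close>

text \<open>\<open>m S\<close> counts the summands isomorphic to the interval module of \<open>S\<close>.\<close>

inductive decomposes :: "'x rel \<Rightarrow> ('x, 'k::field) pmod \<Rightarrow> ('x set \<Rightarrow> nat) \<Rightarrow> bool" for X where
  zero: "is_pmod X N \<Longrightarrow> pmod_iso X N zero_pmod \<Longrightarrow> decomposes X N (\<lambda>_. 0)"
| add: "is_pmod X N \<Longrightarrow> is_pmod X N' \<Longrightarrow> S \<in> stars X \<Longrightarrow>
     pmod_iso X N (pmod_sum (interval_pmod S) N') \<Longrightarrow> decomposes X N' m \<Longrightarrow>
     decomposes X N (m(S := Suc (m S)))"

lemma rank_ge_bounded:
  assumes "is_pmod X N" "x \<in> Field X"
  obtains d where "\<And>n. rank_ge X {x} N n \<Longrightarrow> n \<le> d"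
proof -
  obtain d where bound: "\<And>(R :: nat set) u \<phi>. finite R \<Longrightarrow> (\<And>r. r \<in> R \<Longrightarrow> u r \<in> sp N x) \<Longrightarrow>
      (\<And>r. r \<in> R \<Longrightarrow> lin_form (sp N x) (\<phi> r)) \<Longrightarrow>
      (\<And>r s. r \<in> R \<Longrightarrow> s \<in> R \<Longrightarrow> \<phi> r (u s) = (if r = s then 1 else 0)) \<Longrightarrow> card R \<le> d"
    using dual_family_bounded[OF pmod_fd[OF assms]] by blast
  have "n \<le> d" if rk: "rank_ge X {x} N n" for n
  proof -
    from rk obtain R u \<phi> where R: "finite R" "card R = n" and dual: "dual_system X {x} N R u \<phi>"
      unfolding rank_ge_def by blast
      note s = dual_systemD(1)[OF dual] and c = dual_systemD(2)[OF dual] and d = dual_systemD(3)[OF dual]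
    show ?thesis
      using bound[of R "\<lambda>r. u r x" "\<lambda>r. \<phi> r x"] R s c d by (auto simp: section_on_def cosection_on_def)
  qed
  with that show ?thesis by blast
qed

text \<open>Without chains of three elements every subset is convex, so that each star has an interval module.\<close>

locale height_two_poset =
  fixes X :: "'x rel"
  assumes finite_X: "finite (Field X)"
    and order_X: "Partial_order X"
    and height: "\<And>x y z. (x, y) \<in> X \<Longrightarrow> (y, z) \<in> X \<Longrightarrow> x = y \<or> y = z"
begin

lemma refl_X: "x \<in> Field X \<Longrightarrow> (x, x) \<in> X"
  using order_X by (auto simp: order_on_defs refl_on_def)

lemma convex_X: "convex_in X S"
  using height by (auto simp: convex_in_def)

lemma star_singleton: "x \<in> Field X \<Longrightarrow> star X {x} x"
  using refl_X by (auto simp: star_def)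

lemma finite_stars: "finite (stars X)"
  by (rule finite_subset[of _ "Pow (Field X)"]) (auto simp: stars_def star_def finite_X)

text \<open>Splitting off the interval module of \<open>S\<close> lowers the rank at the points of \<open>S\<close> by one, and these
  ranks are bounded.\<close>

lemma decomposes_exists:
  fixes N :: "('x, 'k::field) pmod"
  assumes split: "\<And>N :: ('x, 'k) pmod. is_pmod X N \<Longrightarrow> \<not> pmod_iso X N zero_pmod \<Longrightarrow>
      \<exists>S\<in>stars X. \<exists>N'. is_pmod X N' \<and> pmod_iso X N (pmod_sum (interval_pmod S) N')"
    and N: "is_pmod X N"
  shows "\<exists>m. decomposes X N m"
proof -
  have "\<exists>m. decomposes X N m"
    if "is_pmod X N" "\<And>x n. x \<in> Field X \<Longrightarrow> rank_ge X {x} N n \<Longrightarrow> n \<le> d x" "(\<Sum>x\<in>Field X. d x) = D"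
    for N :: "('x, 'k) pmod" and d D
    using that
  proof (induction D arbitrary: N d rule: less_induct)
    case (less D)
    show ?case
    proof (cases "pmod_iso X N zero_pmod")
      case False
      then obtain S N' where S: "S \<in> stars X" and N': "is_pmod X N'"
        and iso: "pmod_iso X N (pmod_sum (interval_pmod S) N')"
        using split[OF less.prems(1)] by blast
      have SF: "S \<subseteq> Field X" and "S \<noteq> {}" using S by (auto simp: stars_def star_def)
      have step: "rank_ge X {x} N n \<longleftrightarrow>
          (if x \<in> S then n = 0 \<or> rank_ge X {x} N' (n - 1) else rank_ge X {x} N' n)"
        if "x \<in> Field X" for x n
        using rank_ge_iso[OF less.prems(1) iso, of "{x}" n] that
          rank_ge_interval_sum[OF star_singleton[OF that] N' convex_X, of S n] by simp
      \<comment> \<open>The bounds for the complement have a smaller sum because \<open>S\<close> is not empty.\<close>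
      define d' where "d' x = (if x \<in> S then d x - 1 else d x)" for x
      have d': "n \<le> d' x" if "x \<in> Field X" "rank_ge X {x} N' n" for x n
        using less.prems(2)[OF that(1), of "if x \<in> S then Suc n else n"] step[OF that(1)] that(2)
        by (auto simp: d'_def)
      have pos: "d x > 0" if "x \<in> S" for x
      proof -
        have x: "x \<in> Field X" using that SF by blast
        have "rank_ge X {x} N 1" using step[OF x, of 1] that by (simp add: rank_ge_0)
        then show ?thesis using less.prems(2)[OF x] by fastforce
      qed
      have "(\<Sum>x\<in>Field X. d' x) < (\<Sum>x\<in>Field X. d x)"
      proof (rule sum_strict_mono_ex1[OF finite_X])
        obtain x where "x \<in> S" using \<open>S \<noteq> {}\<close> by blast
        then show "\<exists>x\<in>Field X. d' x < d x"
          using SF pos by (intro bexI[of _ x]) (auto simp: d'_def)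
      qed (auto simp: d'_def)
      then obtain m where "decomposes X N' m"
        using less.IH[of "sum d' (Field X)" N' d'] N' d' less.prems(3) by blast
      then show ?thesis using decomposes.add[OF less.prems(1) N' S iso] by blast
    qed (use less.prems decomposes.zero in blast)
  qed
  moreover have "\<exists>d. \<forall>x\<in>Field X. \<forall>n. rank_ge X {x} N n \<longrightarrow> n \<le> d x"
    by (intro bchoice ballI) (metis rank_ge_bounded[OF N])
  ultimately show ?thesis using N by blast
qed

text \<open>Each summand \<open>T\<close> with \<open>S \<subseteq> T\<close> contributes one to the rank over \<open>S\<close>, every other summand nothing.\<close>

lemma decomposes_rank:
  assumes "decomposes X N m" "star X S x"
  shows "rank_ge X S N n \<longleftrightarrow> n \<le> (\<Sum>T\<in>{T \<in> stars X. S \<subseteq> T}. m T)"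
  using assms(1)
proof (induction arbitrary: n)
  case (zero N)
  then show ?case using rank_ge_zero[of X N S x n] assms(2) by (auto simp: star_def)
next
  case (add N N' T m)
  have SF: "S \<subseteq> Field X" using assms(2) by (simp add: star_def)
  let ?Q = "{T \<in> stars X. S \<subseteq> T}"
  have fin: "finite ?Q" using finite_stars by simp
  have "(\<Sum>U\<in>?Q. (m(T := Suc (m T))) U) = (\<Sum>U\<in>?Q. m U + (if U = T then 1 else 0))"
    by (intro sum.cong) auto
  also have "\<dots> = (\<Sum>U\<in>?Q. m U) + (if S \<subseteq> T then 1 else 0)"
    using fin add.hyps(3) by (simp add: sum.distrib)
  finally have sum: "(\<Sum>U\<in>?Q. (m(T := Suc (m T))) U) = (\<Sum>U\<in>?Q. m U) + (if S \<subseteq> T then 1 else 0)" .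
  have "rank_ge X S N n \<longleftrightarrow> rank_ge X S (pmod_sum (interval_pmod T) N') n"
    by (rule rank_ge_iso[OF add.hyps(1) add.hyps(4) SF])
  also have "\<dots> \<longleftrightarrow>
      (if S \<subseteq> T then n = 0 \<or> n - 1 \<le> (\<Sum>U\<in>?Q. m U) else n \<le> (\<Sum>U\<in>?Q. m U))"
    unfolding rank_ge_interval_sum[OF assms(2) add.hyps(2) convex_X] add.IH ..
  also have "\<dots> \<longleftrightarrow> n \<le> (\<Sum>U\<in>?Q. m U) + (if S \<subseteq> T then 1 else 0)"
    by (cases "S \<subseteq> T") (simp_all only: if_True if_False, linarith+)
  finally show ?case unfolding sum .
qed

lemma decomposes_iso:
  assumes "decomposes X N m" "is_pmod X M" "pmod_iso X M N"
  shows "decomposes X M m"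
  using assms(1)
proof cases
  case zero
  then show ?thesis using decomposes.zero[OF assms(2)] pmod_iso_trans[OF assms(3)] by simp
next
  case (add N' S k)
  then show ?thesis
    using decomposes.add[OF assms(2) add(3,4) pmod_iso_trans[OF assms(3) add(5)]] by simp
qed

lemma decomposes_sum:
  assumes "decomposes X N m" "decomposes X M m'"
  shows "decomposes X (pmod_sum N M) (\<lambda>S. m S + m' S)"
proof -
  have M: "is_pmod X M" using assms(2) by cases auto
  show ?thesis
    using assms(1)
  proof induction
    case (zero N)
    have "pmod_iso X (pmod_sum N M) M"
      using pmod_iso_trans[OF iso_sum_comm iso_sum_zero[OF M zero]] .
    then show ?case using decomposes_iso[OF assms(2) is_pmod_sum[OF zero(1) M]] by simp
  next
    case (add N N' S k)
    note K = is_pmod_interval[OF convex_X, of S]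
    have "pmod_iso X (pmod_sum N M) (pmod_sum (interval_pmod S) (pmod_sum N' M))"
      using pmod_iso_trans[OF iso_sum_cong[OF add(1) M add(4) pmod_iso_refl] iso_sum_assoc] .
    then have "decomposes X (pmod_sum N M) ((\<lambda>S. k S + m' S)(S := Suc (k S + m' S)))"
      by (rule decomposes.add[OF is_pmod_sum[OF add(1) M] is_pmod_sum[OF add(2) M] add(3) _ add.IH])
    moreover have "(\<lambda>S. k S + m' S)(S := Suc (k S + m' S)) = (\<lambda>T. (k(S := Suc (k S))) T + m' T)"
      by auto
    ultimately show ?case by simp
  qed
qed

lemma decomposes_power:
  assumes "S \<in> stars X" "decomposes X N m"
  shows "decomposes X (pmod_sum (pmod_power (interval_pmod S) n) N) (m(S := m S + n))"
proof -
  note K = is_pmod_interval[OF convex_X, of S]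
  have "decomposes X (pmod_power (interval_pmod S) n) ((\<lambda>_. 0)(S := n))"
  proof (induction n)
    case 0
    then show ?case using decomposes.zero[OF is_pmod_zero pmod_iso_refl] by (simp add: fun_upd_def)
  next
    case (Suc n)
    have "pmod_iso X (pmod_power (interval_pmod S) (Suc n))
        (pmod_sum (interval_pmod S) (pmod_power (interval_pmod S) n))"
      by (simp add: pmod_iso_refl)
    from decomposes.add[OF is_pmod_power[OF K] is_pmod_power[OF K] assms(1) this Suc]
    show ?case by (simp only: fun_upd_upd fun_upd_same)
  qed
  from decomposes_sum[OF this assms(2)]
  show ?thesis by (rule back_subst[where P = "decomposes X _"]) auto
qed

lemma decomposes_extract:
  assumes "decomposes X N m" "n \<le> m S"
  shows "\<exists>N'. is_pmod X N' \<and> pmod_iso X N (pmod_sum (pmod_power (interval_pmod S) n) N')"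
  using assms
proof (induction arbitrary: n)
  case (zero N)
  have "pmod_iso X N (pmod_sum zero_pmod N)"
    using pmod_iso_sym[OF is_pmod_sum[OF is_pmod_zero zero(1)]
        pmod_iso_trans[OF iso_sum_comm iso_sum_zero[OF zero(1) is_pmod_zero pmod_iso_refl]]] .
  then show ?case using zero by auto
next
  case (add N N' T k)
  note K = is_pmod_interval[OF convex_X]
  show ?case
  proof (cases "T = S \<and> n > 0")
    case True
    then obtain n' where n: "n = Suc n'" by (cases n) auto
    then obtain N'' where N'': "is_pmod X N''" "pmod_iso X N' (pmod_sum (pmod_power (interval_pmod S) n') N'')"
      using add.IH[of n'] add.prems True by auto
    have "pmod_iso X N (pmod_sum (interval_pmod S) (pmod_sum (pmod_power (interval_pmod S) n') N''))"
      using pmod_iso_trans[OF add(4) iso_sum_cong[OF K add(2) pmod_iso_refl N''(2)]] True by simp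
    moreover have "pmod_iso X (pmod_sum (interval_pmod S) (pmod_sum (pmod_power (interval_pmod S) n') N''))
        (pmod_sum (pmod_power (interval_pmod S) n) N'')"
      unfolding n pmod_power.simps
      by (rule pmod_iso_sym[OF is_pmod_sum[OF is_pmod_sum[OF K is_pmod_power[OF K]] N''(1)] iso_sum_assoc])
    ultimately show ?thesis using N''(1) pmod_iso_trans by blast
  next
    case False
    then have "n \<le> k S" using add.prems by (auto split: if_splits)
    then obtain N'' where N'': "is_pmod X N''" "pmod_iso X N' (pmod_sum (pmod_power (interval_pmod S) n) N'')"
      using add.IH[of n] by blast
    have "pmod_iso X N (pmod_sum (interval_pmod T) (pmod_sum (pmod_power (interval_pmod S) n) N''))"
      using pmod_iso_trans[OF add(4) iso_sum_cong[OF K add(2) pmod_iso_refl N''(2)]] .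
    moreover note iso_sum_left_commute[OF K is_pmod_power[OF K] N''(1), of T S n]
    ultimately have "pmod_iso X N
        (pmod_sum (pmod_power (interval_pmod S) n) (pmod_sum (interval_pmod T) N''))"
      using pmod_iso_trans by blast
    then show ?thesis using is_pmod_sum[OF K N''(1)] by blast
  qed
qed

end

section \<open>Zeta matrices of finite families of sets\<close>

text \<open>At a maximal set in the support of \<open>c\<close> the sum has a single nonzero term.\<close>

lemma zeta_inj:
  fixes c :: "'a set \<Rightarrow> int"
  assumes "finite F" and sum: "\<And>S. S \<in> F \<Longrightarrow> (\<Sum>T\<in>{T \<in> F. S \<subseteq> T}. c T) = 0" and "S \<in> F"
  shows "c S = 0"
proof (rule ccontr)
  assume "c S \<noteq> 0"
  then have "finite {T \<in> F. c T \<noteq> 0}" "{T \<in> F. c T \<noteq> 0} \<noteq> {}" using assms by auto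
  then obtain T where T: "T \<in> F" "c T \<noteq> 0" and max: "\<And>U. U \<in> F \<Longrightarrow> c U \<noteq> 0 \<Longrightarrow> T \<subseteq> U \<Longrightarrow> T = U"
    using finite_has_maximal[of "{T \<in> F. c T \<noteq> 0}"] by auto
  have "(\<Sum>U\<in>{U \<in> F. T \<subseteq> U}. c U) = (\<Sum>U\<in>{T}. c U)"
    using T max assms(1) by (intro sum.mono_neutral_right) auto
  then show False using sum[OF T(1)] T(2) by simp
qed

text \<open>The equation of a minimal set \<open>J\<close> can be solved last: its unknown \<open>c J\<close> occurs in no other
  equation.\<close>

lemma zeta_surj:
  fixes r :: "'a set \<Rightarrow> int"
  assumes "finite F"
  shows "\<exists>c. \<forall>S\<in>F. r S = (\<Sum>T\<in>{T \<in> F. S \<subseteq> T}. c T)"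
  using assms
proof (induction "card F" arbitrary: F)
  case (Suc n)
  have "F \<noteq> {}" using Suc.hyps(2) by (metis card.empty nat.distinct(1))
  then obtain J where J: "J \<in> F" and min: "\<And>U. U \<in> F \<Longrightarrow> U \<subseteq> J \<Longrightarrow> U = J"
    using finite_has_minimal[OF Suc.prems \<open>F \<noteq> {}\<close>] by auto
  let ?G = "F - {J}"
  have "n = card ?G" using Suc.hyps(2) J by (simp add: card_Diff_singleton)
  from Suc.hyps(1)[OF this finite_Diff[OF Suc.prems]]
  obtain c where c: "\<forall>S\<in>?G. r S = (\<Sum>T\<in>{T \<in> ?G. S \<subseteq> T}. c T)" ..
  define c' where "c' = c(J := r J - (\<Sum>T\<in>{T \<in> ?G. J \<subseteq> T}. c T))"
  have "r S = (\<Sum>T\<in>{T \<in> F. S \<subseteq> T}. c' T)" if "S \<in> F" for S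
  proof (cases "S = J")
    case True
    have "{T \<in> F. J \<subseteq> T} = insert J {T \<in> ?G. J \<subseteq> T}" using J by auto
    moreover have "(\<Sum>T\<in>{T \<in> ?G. J \<subseteq> T}. c' T) = (\<Sum>T\<in>{T \<in> ?G. J \<subseteq> T}. c T)"
      by (intro sum.cong) (auto simp: c'_def)
    ultimately show ?thesis using True Suc.prems by (simp add: c'_def)
  next
    case False
    then have "{T \<in> F. S \<subseteq> T} = {T \<in> ?G. S \<subseteq> T}" using min that by auto
    moreover have "(\<Sum>T\<in>{T \<in> ?G. S \<subseteq> T}. c' T) = (\<Sum>T\<in>{T \<in> ?G. S \<subseteq> T}. c T)"
      by (intro sum.cong) (auto simp: c'_def)
    ultimately show ?thesis using c that False by simp
  qed
  then show ?case by blast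
qed auto

section \<open>Multiplicities of interval modules\<close>

context height_two_poset
begin

lemma interval_pmod_X: "is_pmod X (interval_pmod S)"
  by (rule is_pmod_interval[OF convex_X])

text \<open>The ranks over stars are determined by \<open>N\<close>, and they determine \<open>m\<close> by inversion over inclusion.\<close>

lemma decomposes_unique:
  assumes "decomposes X N m" "decomposes X N m'" "S \<in> stars X"
  shows "m S = m' S"
proof -
  have "(\<Sum>T\<in>{T \<in> stars X. S \<subseteq> T}. int (m T) - int (m' T)) = 0" if S: "S \<in> stars X" for S
  proof -
    obtain x where "star X S x" using S by (auto simp: stars_def)
    then have "n \<le> (\<Sum>T\<in>{T \<in> stars X. S \<subseteq> T}. m T) \<longleftrightarrow> n \<le> (\<Sum>T\<in>{T \<in> stars X. S \<subseteq> T}. m' T)" for n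
      using decomposes_rank assms(1,2) by metis
    then have "(\<Sum>T\<in>{T \<in> stars X. S \<subseteq> T}. m T) = (\<Sum>T\<in>{T \<in> stars X. S \<subseteq> T}. m' T)"
      by (meson order_antisym order_refl)
    then show ?thesis by (simp add: sum_subtractf flip: of_nat_sum)
  qed
  from zeta_inj[OF finite_stars this assms(3)] show ?thesis by simp
qed

lemma multiplicity_decomposes:
  fixes U N :: "('x, 'k::field) pmod"
  assumes dec: "\<And>N :: ('x, 'k) pmod. is_pmod X N \<Longrightarrow> \<exists>m. decomposes X N m"
    and N: "decomposes X N m" and S: "S \<in> stars X" and U: "is_pmod X U" "pmod_iso X U (interval_pmod S)"
  shows "multiplicity X U N = m S"
proof -
  let ?Q = "{n. \<exists>N'. is_pmod X N' \<and> pmod_iso X N (pmod_sum (pmod_power U n) N')}"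
  have NX: "is_pmod X N" using N by cases auto
  have bound: "n \<le> m S" if n: "n \<in> ?Q" for n
  proof -
    obtain N' where N': "is_pmod X N'" "pmod_iso X N (pmod_sum (pmod_power U n) N')" using n by blast
    obtain m' where m': "decomposes X N' m'" using dec[OF N'(1)] by blast
    have "pmod_iso X N (pmod_sum (pmod_power (interval_pmod S) n) N')"
      using pmod_iso_trans[OF N'(2) iso_sum_cong[OF is_pmod_power[OF U(1)] N'(1)
            iso_power_cong[OF U] pmod_iso_refl]] .
    from decomposes_unique[OF N decomposes_iso[OF decomposes_power[OF S m'] NX this] S]
    show ?thesis by simp
  qed
  have "m S \<in> ?Q"
  proof -
    obtain N' where N': "is_pmod X N'" "pmod_iso X N (pmod_sum (pmod_power (interval_pmod S) (m S)) N')"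
      using decomposes_extract[OF N order_refl] by blast
    have "pmod_iso X (pmod_power (interval_pmod S) (m S)) (pmod_power U (m S))"
      using iso_power_cong[OF interval_pmod_X pmod_iso_sym[OF U]] .
    then have "pmod_iso X N (pmod_sum (pmod_power U (m S)) N')"
      using pmod_iso_trans[OF N'(2) iso_sum_cong[OF is_pmod_power[OF interval_pmod_X] N'(1) _ pmod_iso_refl]]
      by blast
    then show ?thesis using N'(1) by blast
  qed
  moreover have "finite ?Q" using bound by (meson finite_nat_set_iff_bounded_le)
  ultimately show ?thesis unfolding multiplicity_def using bound by (intro Max_eqI) auto
qed

lemma indecomposable_star:
  assumes "S \<in> stars X" shows "indecomposable X (interval_pmod S)"
proof -
  obtain z where z: "star X S z" using assms by (auto simp: stars_def)
  then show ?thesis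
    by (intro indecomposable_interval[OF convex_X, of z]) (auto simp: star_def intro: r_into_rtrancl)
qed

text \<open>If an indecomposable module splits off the interval module of \<open>S\<close>, the complement is zero.\<close>

lemma Ind_star:
  assumes dec: "\<And>N :: ('x, 'k::field) pmod. is_pmod X N \<Longrightarrow> \<exists>m. decomposes X N m"
    and U: "U \<in> (Ind X :: ('x, 'k) pmod set)"
  obtains S where "S \<in> stars X" "is_pmod X U" "pmod_iso X U (interval_pmod S)"
proof -
  obtain M :: "('x, 'k) pmod" where M: "indecomposable X M" and U_def: "U = (SOME N. N \<in> isoclass X M)"
    using U by (auto simp: Ind_def)
  have MX: "is_pmod X M" using M by (simp add: indecomposable_def)
  then have "M \<in> isoclass X M" by (simp add: isoclass_def pmod_iso_refl)
  then have "U \<in> isoclass X M" unfolding U_def by (rule someI)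
  then have UX: "is_pmod X U" and MU: "pmod_iso X M U" by (auto simp: isoclass_def)
  obtain m where "decomposes X M m" using dec[OF MX] by blast
  then show ?thesis
  proof cases
    case zero
    then show ?thesis using M by (auto simp: indecomposable_def)
  next
    case (add N' S k)
    have "\<not> pmod_iso X (interval_pmod S :: ('x, 'k) pmod) zero_pmod"
      using indecomposable_star[OF add(4)] by (auto simp: indecomposable_def)
    then have "pmod_iso X N' zero_pmod"
      using M add(3,5) interval_pmod_X by (auto simp: indecomposable_def)
    then have "pmod_iso X M (interval_pmod S)"
      using pmod_iso_trans[OF add(5) iso_sum_zero[OF interval_pmod_X add(3)]] by blast
    then have "pmod_iso X U (interval_pmod S)" using pmod_iso_trans[OF pmod_iso_sym[OF MX MU]] by blast
    then show ?thesis using that add(4) UX by blast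
  qed
qed

lemma star_Ind:
  assumes "S \<in> stars X"
  obtains U where "U \<in> (Ind X :: ('x, 'k::field) pmod set)" "is_pmod X U" "pmod_iso X U (interval_pmod S)"
proof -
  let ?K = "interval_pmod S :: ('x, 'k) pmod"
  define U where "U = (SOME N. N \<in> isoclass X ?K)"
  have "U \<in> Ind X" using indecomposable_star[OF assms] unfolding Ind_def U_def by blast
  have "?K \<in> isoclass X ?K" using interval_pmod_X by (simp add: isoclass_def pmod_iso_refl)
  then have "U \<in> isoclass X ?K" unfolding U_def by (rule someI)
  then show ?thesis
    using that \<open>U \<in> Ind X\<close> pmod_iso_sym[OF interval_pmod_X] by (auto simp: isoclass_def)
qed

end

section \<open>Modules over the two stars with three elements\<close>

text \<open>For a centre below everything else, a vector at the centre spreads to a section over \<open>S\<close>. A form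
  at the centre extends to a cosection if it vanishes on the kernels of the maps to the other points
  of \<open>S\<close>.\<close>

lemma split_off_source:
  assumes N: "is_pmod X N" and X: "X = {(x, x) | x. x \<in> F} \<union> {(c, x) | x. x \<in> F}" and c: "c \<in> S" "S \<subseteq> F"
    and v: "v \<in> sp N c" and \<phi>: "lin_form (sp N c) \<phi>" "\<phi> v = 1"
    and inside: "\<And>x w. x \<in> S - {c} \<Longrightarrow> w \<in> sp N c \<Longrightarrow> tr N c x w = 0 \<Longrightarrow> \<phi> w = 0"
    and outside: "\<And>x. x \<in> F - S \<Longrightarrow> tr N c x v = 0"
  shows "\<exists>N'. is_pmod X N' \<and> pmod_iso X N (pmod_sum (interval_pmod S) N')"
proof -
  have FX: "Field X = F" unfolding X Field_def using c by auto
  have cx: "(c, x) \<in> X" if "x \<in> F" for x using that X by auto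
  have cF: "c \<in> Field X" using c FX by blast
  have "\<exists>\<psi>. lin_form UNIV \<psi> \<and> (\<forall>w\<in>sp N c. \<psi> (tr N c x w) = \<phi> w)" if x: "x \<in> S - {c}" for x
  proof -
    have "x \<in> F" using x c(2) by blast
    show ?thesis
      by (rule lin_form_factor[OF pmod_subspace[OF N cF] pmod_lin[OF N cx[OF \<open>x \<in> F\<close>]] \<phi>(1) inside[OF x]])
        blast+
  qed
  then obtain \<psi> where \<psi>: "\<And>x. x \<in> S - {c} \<Longrightarrow> lin_form UNIV (\<psi> x)"
    "\<And>x w. x \<in> S - {c} \<Longrightarrow> w \<in> sp N c \<Longrightarrow> \<psi> x (tr N c x w) = \<phi> w" by metis
  define \<phi>' where "\<phi>' x = (if x = c then \<phi> else \<psi> x)" for x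
  have \<phi>': "\<phi>' x (tr N c x w) = \<phi> w" if "x \<in> S" "w \<in> sp N c" for x w
    using that \<psi> pmod_tr_id[OF N cF] by (auto simp: \<phi>'_def)
  obtain N' where "is_pmod X N'" "pmod_iso X N (pmod_sum (interval_pmod S) N')"
  proof (rule interval_split_off[OF N, of S "\<lambda>x. tr N c x v" \<phi>'])
    show "S \<subseteq> Field X" using c FX by blast
    show "tr N c x v \<in> sp N x" if "x \<in> S" for x using that cx c(2) pmod_tr_in[OF N] v by blast
    show "tr N p q (tr N c p v) = (if q \<in> S then tr N c q v else 0)" if "(p, q) \<in> X" "p \<in> S" for p q
      using that c(2) pmod_tr_tr[OF N cx that(1) v] outside X by auto
    show "lin_form (sp N p) (\<phi>' p)" if "p \<in> S" for p
      using that \<phi>(1) \<psi>(1) lin_form_subset by (auto simp: \<phi>'_def) blast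
    show "\<phi>' q (tr N p q w) = (if p \<in> S then \<phi>' p w else 0)" if "(p, q) \<in> X" "q \<in> S" "w \<in> sp N p" for p q w
    proof (cases "p = c")
      case True
      then show ?thesis using \<phi>'[OF that(2)] that(3) c(1) by (simp add: \<phi>'_def)
    next
      case False
      then have "p = q" using that(1) X by auto
      then show ?thesis using that pmod_tr_id[OF N] FieldI1[OF that(1)] by simp
    qed
    show "\<phi>' p (tr N c p v) = 1" if "p \<in> S" for p using \<phi>'[OF that v] \<phi>(2) by simp
  qed
  then show ?thesis by blast
qed

text \<open>The dual situation: a form at the centre pulls back to a cosection over \<open>S\<close>, and a vector at the
  centre extends to a section if it lies in the images of the maps from the other points of \<open>S\<close>.\<close>

lemma split_off_sink:
  assumes N: "is_pmod X N" and X: "X = {(x, x) | x. x \<in> F} \<union> {(x, c) | x. x \<in> F}" and c: "c \<in> S" "S \<subseteq> F"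
    and w: "w \<in> sp N c" and \<phi>: "lin_form (sp N c) \<phi>" "\<phi> w = 1"
    and inside: "\<And>x. x \<in> S - {c} \<Longrightarrow> w \<in> tr N x c ` sp N x"
    and outside: "\<And>x v. x \<in> F - S \<Longrightarrow> v \<in> sp N x \<Longrightarrow> \<phi> (tr N x c v) = 0"
  shows "\<exists>N'. is_pmod X N' \<and> pmod_iso X N (pmod_sum (interval_pmod S) N')"
proof -
  have FX: "Field X = F" unfolding X Field_def using c by auto
  have xc: "(x, c) \<in> X" if "x \<in> F" for x using that X by auto
  have cF: "c \<in> Field X" using c FX by blast
  have "\<exists>v\<in>sp N x. tr N x c v = w" if "x \<in> S - {c}" for x
    using inside[OF that] by (metis imageE)
  then obtain u' where u': "\<And>x. x \<in> S - {c} \<Longrightarrow> u' x \<in> sp N x" "\<And>x. x \<in> S - {c} \<Longrightarrow> tr N x c (u' x) = w"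
    by metis
  define u where "u = u'(c := w)"
  have u: "u x \<in> sp N x" "tr N x c (u x) = w" if "x \<in> S" for x
    using that u' w pmod_tr_id[OF N cF w] by (auto simp: u_def)
  obtain N' where "is_pmod X N'" "pmod_iso X N (pmod_sum (interval_pmod S) N')"
  proof (rule interval_split_off[OF N, of S u "\<lambda>x v. \<phi> (tr N x c v)"])
    show "S \<subseteq> Field X" using c FX by blast
    show "u x \<in> sp N x" if "x \<in> S" for x using u that by blast
    show "tr N p q (u p) = (if q \<in> S then u q else 0)" if "(p, q) \<in> X" "p \<in> S" for p q
    proof (cases "q = c")
      case True
      then show ?thesis using u(2)[OF that(2)] c(1) by (simp add: u_def)
    next
      case False
      then have "p = q" using that(1) X by auto
      then show ?thesis using that pmod_tr_id[OF N] FieldI1[OF that(1)] u(1) by simp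
    qed
    show "lin_form (sp N p) (\<lambda>v. \<phi> (tr N p c v))" if "p \<in> S" for p
      using lin_form_comp[OF pmod_lin[OF N xc] \<phi>(1)] that c(2) by blast
    show "\<phi> (tr N q c (tr N p q v)) = (if p \<in> S then \<phi> (tr N p c v) else 0)"
      if "(p, q) \<in> X" "q \<in> S" "v \<in> sp N p" for p q v
      using pmod_tr_tr[OF N that(1) xc that(3)] that c(2) outside[of p v] FieldI1[OF that(1)] FX by auto
    show "\<phi> (tr N p c (u p)) = 1" if "p \<in> S" for p using u(2)[OF that] \<phi>(2) by simp
  qed
  then show ?thesis by blast
qed

lemma split_off_isolated:
  assumes N: "is_pmod X N" and x: "x \<in> Field X" "sp N x \<noteq> {0}"
    and isolated: "\<And>y. (x, y) \<in> X \<or> (y, x) \<in> X \<Longrightarrow> y \<noteq> x \<Longrightarrow> sp N y = {0}"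
  shows "\<exists>N'. is_pmod X N' \<and> pmod_iso X N (pmod_sum (interval_pmod {x}) N')"
proof -
  obtain v where v: "v \<in> sp N x" "v \<notin> {0}" using x pmod_0_in[OF N x(1)] by blast
  obtain \<phi> where \<phi>: "lin_form UNIV \<phi>" "\<phi> v = 1"
    using lin_form_separating[of "{0}" v] v(2) by auto
  obtain N' where "is_pmod X N'" "pmod_iso X N (pmod_sum (interval_pmod {x}) N')"
  proof (rule interval_split_off[OF N, of "{x}" "\<lambda>_. v" "\<lambda>_. \<phi>"])
    show "tr N p q v = (if q \<in> {x} then v else 0)" if "(p, q) \<in> X" "p \<in> {x}" for p q
      using that v isolated[of q] pmod_tr_in[OF N that(1)] pmod_tr_id[OF N x(1)] by auto
    show "\<phi> (tr N p q w) = (if p \<in> {x} then \<phi> w else 0)" if "(p, q) \<in> X" "q \<in> {x}" "w \<in> sp N p" for p q w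
      using that isolated[of p] pmod_tr_0[OF N that(1)] pmod_tr_id[OF N x(1)]
        lin_form_0[OF seqv.subspace_UNIV \<phi>(1)] by auto
    show "lin_form (sp N p) \<phi>" for p using \<phi>(1) lin_form_subset by blast
  qed (use x v \<phi> in auto)
  then show ?thesis by blast
qed

lemma X3'_eq: "X3' = {(x, x) | x. x \<in> {1, 2, 3}} \<union> {(1, x) | x. x \<in> {1, 2, 3}}"
  and X3''_eq: "X3'' = {(x, x) | x. x \<in> {1, 2, 3}} \<union> {(x, 3) | x. x \<in> {1, 2, 3}}"
  and Field_X3': "Field X3' = {1, 2, 3}"
  and Field_X3'': "Field X3'' = {1, 2, 3}"
  by (auto simp: X3'_def X3''_def Field_def)

lemma in_X3': "(x, y) \<in> X3' \<longleftrightarrow> x \<in> {1, 2, 3} \<and> y \<in> {1, 2, 3} \<and> (x = y \<or> x = 1)"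
  and in_X3'': "(x, y) \<in> X3'' \<longleftrightarrow> x \<in> {1, 2, 3} \<and> y \<in> {1, 2, 3} \<and> (x = y \<or> y = 3)"
  by (auto simp: X3'_def X3''_def)

lemma height_two_X3': "height_two_poset X3'"
proof
  have "refl_on (Field X3') X3'" by (simp add: refl_on_def Field_X3' in_X3')
  moreover have "trans X3'" unfolding trans_def in_X3' by metis
  moreover have "antisym X3'" unfolding antisym_def in_X3' by metis
  moreover have "X3' \<subseteq> Field X3' \<times> Field X3'" by (auto simp: Field_def)
  ultimately show "Partial_order X3'" by (simp add: order_on_defs)
  show "x = y \<or> y = z" if "(x, y) \<in> X3'" "(y, z) \<in> X3'" for x y z
    using that unfolding in_X3' by metis
qed (simp add: Field_X3')

lemma height_two_X3'': "height_two_poset X3''"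
proof
  have "refl_on (Field X3'') X3''" by (simp add: refl_on_def Field_X3'' in_X3'')
  moreover have "trans X3''" unfolding trans_def in_X3'' by metis
  moreover have "antisym X3''" unfolding antisym_def in_X3'' by metis
  moreover have "X3'' \<subseteq> Field X3'' \<times> Field X3''" by (auto simp: Field_def)
  ultimately show "Partial_order X3''" by (simp add: order_on_defs)
  show "x = y \<or> y = z" if "(x, y) \<in> X3''" "(y, z) \<in> X3''" for x y z
    using that unfolding in_X3'' by metis
qed (simp add: Field_X3'')

lemma star_X3': "x \<in> {1, 2, 3} \<Longrightarrow> {x} \<in> stars X3'" "1 \<in> S \<Longrightarrow> S \<subseteq> {1, 2, 3} \<Longrightarrow> S \<in> stars X3'"
  unfolding stars_def star_def Field_X3' by (auto simp: X3'_eq)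

lemma star_X3'': "x \<in> {1, 2, 3} \<Longrightarrow> {x} \<in> stars X3''" "3 \<in> S \<Longrightarrow> S \<subseteq> {1, 2, 3} \<Longrightarrow> S \<in> stars X3''"
  unfolding stars_def star_def Field_X3'' by (auto simp: X3''_eq)

text \<open>Let \<open>K 2\<close> and \<open>K 3\<close> be the kernels of the two maps out of \<open>1\<close>. Suitable vectors are found in the
  complement of \<open>K 2 + K 3\<close>, in one kernel but not in the other, or in their intersection. If there are
  none, the space at \<open>1\<close> vanishes and the module is a sum of simple modules.\<close>

lemma split_X3':
  fixes N :: "(nat, 'k::field) pmod"
  assumes N: "is_pmod X3' N" and nz: "\<not> pmod_iso X3' N zero_pmod"
  shows "\<exists>S\<in>stars X3'. \<exists>N'. is_pmod X3' N' \<and> pmod_iso X3' N (pmod_sum (interval_pmod S) N')"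
proof (cases "sp N 1 = {0}")
  case True
  obtain x where x: "x \<in> Field X3'" "sp N x \<noteq> {0}" using nz iso_zero_iff[OF N] by blast
  have "\<exists>N'. is_pmod X3' N' \<and> pmod_iso X3' N (pmod_sum (interval_pmod {x}) N')"
  proof (rule split_off_isolated[OF N x])
    have "x \<noteq> 1" using x True by auto
    then show "sp N y = {0}" if "(x, y) \<in> X3' \<or> (y, x) \<in> X3'" "y \<noteq> x" for y
      using that True unfolding in_X3' by metis
  qed
  moreover have "{x} \<in> stars X3'" using x by (intro star_X3') (simp add: Field_X3')
  ultimately show ?thesis by blast
next
  case False
  define K where "K x = {v \<in> sp N 1. tr N 1 x v = 0}" for x
  have F1: "1 \<in> Field X3'" by (simp add: Field_X3')
  note sub1 = pmod_subspace[OF N F1]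
  have lin: "lin_map (sp N 1) (sp N 2) (tr N 1 2)" "lin_map (sp N 1) (sp N 3) (tr N 1 3)"
    using pmod_lin[OF N] by (auto simp: X3'_def)
  note subK = subspace_ker[OF sub1 lin(1), folded K_def] subspace_ker[OF sub1 lin(2), folded K_def]
  have split: "\<exists>S\<in>stars X3'. \<exists>N'. is_pmod X3' N' \<and> pmod_iso X3' N (pmod_sum (interval_pmod S) N')"
    if S: "1 \<in> S" "S \<subseteq> {1, 2, 3}" and v: "v \<in> sp N 1" and W: "seqv.subspace W" "v \<notin> W"
      and inside: "\<And>x. x \<in> S - {1} \<Longrightarrow> K x \<subseteq> W" and outside: "\<And>x. x \<in> {1, 2, 3} - S \<Longrightarrow> v \<in> K x" for S W v
  proof -
    obtain \<phi> where \<phi>: "lin_form UNIV \<phi>" "\<phi> v = 1" "\<And>w. w \<in> W \<Longrightarrow> \<phi> w = 0"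
      using lin_form_separating[OF W] by blast
    have "\<exists>N'. is_pmod X3' N' \<and> pmod_iso X3' N (pmod_sum (interval_pmod S) N')"
    proof (rule split_off_source[where \<phi> = \<phi>, OF N X3'_eq S v _ \<phi>(2)])
      show "lin_form (sp N 1) \<phi>" using \<phi>(1) lin_form_subset by blast
      show "\<phi> w = 0" if "x \<in> S - {1}" "w \<in> sp N 1" "tr N 1 x w = 0" for x w
        using that inside[OF that(1)] \<phi>(3) by (auto simp: K_def)
      show "tr N 1 x v = 0" if "x \<in> {1, 2, 3} - S" for x using outside[OF that] by (simp add: K_def)
    qed
    then show ?thesis using star_X3'(2)[OF S] by blast
  qed
  let ?W = "{x + y | x y. x \<in> K 2 \<and> y \<in> K 3}"
  have subW: "seqv.subspace ?W" using seqv.subspace_sums[OF subK] .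
  have KW: "K 2 \<subseteq> ?W" "K 3 \<subseteq> ?W"
    using seqv.subspace_0[OF subK(1)] seqv.subspace_0[OF subK(2)] by force+
  consider v where "v \<in> sp N 1" "v \<notin> ?W" | v where "v \<in> K 3" "v \<notin> K 2" | v where "v \<in> K 2" "v \<notin> K 3"
    | v where "v \<in> K 2" "v \<in> K 3" "v \<notin> {0}"
  proof (atomize_elim, rule ccontr)
    assume *: "\<not> ((\<exists>v. v \<in> sp N 1 \<and> v \<notin> ?W) \<or> (\<exists>v. v \<in> K 3 \<and> v \<notin> K 2) \<or> (\<exists>v. v \<in> K 2 \<and> v \<notin> K 3) \<or>
        (\<exists>v. v \<in> K 2 \<and> v \<in> K 3 \<and> v \<notin> {0}))"
    then have "x = 0" if "x \<in> K 2 \<union> K 3" for x using that by blast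
    then have "x + y = 0" if "x \<in> K 2" "y \<in> K 3" for x y using that by (metis UnI1 UnI2 add_0)
    then have "?W \<subseteq> {0}" by blast
    then have "sp N 1 \<subseteq> {0}" using * by blast
    then show False using False pmod_0_in[OF N F1] by blast
  qed
  then show ?thesis
  proof cases
    case 1
    show ?thesis by (rule split[OF _ _ 1(1) subW 1(2), of "{1, 2, 3}"]) (use KW in auto)
  next
    case 2
    show ?thesis by (rule split[OF _ _ _ subK(1) 2(2), of "{1, 2}"]) (use 2 in \<open>auto simp: K_def\<close>)
  next
    case 3
    show ?thesis by (rule split[OF _ _ _ subK(2) 3(2), of "{1, 3}"]) (use 3 in \<open>auto simp: K_def\<close>)
  next
    case 4
    show ?thesis
      by (rule split[OF _ _ _ seqv.subspace_single_0 4(3), of "{1}"]) (use 4 in \<open>auto simp: K_def\<close>)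
  qed
qed

text \<open>The same trichotomy with the images \<open>I 1\<close> and \<open>I 2\<close> of the two maps into \<open>3\<close> and with the roles of
  sum and intersection exchanged.\<close>

lemma split_X3'':
  fixes N :: "(nat, 'k::field) pmod"
  assumes N: "is_pmod X3'' N" and nz: "\<not> pmod_iso X3'' N zero_pmod"
  shows "\<exists>S\<in>stars X3''. \<exists>N'. is_pmod X3'' N' \<and> pmod_iso X3'' N (pmod_sum (interval_pmod S) N')"
proof (cases "sp N 3 = {0}")
  case True
  obtain x where x: "x \<in> Field X3''" "sp N x \<noteq> {0}" using nz iso_zero_iff[OF N] by blast
  have "\<exists>N'. is_pmod X3'' N' \<and> pmod_iso X3'' N (pmod_sum (interval_pmod {x}) N')"
  proof (rule split_off_isolated[OF N x])
    have "x \<noteq> 3" using x True by auto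
    then show "sp N y = {0}" if "(x, y) \<in> X3'' \<or> (y, x) \<in> X3''" "y \<noteq> x" for y
      using that True unfolding in_X3'' by metis
  qed
  moreover have "{x} \<in> stars X3''" using x by (intro star_X3'') (simp add: Field_X3'')
  ultimately show ?thesis by blast
next
  case False
  define I where "I x = tr N x 3 ` sp N x" for x
  have F: "1 \<in> Field X3''" "2 \<in> Field X3''" "3 \<in> Field X3''" by (simp_all add: Field_X3'')
  have in_X: "(1, 3) \<in> X3''" "(2, 3) \<in> X3''" by (simp_all add: X3''_def)
  note subI = subspace_image[OF pmod_subspace[OF N F(1)] pmod_lin[OF N in_X(1)], folded I_def]
    subspace_image[OF pmod_subspace[OF N F(2)] pmod_lin[OF N in_X(2)], folded I_def]
  have I3: "I 1 \<subseteq> sp N 3" "I 2 \<subseteq> sp N 3"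
    using pmod_tr_in[OF N in_X(1)] pmod_tr_in[OF N in_X(2)] by (auto simp: I_def)
  have split: "\<exists>S\<in>stars X3''. \<exists>N'. is_pmod X3'' N' \<and> pmod_iso X3'' N (pmod_sum (interval_pmod S) N')"
    if S: "3 \<in> S" "S \<subseteq> {1, 2, 3}" and w: "w \<in> sp N 3" and W: "seqv.subspace W" "w \<notin> W"
      and inside: "\<And>x. x \<in> S - {3} \<Longrightarrow> w \<in> I x" and outside: "\<And>x. x \<in> {1, 2, 3} - S \<Longrightarrow> I x \<subseteq> W" for S W w
  proof -
    obtain \<phi> where \<phi>: "lin_form UNIV \<phi>" "\<phi> w = 1" "\<And>w. w \<in> W \<Longrightarrow> \<phi> w = 0"
      using lin_form_separating[OF W] by blast
    have "\<exists>N'. is_pmod X3'' N' \<and> pmod_iso X3'' N (pmod_sum (interval_pmod S) N')"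
    proof (rule split_off_sink[where \<phi> = \<phi>, OF N X3''_eq S w _ \<phi>(2)])
      show "lin_form (sp N 3) \<phi>" using \<phi>(1) lin_form_subset by blast
      show "w \<in> tr N x 3 ` sp N x" if "x \<in> S - {3}" for x using inside[OF that] by (simp add: I_def)
      show "\<phi> (tr N x 3 v) = 0" if "x \<in> {1, 2, 3} - S" "v \<in> sp N x" for x v
        using outside[OF that(1)] that(2) \<phi>(3) by (auto simp: I_def)
    qed
    then show ?thesis using star_X3''(2)[OF S] by blast
  qed
  let ?W = "{x + y | x y. x \<in> I 1 \<and> y \<in> I 2}"
  have subW: "seqv.subspace ?W" using seqv.subspace_sums[OF subI] .
  have IW: "I 1 \<subseteq> ?W" "I 2 \<subseteq> ?W"
    using seqv.subspace_0[OF subI(1)] seqv.subspace_0[OF subI(2)] by force+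
  consider v where "v \<in> sp N 3" "v \<notin> ?W" | v where "v \<in> I 1" "v \<notin> I 2" | v where "v \<in> I 2" "v \<notin> I 1"
    | v where "v \<in> I 1" "v \<in> I 2" "v \<notin> {0}"
  proof (atomize_elim, rule ccontr)
    assume *: "\<not> ((\<exists>v. v \<in> sp N 3 \<and> v \<notin> ?W) \<or> (\<exists>v. v \<in> I 1 \<and> v \<notin> I 2) \<or> (\<exists>v. v \<in> I 2 \<and> v \<notin> I 1) \<or>
        (\<exists>v. v \<in> I 1 \<and> v \<in> I 2 \<and> v \<notin> {0}))"
    then have "x = 0" if "x \<in> I 1 \<union> I 2" for x using that by blast
    then have "x + y = 0" if "x \<in> I 1" "y \<in> I 2" for x y using that by (metis UnI1 UnI2 add_0)
    then have "?W \<subseteq> {0}" by blast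
    then have "sp N 3 \<subseteq> {0}" using * by blast
    then show False using False pmod_0_in[OF N F(3)] by blast
  qed
  then show ?thesis
  proof cases
    case 1
    show ?thesis by (rule split[OF _ _ 1(1) subW 1(2), of "{3}"]) (use IW in auto)
  next
    case 2
    show ?thesis by (rule split[OF _ _ _ subI(2) 2(2), of "{1, 3}"]) (use 2 I3 in auto)
  next
    case 3
    show ?thesis by (rule split[OF _ _ _ subI(1) 3(2), of "{2, 3}"]) (use 3 I3 in auto)
  next
    case 4
    show ?thesis
      by (rule split[OF _ _ _ seqv.subspace_single_0 4(3), of "{1, 2, 3}"]) (use 4 I3 in auto)
  qed
qed

section \<open>Kan extensions along an order-embedding\<close>

definition convex_closure :: "'p rel \<Rightarrow> 'p set \<Rightarrow> 'p set" where
  "convex_closure P A = {p. \<exists>a\<in>A. \<exists>b\<in>A. (a, p) \<in> P \<and> (p, b) \<in> P}"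

text \<open>A family of sequences indexed by \<open>nat\<close> is coded as one sequence; \<open>proj\<close> and \<open>fam\<close> decode and
  encode.\<close>

definition proj :: "nat \<Rightarrow> 'k seq \<Rightarrow> 'k seq" where
  "proj x w = (\<lambda>i. w (prod_encode (x, i)))"

definition fam :: "(nat \<Rightarrow> 'k seq) \<Rightarrow> 'k seq" where
  "fam g = (\<lambda>n. case prod_decode n of (x, i) \<Rightarrow> g x i)"

definition single :: "nat \<Rightarrow> 'k::field seq \<Rightarrow> 'k seq" where
  "single x v = fam (\<lambda>y. if y = x then v else 0)"

text \<open>The direct sum of the spaces \<open>V x\<close>, \<open>x \<in> E\<close>.\<close>

definition fams :: "nat set \<Rightarrow> (nat \<Rightarrow> 'k::field seq set) \<Rightarrow> 'k seq set" where
  "fams E V = {w. (\<forall>x\<in>E. proj x w \<in> V x) \<and> (\<forall>x. x \<notin> E \<longrightarrow> proj x w = 0)}"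

lemma proj_fam [simp]: "proj x (fam g) = g x"
  by (simp add: proj_def fam_def)

lemma fam_eqI: "(\<And>x. proj x v = proj x w) \<Longrightarrow> v = w"
proof
  fix n assume *: "\<And>x. proj x v = proj x w"
  obtain x i where "prod_decode n = (x, i)" by fastforce
  then have "n = prod_encode (x, i)" by (metis prod_decode_inverse)
  then show "v n = w n" using fun_cong[OF *[of x], of i] by (simp add: proj_def)
qed

lemma proj_add [simp]: "proj x (v + w) = proj x v + proj x w"
  and proj_diff [simp]: "proj x (v - w) = proj x v - proj x w"
  and proj_scale [simp]: "proj x (seq_scale c v) = seq_scale c (proj x v)"
  and proj_0 [simp]: "proj x 0 = (0 :: 'k::field seq)"
  for v w :: "'k::field seq"
  by (auto simp: proj_def seq_scale_def fun_eq_iff plus_fun_apply minus_apply zero_fun_apply)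

lemma proj_sum: "proj x (\<Sum>i\<in>I. g i) = (\<Sum>i\<in>I. proj x (g i :: 'k::field seq))"
  by (induction I rule: infinite_finite_induct) auto

lemma proj_single: "proj y (single x v) = (if y = x then v else 0)"
  by (simp add: single_def)

lemma single_add: "single x (u + v) = single x u + single x v"
  and single_scale: "single x (seq_scale c v) = seq_scale c (single x v)"
  by (rule fam_eqI; simp add: proj_single)+

lemma fams_decompose:
  assumes "finite E" "w \<in> fams E V"
  shows "w = (\<Sum>x\<in>E. single x (proj x w))"
proof (rule fam_eqI)
  fix y show "proj y w = proj y (\<Sum>x\<in>E. single x (proj x w))"
    using assms by (auto simp: proj_sum proj_single fams_def)
qed

lemma subspace_fams: "(\<And>x. x \<in> E \<Longrightarrow> seqv.subspace (V x)) \<Longrightarrow> seqv.subspace (fams E V)"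
  by (auto simp: seqv.subspace_def fams_def)

lemma fd_space_fams:
  assumes "finite E" and V: "\<And>x. x \<in> E \<Longrightarrow> fd_space (V x)"
  shows "fd_space (fams E V)"
proof -
  have "\<exists>C. finite C \<and> single x ` V x = seqv.span C" if "x \<in> E" for x
  proof -
    have "lin_map (V x) UNIV (single x)" by (auto simp: lin_map_def single_add single_scale)
    from fd_space_image[OF V[OF that] this] show ?thesis unfolding fd_space_def .
  qed
  then obtain C where C: "\<And>x. x \<in> E \<Longrightarrow> finite (C x)" "\<And>x. x \<in> E \<Longrightarrow> single x ` V x = seqv.span (C x)"
    by metis
  have "w \<in> seqv.span (\<Union>x\<in>E. C x)" if w: "w \<in> fams E V" for w
  proof -
    have "single x (proj x w) \<in> seqv.span (\<Union>x\<in>E. C x)" if x: "x \<in> E" for x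
    proof -
      have "single x (proj x w) \<in> seqv.span (C x)" using w x C(2)[OF x] by (auto simp: fams_def)
      moreover have "seqv.span (C x) \<subseteq> seqv.span (\<Union>x\<in>E. C x)" using x by (intro seqv.span_mono) blast
      ultimately show ?thesis by blast
    qed
    then have "(\<Sum>x\<in>E. single x (proj x w)) \<in> seqv.span (\<Union>x\<in>E. C x)" by (rule seqv.span_sum)
    then show ?thesis using fams_decompose[OF assms(1) w] by simp
  qed
  then show ?thesis
    using assms C(1) V[THEN fd_space_subspace]
    by (intro fd_space_if_spanned[of _ "\<Union>x\<in>E. C x"] subspace_fams) auto
qed

lemma sp_restr [simp]: "sp (restr f M) x = sp M (f x)"
  and tr_restr [simp]: "tr (restr f M) x y = tr M (f x) (f y)"
  by (simp_all add: restr_def)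

locale poset_embedding =
  fixes X :: "nat rel" and P :: "'p rel" and f :: "nat \<Rightarrow> 'p"
  assumes finite_X: "finite (Field X)" and order_P: "Partial_order P"
    and f_emb: "f \<in> order_embeddings X P"
begin

lemma f_in: "x \<in> Field X \<Longrightarrow> f x \<in> Field P"
  using f_emb by (auto simp: order_embeddings_def)

lemma f_iff: "x \<in> Field X \<Longrightarrow> y \<in> Field X \<Longrightarrow> (f x, f y) \<in> P \<longleftrightarrow> (x, y) \<in> X"
  using f_emb by (auto simp: order_embeddings_def)

lemma f_mono: "(x, y) \<in> X \<Longrightarrow> (f x, f y) \<in> P"
  using f_iff by (meson FieldI1 FieldI2)

lemma refl_P: "p \<in> Field P \<Longrightarrow> (p, p) \<in> P"
  using order_P by (auto simp: order_on_defs refl_on_def)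

lemma trans_P: "(p, q) \<in> P \<Longrightarrow> (q, r) \<in> P \<Longrightarrow> (p, r) \<in> P"
  using order_P by (auto simp: order_on_defs dest: transD)

lemma refl_X: "x \<in> Field X \<Longrightarrow> (x, x) \<in> X"
  using f_iff f_in refl_P by blast

lemma is_pmod_restr:
  assumes "is_pmod P M" shows "is_pmod X (restr f M)"
  unfolding is_pmod_def
proof (intro conjI ballI allI impI)
  fix x assume "x \<in> X"
  then show "case x of (p, q) \<Rightarrow> lin_map (sp (restr f M) p) (sp (restr f M) q) (tr (restr f M) p q)"
    using pmod_lin[OF assms] f_mono by (cases x) simp
qed (use pmod_fd[OF assms] pmod_tr_id[OF assms] pmod_tr_tr[OF assms] f_in f_mono in simp_all)

lemma restr_hom: "pmod_hom P M N h \<Longrightarrow> pmod_hom X (restr f M) (restr f N) (\<lambda>x. h (f x))"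
  unfolding pmod_hom_def[of X] by (auto simp: hom_tr f_mono f_in hom_lin)

lemma restr_iso:
  assumes "is_pmod P M" "pmod_iso P M N" shows "pmod_iso X (restr f M) (restr f N)"
proof -
  obtain h where "pmod_hom P M N h" "\<forall>p\<in>Field P. bij_betw (h p) (sp M p) (sp N p)"
    using assms(2) by (auto simp: pmod_iso_def)
  then show ?thesis
    unfolding pmod_iso_def by (intro exI[of _ "\<lambda>x. h (f x)"]) (auto simp: restr_hom f_in)
qed

lemma restr_sum: "restr f (pmod_sum M N) = pmod_sum (restr f M) (restr f N)"
  by (simp add: restr_def pmod_sum_def)

subsection \<open>The right adjoint\<close>

definition above :: "'p \<Rightarrow> nat set" where
  "above p = {x \<in> Field X. (p, f x) \<in> P}"

text \<open>The value at \<open>p\<close> is the limit of \<open>U\<close> over the elements of \<open>X\<close> whose image is above \<open>p\<close>.\<close>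

definition right_kan :: "(nat, 'k::field) pmod \<Rightarrow> ('p, 'k) pmod" where
  "right_kan U = \<lparr>sp = (\<lambda>p. {w \<in> fams (above p) (sp U).
       \<forall>(x, y)\<in>X. x \<in> above p \<longrightarrow> tr U x y (proj x w) = proj y w}),
     tr = (\<lambda>p q w. fam (\<lambda>x. if x \<in> above q then proj x w else 0))\<rparr>"

lemma above_mono: "(p, q) \<in> P \<Longrightarrow> above q \<subseteq> above p"
  by (auto simp: above_def intro: trans_P)

lemma above_up: "(x, y) \<in> X \<Longrightarrow> x \<in> above p \<Longrightarrow> y \<in> above p"
  using f_mono trans_P by (auto simp: above_def Field_def)

lemma above_f: "x \<in> Field X \<Longrightarrow> y \<in> above (f x) \<longleftrightarrow> (x, y) \<in> X"
  using f_iff by (auto simp: above_def Field_def)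

lemma above_self: "x \<in> Field X \<Longrightarrow> x \<in> above (f x)"
  using above_f refl_X by blast

lemma in_right_kan: "w \<in> sp (right_kan U) p \<longleftrightarrow> (\<forall>x\<in>above p. proj x w \<in> sp U x) \<and>
    (\<forall>x. x \<notin> above p \<longrightarrow> proj x w = 0) \<and>
    (\<forall>x y. (x, y) \<in> X \<longrightarrow> x \<in> above p \<longrightarrow> tr U x y (proj x w) = proj y w)"
  by (auto simp: right_kan_def fams_def)

lemma proj_tr_right_kan [simp]:
  "proj x (tr (right_kan U) p q w) = (if x \<in> above q then proj x w else 0)"
  by (simp add: right_kan_def)

lemma is_pmod_right_kan:
  assumes U: "is_pmod X U" shows "is_pmod P (right_kan U)"
  unfolding is_pmod_def
proof (intro conjI ballI allI impI)
  fix p assume "p \<in> Field P"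
  have sub: "seqv.subspace (sp U x)" if "x \<in> above p" for x
    using that pmod_subspace[OF U] by (simp add: above_def)
  have "seqv.subspace (sp (right_kan U) p)"
    unfolding seqv.subspace_def
    using sub pmod_tr_0[OF U] above_up
    by (auto simp: in_right_kan seqv.subspace_0 seqv.subspace_add seqv.subspace_scale
        lin_map_add[OF pmod_lin[OF U]] lin_map_scale[OF pmod_lin[OF U]])
  moreover have "fd_space (fams (above p) (sp U))"
    using finite_X pmod_fd[OF U] by (intro fd_space_fams) (auto simp: above_def)
  moreover have "sp (right_kan U) p \<subseteq> fams (above p) (sp U)" by (auto simp: right_kan_def)
  ultimately show "fd_space (sp (right_kan U) p)" using fd_space_subset by blast
next
  fix x assume "x \<in> P"
  then obtain p q where x: "x = (p, q)" and pq: "(p, q) \<in> P" by (cases x) auto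
  have "tr (right_kan U) p q w \<in> sp (right_kan U) q" if "w \<in> sp (right_kan U) p" for w
    using that above_mono[OF pq] above_up by (auto simp: in_right_kan)
  moreover have "tr (right_kan U) p q (v + w) = tr (right_kan U) p q v + tr (right_kan U) p q w"
    "tr (right_kan U) p q (seq_scale c v) = seq_scale c (tr (right_kan U) p q v)" for c v w
    by (rule fam_eqI, simp)+
  ultimately show "case x of (p, q) \<Rightarrow> lin_map (sp (right_kan U) p) (sp (right_kan U) q) (tr (right_kan U) p q)"
    by (auto simp: x lin_map_def)
next
  fix p w assume "w \<in> sp (right_kan U) p"
  then show "tr (right_kan U) p p w = w" by - (rule fam_eqI, auto simp: in_right_kan)
next
  fix p q r w assume "(p, q) \<in> P" "(q, r) \<in> P" "w \<in> sp (right_kan U) p"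
  then show "tr (right_kan U) q r (tr (right_kan U) p q w) = tr (right_kan U) p r w"
    using above_mono[of q r] by - (rule fam_eqI, auto)
qed

lemma right_kan_right_adj:
  fixes U :: "(nat, 'k::field) pmod"
  assumes U: "is_pmod X U"
  shows "is_right_adj X P f U (right_kan U) proj"
  unfolding is_right_adj_def
proof (intro conjI allI impI)
  let ?R = "right_kan U"
  show R: "is_pmod P ?R" using is_pmod_right_kan[OF U] .
  show "pmod_hom X (restr f ?R) U proj"
    unfolding pmod_hom_def
  proof (intro conjI ballI)
    fix x assume "x \<in> Field X"
    then show "lin_map (sp (restr f ?R) x) (sp U x) (proj x)"
      using above_f refl_X by (auto simp: lin_map_def in_right_kan)
  next
    fix z assume "z \<in> X"
    then obtain x y where z: "z = (x, y)" and xy: "(x, y) \<in> X" by (cases z) auto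
    then have "x \<in> above (f x)" "y \<in> above (f y)" by (simp_all add: above_self FieldI1 FieldI2)
    then show "case z of (x, y) \<Rightarrow> \<forall>v\<in>sp (restr f ?R) x. proj y (tr (restr f ?R) x y v) = tr U x y (proj x v)"
      using xy by (auto simp: z in_right_kan)
  qed
  fix N :: "('p, 'k) pmod" and g assume N: "is_pmod P N" and g: "pmod_hom X (restr f N) U g"
  define h where "h p v = fam (\<lambda>x. if x \<in> above p then g x (tr N p (f x) v) else 0)" for p v
  have above_P: "(p, f x) \<in> P" "x \<in> Field X" if "x \<in> above p" for p x using that by (auto simp: above_def)
  have h_hom: "pmod_hom P N ?R h"
    unfolding pmod_hom_def
  proof (intro conjI ballI)
    fix p assume p: "p \<in> Field P"
    have "h p v \<in> sp ?R p" if v: "v \<in> sp N p" for v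
      unfolding in_right_kan
    proof (intro conjI ballI allI impI)
      fix x assume x: "x \<in> above p"
      then have "tr N p (f x) v \<in> sp N (f x)" using pmod_tr_in[OF N above_P(1) v] by blast
      then show "proj x (h p v) \<in> sp U x" using hom_in[OF g above_P(2)[OF x]] x by (simp add: h_def)
    next
      fix x y assume xy: "(x, y) \<in> X" and x: "x \<in> above p"
      then have y: "y \<in> above p" using above_up by blast
      have "tr N p (f x) v \<in> sp (restr f N) x" using pmod_tr_in[OF N above_P(1)[OF x] v] by simp
      from hom_tr[OF g xy this]
      have "tr U x y (g x (tr N p (f x) v)) = g y (tr N p (f y) v)"
        using pmod_tr_tr[OF N above_P(1)[OF x] f_mono[OF xy] v] by simp
      then show "tr U x y (proj x (h p v)) = proj y (h p v)" using x y by (simp add: h_def)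
    qed (simp add: h_def)
    moreover have "h p (u + v) = h p u + h p v" if "u \<in> sp N p" "v \<in> sp N p" for u v
    proof (rule fam_eqI)
      fix x show "proj x (h p (u + v)) = proj x (h p u + h p v)"
        using that lin_map_add[OF pmod_lin[OF N above_P(1)]] pmod_tr_in[OF N above_P(1)]
          lin_map_add[OF hom_lin[OF g above_P(2)]]
        by (simp add: h_def)
    qed
    moreover have "h p (seq_scale c v) = seq_scale c (h p v)" if "v \<in> sp N p" for c v
    proof (rule fam_eqI)
      fix x show "proj x (h p (seq_scale c v)) = proj x (seq_scale c (h p v))"
        using that lin_map_scale[OF pmod_lin[OF N above_P(1)]] pmod_tr_in[OF N above_P(1)]
          lin_map_scale[OF hom_lin[OF g above_P(2)]]
        by (simp add: h_def)
    qed
    ultimately show "lin_map (sp N p) (sp ?R p) (h p)" by (auto simp: lin_map_def)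
  next
    fix z assume "z \<in> P"
    then obtain p q where z: "z = (p, q)" and pq: "(p, q) \<in> P" by (cases z) auto
    have "h q (tr N p q v) = tr ?R p q (h p v)" if "v \<in> sp N p" for v
    proof (rule fam_eqI)
      fix x show "proj x (h q (tr N p q v)) = proj x (tr ?R p q (h p v))"
        using pmod_tr_tr[OF N pq above_P(1) that, of x] above_mono[OF pq] by (auto simp: h_def)
    qed
    then show "case z of (p, q) \<Rightarrow> \<forall>v\<in>sp N p. h q (tr N p q v) = tr ?R p q (h p v)" by (simp add: z)
  qed
  have eps_h: "proj x (h (f x) v) = g x v" if "x \<in> Field X" "v \<in> sp N (f x)" for x v
    using that above_f refl_X pmod_tr_id[OF N f_in] by (simp add: h_def)
  have uniq: "h' p v = h p v"
    if h': "pmod_hom P N ?R h'" and eps: "\<forall>x\<in>Field X. \<forall>v\<in>sp N (f x). proj x (h' (f x) v) = g x v"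
      and p: "p \<in> Field P" and v: "v \<in> sp N p" for h' p v
  proof (rule fam_eqI)
    fix x
    have h'v: "h' p v \<in> sp ?R p" using hom_in[OF h' p v] .
    show "proj x (h' p v) = proj x (h p v)"
    proof (cases "x \<in> above p")
      case True
      note x = above_P[OF True]
      have "proj x (h' p v) = proj x (tr ?R p (f x) (h' p v))"
        using above_f[OF x(2)] refl_X[OF x(2)] by simp
      also have "\<dots> = proj x (h' (f x) (tr N p (f x) v))" using hom_tr[OF h' x(1) v] by simp
      also have "\<dots> = g x (tr N p (f x) v)" using eps x(2) pmod_tr_in[OF N x(1) v] by blast
      finally show ?thesis using True by (simp add: h_def)
    next
      case False
      then show ?thesis using h'v by (simp add: in_right_kan h_def)
    qed
  qed
  show "\<exists>h. pmod_hom P N ?R h \<and> (\<forall>x\<in>Field X. \<forall>v\<in>sp N (f x). proj x (h (f x) v) = g x v) \<and>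
     (\<forall>h'. pmod_hom P N ?R h' \<longrightarrow> (\<forall>x\<in>Field X. \<forall>v\<in>sp N (f x). proj x (h' (f x) v) = g x v) \<longrightarrow>
        (\<forall>p\<in>Field P. \<forall>v\<in>sp N p. h' p v = h p v))"
    using h_hom eps_h uniq by (intro exI[of _ h]) blast
qed

text \<open>Over \<open>f x\<close> the limit is taken over the elements above \<open>x\<close>, among which \<open>x\<close> is the least: a
  compatible family is determined by its entry at \<open>x\<close>.\<close>

lemma right_kan_counit_inj:
  assumes "x \<in> Field X" "v \<in> sp (right_kan U) (f x)" "w \<in> sp (right_kan U) (f x)" "proj x v = proj x w"
  shows "v = w"
proof (rule fam_eqI)
  fix y
  have x: "x \<in> above (f x)" using assms(1) above_f refl_X by blast
  show "proj y v = proj y w"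
  proof (cases "y \<in> above (f x)")
    case True
    then have "(x, y) \<in> X" using above_f[OF assms(1)] by blast
    then show ?thesis using assms(2-4) x unfolding in_right_kan by metis
  qed (use assms in \<open>simp add: in_right_kan\<close>)
qed

subsection \<open>The left adjoint\<close>

definition below :: "'p \<Rightarrow> nat set" where
  "below p = {x \<in> Field X. (f x, p) \<in> P}"

text \<open>The relations that turn the direct sum over the elements with image below \<open>p\<close> into the colimit.\<close>

definition relations :: "(nat, 'k::field) pmod \<Rightarrow> 'p \<Rightarrow> 'k seq set" where
  "relations U p = seqv.span {single x u - single y (tr U x y u) | x y u.
     (x, y) \<in> X \<and> y \<in> below p \<and> u \<in> sp U x}"

lemma below_mono: "(p, q) \<in> P \<Longrightarrow> below p \<subseteq> below q"
  by (auto simp: below_def intro: trans_P)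

lemma below_down: "(x, y) \<in> X \<Longrightarrow> y \<in> below p \<Longrightarrow> x \<in> below p"
  using trans_P[OF f_mono, of x y p] FieldI1[of x y X] by (simp add: below_def)

lemma below_f: "x \<in> Field X \<Longrightarrow> x \<in> below (f x)"
  using refl_P f_in by (auto simp: below_def)

text \<open>The value of the left adjoint at \<open>p\<close> is the colimit of \<open>U\<close> over the elements of \<open>X\<close> whose image is
  below \<open>p\<close>: the image of the direct sum \<open>T p\<close> under a map \<open>\<pi> p\<close> with kernel \<open>relations U p\<close>.\<close>

lemma left_adj_exists:
  fixes U :: "(nat, 'k::field) pmod"
  assumes U: "is_pmod X U"
  shows "\<exists>L \<eta>. is_left_adj X P f U L \<eta>"
proof -
  define T where "T p = fams (below p) (sp U)" for p
  have below_P: "(f x, p) \<in> P" "x \<in> Field X" if "x \<in> below p" for p x using that by (auto simp: below_def)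
  have finite_below: "finite (below p)" for p using finite_X by (auto simp: below_def)
  have subT: "seqv.subspace (T p)" for p
    unfolding T_def using pmod_subspace[OF U] below_P(2) by (intro subspace_fams) blast
  have single_T: "single x u \<in> T p" if "x \<in> below p" "u \<in> sp U x" for x u p
    using that pmod_0_in[OF U] by (auto simp: T_def fams_def proj_single below_def)
  have T_mono: "T p \<subseteq> T q" if "(p, q) \<in> P" for p q
    using below_mono[OF that] pmod_0_in[OF U] below_P(2) by (auto simp: T_def fams_def)
  have rel_T: "relations U p \<subseteq> T p" for p
    unfolding relations_def
    by (intro seqv.span_minimal subT)
      (auto intro!: seqv.subspace_diff[OF subT] single_T intro: below_down pmod_tr_in[OF U])
  have rel_mono: "relations U p \<subseteq> relations U q" if "(p, q) \<in> P" for p q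
    unfolding relations_def using below_mono[OF that] by (intro seqv.span_mono) blast
  have "\<exists>\<pi>. lin_map UNIV UNIV \<pi> \<and> (\<forall>v. \<pi> v = 0 \<longleftrightarrow> v \<in> relations U p)" for p
  proof -
    have "seqv.subspace (relations U p)" by (simp add: relations_def)
    then show ?thesis using quotient_map by metis
  qed
  then obtain \<pi> where \<pi>: "\<And>p. lin_map UNIV UNIV (\<pi> p)" and ker: "\<And>p v. \<pi> p v = 0 \<longleftrightarrow> v \<in> relations U p"
    by metis
  have \<pi>T: "lin_map (T p) (\<pi> p ` T p) (\<pi> p)" for p
    using \<pi>[of p] by (auto simp: lin_map_def)
  have \<pi>_eq: "\<pi> p v = \<pi> p w \<longleftrightarrow> v - w \<in> relations U p" for p v w
    using lin_map_diff[OF seqv.subspace_UNIV \<pi>[of p], of v w] ker[of p "v - w"] by auto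
  define rep where "rep p v = (SOME w. w \<in> T p \<and> \<pi> p w = v)" for p v
  have rep: "rep p (\<pi> p w) \<in> T p" "\<pi> p (rep p (\<pi> p w)) = \<pi> p w" if "w \<in> T p" for p w
    unfolding rep_def using someI[of "\<lambda>w'. w' \<in> T p \<and> \<pi> p w' = \<pi> p w" w] that by auto
  define L where "L = \<lparr>sp = (\<lambda>p. \<pi> p ` T p), tr = (\<lambda>p q v. \<pi> q (rep p v))\<rparr>"
  have spL: "sp L p = \<pi> p ` T p" for p by (simp add: L_def)
  have trL: "tr L p q (\<pi> p w) = \<pi> q w" if "(p, q) \<in> P" "w \<in> T p" for p q w
  proof -
    have "rep p (\<pi> p w) - w \<in> relations U p" using rep[OF that(2)] \<pi>_eq by blast
    then have "rep p (\<pi> p w) - w \<in> relations U q" using rel_mono[OF that(1)] by blast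
    then show ?thesis using \<pi>_eq by (simp add: L_def)
  qed
  have L: "is_pmod P L"
    unfolding is_pmod_def
  proof (intro conjI ballI allI impI)
    fix p assume "p \<in> Field P"
    have "fd_space (T p)" unfolding T_def
      using finite_below pmod_fd[OF U] below_P(2) by (intro fd_space_fams) blast+
    then show "fd_space (sp L p)" unfolding spL using fd_space_image[OF _ \<pi>T] by blast
  next
    fix z assume "z \<in> P"
    then obtain p q where z: "z = (p, q)" and pq: "(p, q) \<in> P" by (cases z) auto
    have "lin_map (sp L p) (sp L q) (tr L p q)"
      unfolding lin_map_def spL
    proof (intro conjI ballI allI)
      show "tr L p q ` \<pi> p ` T p \<subseteq> \<pi> q ` T q" using trL[OF pq] T_mono[OF pq] by auto
    next
      fix u v assume "u \<in> \<pi> p ` T p" "v \<in> \<pi> p ` T p"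
      then obtain u' v' where *: "u' \<in> T p" "v' \<in> T p" "u = \<pi> p u'" "v = \<pi> p v'" by blast
      have "u + v = \<pi> p (u' + v')" using lin_map_add[OF \<pi>] * by simp
      then show "tr L p q (u + v) = tr L p q u + tr L p q v"
        using * trL[OF pq, of "u' + v'"] trL[OF pq, of u'] trL[OF pq, of v']
          seqv.subspace_add[OF subT *(1,2)] lin_map_add[OF \<pi>, of u' v' q] by auto
    next
      fix c v assume "v \<in> \<pi> p ` T p"
      then obtain v' where *: "v' \<in> T p" "v = \<pi> p v'" by blast
      have "seq_scale c v = \<pi> p (seq_scale c v')" using lin_map_scale[OF \<pi>] * by simp
      then show "tr L p q (seq_scale c v) = seq_scale c (tr L p q v)"
        using * trL[OF pq, of "seq_scale c v'"] trL[OF pq, of v']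
          seqv.subspace_scale[OF subT *(1), of c] lin_map_scale[OF \<pi>, of v' q c] by auto
    qed
    then show "case z of (p, q) \<Rightarrow> lin_map (sp L p) (sp L q) (tr L p q)" by (simp add: z)
  next
    fix p v assume "p \<in> Field P" "v \<in> sp L p"
    then show "tr L p p v = v" using trL refl_P by (auto simp: spL)
  next
    fix p q r v assume pq: "(p, q) \<in> P" and qr: "(q, r) \<in> P" and v: "v \<in> sp L p"
    then show "tr L q r (tr L p q v) = tr L p r v"
      using trL[OF pq] trL[OF qr] trL[OF trans_P[OF pq qr]] T_mono[OF pq] by (auto simp: spL)
  qed
  define \<eta> where "\<eta> x u = \<pi> (f x) (single x u)" for x u
  have \<eta>: "pmod_hom X U (restr f L) \<eta>"
    unfolding pmod_hom_def
  proof (intro conjI ballI)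
    fix x assume x: "x \<in> Field X"
    then show "lin_map (sp U x) (sp (restr f L) x) (\<eta> x)"
      unfolding lin_map_def using single_T[OF below_f[OF x]]
      by (auto simp: spL \<eta>_def single_add single_scale lin_map_add[OF \<pi>] lin_map_scale[OF \<pi>])
  next
    fix z assume "z \<in> X"
    then obtain x y where z: "z = (x, y)" and xy: "(x, y) \<in> X" by (cases z) auto
    have F: "x \<in> Field X" "y \<in> Field X" using xy by (auto simp: Field_def)
    have "\<eta> y (tr U x y u) = tr (restr f L) x y (\<eta> x u)" if u: "u \<in> sp U x" for u
    proof -
      have "tr (restr f L) x y (\<eta> x u) = \<pi> (f y) (single x u)"
        using trL[OF f_mono[OF xy] single_T[OF below_f[OF F(1)] u]] by (simp add: \<eta>_def)
      moreover have "single x u - single y (tr U x y u) \<in> relations U (f y)"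
        unfolding relations_def using xy below_f[OF F(2)] u by (intro seqv.span_base) blast
      ultimately show ?thesis
        using \<pi>_eq[of "f y" "single x u" "single y (tr U x y u)"] by (simp add: \<eta>_def)
    qed
    then show "case z of (x, y) \<Rightarrow> \<forall>u\<in>sp U x. \<eta> y (tr U x y u) = tr (restr f L) x y (\<eta> x u)"
      by (simp add: z)
  qed
  have univ: "\<exists>h. pmod_hom P L N h \<and> (\<forall>x\<in>Field X. \<forall>u\<in>sp U x. h (f x) (\<eta> x u) = g x u) \<and>
       (\<forall>h'. pmod_hom P L N h' \<longrightarrow> (\<forall>x\<in>Field X. \<forall>u\<in>sp U x. h' (f x) (\<eta> x u) = g x u) \<longrightarrow>
          (\<forall>p\<in>Field P. \<forall>v\<in>sp L p. h' p v = h p v))"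
    if N: "is_pmod P N" and g: "pmod_hom X U (restr f N) g" for N g
  proof -
    \<comment> \<open>\<open>G p\<close> is the map on the direct sum that should factor through \<open>\<pi> p\<close>.\<close>
    define G where "G p w = (\<Sum>x\<in>below p. tr N (f x) p (g x (proj x w)))" for p w
    have gN: "g x u \<in> sp N (f x)" if "x \<in> Field X" "u \<in> sp U x" for x u
      using hom_in[OF g that] by simp
    have g_0: "g x 0 = 0" if "x \<in> Field X" for x using hom_0[OF U g that] .
    have term_in: "tr N (f x) p (g x (proj x w)) \<in> sp N p" if "x \<in> below p" "w \<in> T p" for x p w
      using that by (intro pmod_tr_in[OF N below_P(1)] gN[OF below_P(2)]) (auto simp: T_def fams_def)
    have GT: "lin_map (T p) (sp N p) (G p)" if p: "p \<in> Field P" for p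
      unfolding lin_map_def
    proof (intro conjI ballI allI)
      show "G p ` T p \<subseteq> sp N p"
        unfolding G_def by (auto intro!: seqv.subspace_sum[OF pmod_subspace[OF N p]] term_in)
    next
      fix u v assume "u \<in> T p" "v \<in> T p"
      then have "tr N (f x) p (g x (proj x (u + v))) =
          tr N (f x) p (g x (proj x u)) + tr N (f x) p (g x (proj x v))" if "x \<in> below p" for x
        using that lin_map_add[OF hom_lin[OF g below_P(2)[OF that]]]
          lin_map_add[OF pmod_lin[OF N below_P(1)[OF that]]] gN[OF below_P(2)[OF that]]
        by (simp add: T_def fams_def)
      then show "G p (u + v) = G p u + G p v" by (simp add: G_def sum.distrib)
    next
      fix c v assume "v \<in> T p"
      then have "tr N (f x) p (g x (proj x (seq_scale c v))) = seq_scale c (tr N (f x) p (g x (proj x v)))"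
        if "x \<in> below p" for x
        using that lin_map_scale[OF hom_lin[OF g below_P(2)[OF that]]]
          lin_map_scale[OF pmod_lin[OF N below_P(1)[OF that]]] gN[OF below_P(2)[OF that]]
        by (simp add: T_def fams_def)
      then show "G p (seq_scale c v) = seq_scale c (G p v)" by (simp add: G_def seqv.scale_sum_right)
    qed
    have G_single: "G p (single x u) = tr N (f x) p (g x u)" if x: "x \<in> below p" and u: "u \<in> sp U x" for p x u
    proof -
      have "tr N (f z) p (g z (proj z (single x u))) = (if z = x then tr N (f x) p (g x u) else 0)"
        if "z \<in> below p" for z
        using g_0[OF below_P(2)[OF that]] pmod_tr_0[OF N below_P(1)[OF that]] by (simp add: proj_single)
      then show ?thesis using finite_below x by (simp add: G_def)
    qed
    have G_ker: "G p w = 0" if p: "p \<in> Field P" and w: "w \<in> relations U p" for p w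
    proof -
      have "single x u - single y (tr U x y u) \<in> {w \<in> T p. G p w = 0}"
        if xy: "(x, y) \<in> X" and y: "y \<in> below p" and u: "u \<in> sp U x" for x y u
      proof -
        note x = below_down[OF xy y] and u' = pmod_tr_in[OF U xy u]
        have "tr N (f y) p (g y (tr U x y u)) = tr N (f x) p (g x u)"
          using hom_tr[OF g xy u] pmod_tr_tr[OF N f_mono[OF xy] below_P(1)[OF y] gN[OF below_P(2)[OF x] u]]
          by simp
        then have "G p (single x u - single y (tr U x y u)) = 0"
          using lin_map_diff[OF subT GT[OF p] single_T[OF x u] single_T[OF y u']]
            G_single[OF x u] G_single[OF y u'] by simp
        then show ?thesis using seqv.subspace_diff[OF subT single_T[OF x u] single_T[OF y u']] by blast
      qed
      then have "relations U p \<subseteq> {w \<in> T p. G p w = 0}"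
        unfolding relations_def by (intro seqv.span_minimal subspace_ker[OF subT GT[OF p]]) blast
      then show ?thesis using w by blast
    qed
    define h where "h p v = G p (rep p v)" for p v
    have h: "h p (\<pi> p w) = G p w" if "p \<in> Field P" "w \<in> T p" for p w
    proof -
      have "rep p (\<pi> p w) - w \<in> relations U p" using rep[OF that(2)] \<pi>_eq by blast
      then have "G p (rep p (\<pi> p w) - w) = 0" using G_ker[OF that(1)] by blast
      then show ?thesis
        using lin_map_diff[OF subT GT[OF that(1)] rep(1)[OF that(2)] that(2)] by (simp add: h_def)
    qed
    have h_hom: "pmod_hom P L N h"
      unfolding pmod_hom_def
    proof (intro conjI ballI)
      fix p assume p: "p \<in> Field P"
      show "lin_map (sp L p) (sp N p) (h p)"
        unfolding lin_map_def spL
      proof (intro conjI ballI allI)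
        show "h p ` \<pi> p ` T p \<subseteq> sp N p" using h[OF p] lin_map_in[OF GT[OF p]] by auto
      next
        fix u v assume "u \<in> \<pi> p ` T p" "v \<in> \<pi> p ` T p"
        then obtain u' v' where *: "u' \<in> T p" "v' \<in> T p" "u = \<pi> p u'" "v = \<pi> p v'" by blast
        have "u + v = \<pi> p (u' + v')" using lin_map_add[OF \<pi>] * by simp
        then show "h p (u + v) = h p u + h p v"
          using * h[OF p, of "u' + v'"] h[OF p, of u'] h[OF p, of v']
            seqv.subspace_add[OF subT *(1,2)] lin_map_add[OF GT[OF p] *(1,2)] by auto
      next
        fix c v assume "v \<in> \<pi> p ` T p"
        then obtain v' where *: "v' \<in> T p" "v = \<pi> p v'" by blast
        have "seq_scale c v = \<pi> p (seq_scale c v')" using lin_map_scale[OF \<pi>] * by simp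
        then show "h p (seq_scale c v) = seq_scale c (h p v)"
          using * h[OF p, of "seq_scale c v'"] h[OF p, of v']
            seqv.subspace_scale[OF subT *(1), of c] lin_map_scale[OF GT[OF p] *(1), of c] by auto
      qed
    next
      fix z assume "z \<in> P"
      then obtain p q where z: "z = (p, q)" and pq: "(p, q) \<in> P" by (cases z) auto
      have F: "p \<in> Field P" "q \<in> Field P" using pq by (auto simp: Field_def)
      have "h q (tr L p q v) = tr N p q (h p v)" if "v \<in> sp L p" for v
      proof -
        obtain w where w: "w \<in> T p" "v = \<pi> p w" using \<open>v \<in> sp L p\<close> by (auto simp: spL)
        have "h q (tr L p q v) = G q w"
          using trL[OF pq w(1)] h[OF F(2)] T_mono[OF pq] w by auto
        also have "\<dots> = (\<Sum>x\<in>below p. tr N (f x) q (g x (proj x w)))"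
          unfolding G_def
        proof (rule sum.mono_neutral_right[OF finite_below below_mono[OF pq]], intro ballI)
          fix x assume x: "x \<in> below q - below p"
          then have "proj x w = 0" using w(1) by (auto simp: T_def fams_def)
          then show "tr N (f x) q (g x (proj x w)) = 0"
            using x g_0 below_P pmod_tr_0[OF N] by auto
        qed
        also have "\<dots> = (\<Sum>x\<in>below p. tr N p q (tr N (f x) p (g x (proj x w))))"
          using w(1) pmod_tr_tr[OF N below_P(1) pq gN[OF below_P(2)]]
          by (intro sum.cong) (auto simp: T_def fams_def)
        also have "\<dots> = tr N p q (h p v)"
          using lin_map_sum[OF pmod_subspace[OF N F(1)] pmod_lin[OF N pq], of "below p"
              "\<lambda>x. tr N (f x) p (g x (proj x w))"] term_in[OF _ w(1)]
          by (simp add: w(2) h[OF F(1) w(1)] G_def)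
        finally show ?thesis .
      qed
      then show "case z of (p, q) \<Rightarrow> \<forall>v\<in>sp L p. h q (tr L p q v) = tr N p q (h p v)" by (simp add: z)
    qed
    have h_\<eta>: "h (f x) (\<eta> x u) = g x u" if x: "x \<in> Field X" and u: "u \<in> sp U x" for x u
      using h[OF f_in[OF x] single_T[OF below_f[OF x] u]] G_single[OF below_f[OF x] u]
        pmod_tr_id[OF N f_in[OF x] gN[OF x u]] by (simp add: \<eta>_def)
    have "h' p v = h p v"
      if h': "pmod_hom P L N h'" and eta: "\<forall>x\<in>Field X. \<forall>u\<in>sp U x. h' (f x) (\<eta> x u) = g x u"
        and p: "p \<in> Field P" and v: "v \<in> sp L p" for h' p v
    proof -
      obtain w where w: "w \<in> T p" "v = \<pi> p w" using v by (auto simp: spL)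
      have wU: "proj x w \<in> sp U x" if "x \<in> below p" for x using that w(1) by (auto simp: T_def fams_def)
      have "w = (\<Sum>x\<in>below p. single x (proj x w))"
        using w(1) by (intro fams_decompose[OF finite_below]) (simp add: T_def)
      from arg_cong[OF this, of "\<pi> p"]
      have "v = \<pi> p (\<Sum>x\<in>below p. single x (proj x w))" unfolding w(2) .
      also have "\<dots> = (\<Sum>x\<in>below p. \<pi> p (single x (proj x w)))"
        by (rule lin_map_sum[OF seqv.subspace_UNIV \<pi>]) simp
      finally have v_sum: "v = (\<Sum>x\<in>below p. \<pi> p (single x (proj x w)))" .
      have "\<pi> p (single x (proj x w)) \<in> sp L p" if "x \<in> below p" for x
        using single_T[OF that wU[OF that]] by (simp add: spL)
      then have "h' p v = (\<Sum>x\<in>below p. h' p (\<pi> p (single x (proj x w))))"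
        unfolding v_sum by (intro lin_map_sum[OF pmod_subspace[OF L p] hom_lin[OF h' p]])
      also have "\<dots> = G p w"
        unfolding G_def
      proof (rule sum.cong[OF refl])
        fix x assume x: "x \<in> below p"
        note xP = below_P[OF x]
        have s: "single x (proj x w) \<in> T (f x)" using single_T[OF below_f[OF xP(2)] wU[OF x]] .
        have "h' p (\<pi> p (single x (proj x w))) = h' p (tr L (f x) p (\<eta> x (proj x w)))"
          using trL[OF xP(1) s] by (simp add: \<eta>_def)
        also have "\<dots> = tr N (f x) p (h' (f x) (\<eta> x (proj x w)))"
          using hom_tr[OF h' xP(1)] s by (simp add: \<eta>_def spL)
        also have "h' (f x) (\<eta> x (proj x w)) = g x (proj x w)" using eta xP(2) wU[OF x] by blast
        finally show "h' p (\<pi> p (single x (proj x w))) = tr N (f x) p (g x (proj x w))" .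
      qed
      finally show ?thesis using h[OF p w(1)] w(2) by simp
    qed
    then show ?thesis using h_hom h_\<eta> by (intro exI[of _ h]) blast
  qed
  have "is_left_adj X P f U L \<eta>" unfolding is_left_adj_def using L \<eta> univ by blast
  then show ?thesis by blast
qed

subsection \<open>The intermediate extension\<close>

lemma left_adj_induced:
  assumes "is_left_adj X P f U L \<eta>" "is_pmod P N" "pmod_hom X U (restr f N) g"
  obtains h where "pmod_hom P L N h" "\<And>x u. x \<in> Field X \<Longrightarrow> u \<in> sp U x \<Longrightarrow> h (f x) (\<eta> x u) = g x u"
    "\<And>h' p v. pmod_hom P L N h' \<Longrightarrow> \<forall>x\<in>Field X. \<forall>u\<in>sp U x. h' (f x) (\<eta> x u) = g x u \<Longrightarrow>
       p \<in> Field P \<Longrightarrow> v \<in> sp L p \<Longrightarrow> h' p v = h p v"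
proof -
  from assms(1) have "\<forall>N g. is_pmod P N \<longrightarrow> pmod_hom X U (restr f N) g \<longrightarrow>
        (\<exists>h. pmod_hom P L N h \<and> (\<forall>x\<in>Field X. \<forall>u\<in>sp U x. h (f x) (\<eta> x u) = g x u) \<and>
           (\<forall>h'. pmod_hom P L N h' \<longrightarrow> (\<forall>x\<in>Field X. \<forall>u\<in>sp U x. h' (f x) (\<eta> x u) = g x u) \<longrightarrow>
              (\<forall>p\<in>Field P. \<forall>v\<in>sp L p. h' p v = h p v)))"
    unfolding is_left_adj_def by (elim conjE)
  from this[rule_format, OF assms(2,3)] obtain h where
    *: "pmod_hom P L N h \<and> (\<forall>x\<in>Field X. \<forall>u\<in>sp U x. h (f x) (\<eta> x u) = g x u) \<and>
           (\<forall>h'. pmod_hom P L N h' \<longrightarrow> (\<forall>x\<in>Field X. \<forall>u\<in>sp U x. h' (f x) (\<eta> x u) = g x u) \<longrightarrow>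
              (\<forall>p\<in>Field P. \<forall>v\<in>sp L p. h' p v = h p v))" ..
  show thesis by (rule that[of h]) (use * in blast)+
qed

lemma right_adj_induced:
  assumes "is_right_adj X P f U R \<epsilon>" "is_pmod P N" "pmod_hom X (restr f N) U g"
  obtains h where "pmod_hom P N R h" "\<And>x v. x \<in> Field X \<Longrightarrow> v \<in> sp N (f x) \<Longrightarrow> \<epsilon> x (h (f x) v) = g x v"
    "\<And>h' p v. pmod_hom P N R h' \<Longrightarrow> \<forall>x\<in>Field X. \<forall>v\<in>sp N (f x). \<epsilon> x (h' (f x) v) = g x v \<Longrightarrow>
       p \<in> Field P \<Longrightarrow> v \<in> sp N p \<Longrightarrow> h' p v = h p v"
proof -
  from assms(1) have "\<forall>N g. is_pmod P N \<longrightarrow> pmod_hom X (restr f N) U g \<longrightarrow>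
        (\<exists>h. pmod_hom P N R h \<and> (\<forall>x\<in>Field X. \<forall>v\<in>sp N (f x). \<epsilon> x (h (f x) v) = g x v) \<and>
           (\<forall>h'. pmod_hom P N R h' \<longrightarrow>
              (\<forall>x\<in>Field X. \<forall>v\<in>sp N (f x). \<epsilon> x (h' (f x) v) = g x v) \<longrightarrow>
              (\<forall>p\<in>Field P. \<forall>v\<in>sp N p. h' p v = h p v)))"
    unfolding is_right_adj_def by (elim conjE)
  from this[rule_format, OF assms(2,3)] obtain h where
    *: "pmod_hom P N R h \<and> (\<forall>x\<in>Field X. \<forall>v\<in>sp N (f x). \<epsilon> x (h (f x) v) = g x v) \<and>
           (\<forall>h'. pmod_hom P N R h' \<longrightarrow>
              (\<forall>x\<in>Field X. \<forall>v\<in>sp N (f x). \<epsilon> x (h' (f x) v) = g x v) \<longrightarrow>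
              (\<forall>p\<in>Field P. \<forall>v\<in>sp N p. h' p v = h p v))" ..
  show thesis by (rule that[of h]) (use * in blast)+
qed

text \<open>The right adjoint is only given up to isomorphism, but its counit is injective over the image of
  \<open>f\<close> because that of \<open>right_kan U\<close> is. This is what makes the map \<open>theta\<close> unique.\<close>

lemma chosen_adjoints:
  fixes U :: "(nat, 'k::field) pmod"
  assumes U: "is_pmod X U"
  obtains L \<eta> R \<epsilon> where "left_adj X P f U = (L, \<eta>)" "right_adj X P f U = (R, \<epsilon>)"
    "is_left_adj X P f U L \<eta>" "is_right_adj X P f U R \<epsilon>"
    "\<And>x v w. x \<in> Field X \<Longrightarrow> v \<in> sp R (f x) \<Longrightarrow> w \<in> sp R (f x) \<Longrightarrow> \<epsilon> x v = \<epsilon> x w \<Longrightarrow> v = w"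
proof -
  obtain L \<eta> where L: "left_adj X P f U = (L, \<eta>)" by fastforce
  obtain R \<epsilon> where R: "right_adj X P f U = (R, \<epsilon>)" by fastforce
  have "\<exists>z. case z of (L, \<eta>) \<Rightarrow> is_left_adj X P f U L \<eta>" using left_adj_exists[OF U] by auto
  from someI_ex[OF this] have L': "is_left_adj X P f U L \<eta>"
    unfolding left_adj_def[symmetric] L by simp
  have "\<exists>z. case z of (R, \<epsilon>) \<Rightarrow> is_right_adj X P f U R \<epsilon>" using right_kan_right_adj[OF U] by auto
  from someI_ex[OF this] have R': "is_right_adj X P f U R \<epsilon>"
    unfolding right_adj_def[symmetric] R by simp
  let ?K = "right_kan U"
  note K' = right_kan_right_adj[OF U]
  have Rm: "is_pmod P R" and \<epsilon>: "pmod_hom X (restr f R) U \<epsilon>" using R' by (auto simp: is_right_adj_def)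
  have Km: "is_pmod P ?K" and proj: "pmod_hom X (restr f ?K) U proj" using K' by (auto simp: is_right_adj_def)
  obtain a where a: "pmod_hom P R ?K a" "\<And>x v. x \<in> Field X \<Longrightarrow> v \<in> sp R (f x) \<Longrightarrow> proj x (a (f x) v) = \<epsilon> x v"
    by (rule right_adj_induced[OF K' Rm \<epsilon>]) blast
  obtain b where b: "pmod_hom P ?K R b" "\<And>x v. x \<in> Field X \<Longrightarrow> v \<in> sp ?K (f x) \<Longrightarrow> \<epsilon> x (b (f x) v) = proj x v"
    by (rule right_adj_induced[OF R' Km proj]) blast
  obtain e where e: "\<And>h' p v. pmod_hom P R R h' \<Longrightarrow>
      \<forall>x\<in>Field X. \<forall>v\<in>sp R (f x). \<epsilon> x (h' (f x) v) = \<epsilon> x v \<Longrightarrow> p \<in> Field P \<Longrightarrow> v \<in> sp R p \<Longrightarrow> h' p v = e p v"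
    by (rule right_adj_induced[OF R' Rm \<epsilon>]) blast
  have ba: "b p (a p v) = v" if "p \<in> Field P" "v \<in> sp R p" for p v
  proof -
    have "\<forall>x\<in>Field X. \<forall>v\<in>sp R (f x). \<epsilon> x (b (f x) (a (f x) v)) = \<epsilon> x v"
      using a b hom_in[OF a(1) f_in] by simp
    then have "b p (a p v) = e p v" using e[OF hom_comp[OF a(1) b(1)]] that by blast
    moreover have "v = e p v" using e[OF hom_id] that by blast
    ultimately show ?thesis by simp
  qed
  have "v = w" if x: "x \<in> Field X" and v: "v \<in> sp R (f x)" and w: "w \<in> sp R (f x)"
    and eq: "\<epsilon> x v = \<epsilon> x w" for x v w
  proof -
    have "proj x (a (f x) v) = proj x (a (f x) w)" using a(2)[OF x] v w eq by simp
    then have "a (f x) v = a (f x) w"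
      using right_kan_counit_inj[OF x] hom_in[OF a(1) f_in[OF x]] v w by blast
    then show ?thesis using ba[OF f_in[OF x]] v w by metis
  qed
  with that L R L' R' show ?thesis by blast
qed

text \<open>The characterisation of the intermediate extension: the homomorphisms from the left adjoint to \<open>T\<close>
  and from \<open>T\<close> to the right adjoint that are induced by \<open>\<iota>\<close> and \<open>j\<close> compose to \<open>theta\<close>. The first is
  surjective by \<open>gen\<close>, the second injective by \<open>cogen\<close>, so \<open>T\<close> is the image.\<close>

lemma Theta_unique:
  fixes U :: "(nat, 'k::field) pmod"
  assumes U: "is_pmod X U" and T: "is_pmod P T"
    and \<iota>: "pmod_hom X U (restr f T) \<iota>" and j: "pmod_hom X (restr f T) U j"
    and j\<iota>: "\<And>x u. x \<in> Field X \<Longrightarrow> u \<in> sp U x \<Longrightarrow> j x (\<iota> x u) = u"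
    and \<iota>j: "\<And>x v. x \<in> Field X \<Longrightarrow> v \<in> sp T (f x) \<Longrightarrow> \<iota> x (j x v) = v"
    and gen: "\<And>p v. p \<in> Field P \<Longrightarrow> v \<in> sp T p \<Longrightarrow> v \<noteq> 0 \<Longrightarrow>
      \<exists>x\<in>Field X. (f x, p) \<in> P \<and> (\<exists>w\<in>sp T (f x). tr T (f x) p w = v)"
    and cogen: "\<And>p v. p \<in> Field P \<Longrightarrow> v \<in> sp T p \<Longrightarrow> v \<noteq> 0 \<Longrightarrow>
      \<exists>x\<in>Field X. (p, f x) \<in> P \<and> tr T p (f x) v \<noteq> 0"
  shows "pmod_iso P T (Theta X P f U)" and "is_pmod P (Theta X P f U)"
proof -
  obtain L \<eta> R \<epsilon> where LR: "left_adj X P f U = (L, \<eta>)" "right_adj X P f U = (R, \<epsilon>)"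
    and L: "is_left_adj X P f U L \<eta>" and R: "is_right_adj X P f U R \<epsilon>"
    and \<epsilon>_inj: "\<And>x v w. x \<in> Field X \<Longrightarrow> v \<in> sp R (f x) \<Longrightarrow> w \<in> sp R (f x) \<Longrightarrow> \<epsilon> x v = \<epsilon> x w \<Longrightarrow> v = w"
    using chosen_adjoints[OF U] by blast
  have Lm: "is_pmod P L" and \<eta>: "pmod_hom X U (restr f L) \<eta>" using L by (auto simp: is_left_adj_def)
  have Rm: "is_pmod P R" and \<epsilon>: "pmod_hom X (restr f R) U \<epsilon>" using R by (auto simp: is_right_adj_def)
  obtain a where a: "pmod_hom P L T a" "\<And>x u. x \<in> Field X \<Longrightarrow> u \<in> sp U x \<Longrightarrow> a (f x) (\<eta> x u) = \<iota> x u"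
    by (rule left_adj_induced[OF L T \<iota>]) blast
  obtain b where b: "pmod_hom P T R b" "\<And>x v. x \<in> Field X \<Longrightarrow> v \<in> sp T (f x) \<Longrightarrow> \<epsilon> x (b (f x) v) = j x v"
    by (rule right_adj_induced[OF R T j]) blast
  define \<theta> where "\<theta> = theta X P f U"
  have \<theta>_def': "\<theta> = (SOME h. pmod_hom P L R h \<and> (\<forall>x\<in>Field X. \<forall>u\<in>sp U x. \<epsilon> x (h (f x) (\<eta> x u)) = u))"
    by (simp add: \<theta>_def theta_def LR)
  have comp: "pmod_hom P L R (\<lambda>p v. b p (a p v))" using hom_comp[OF a(1) b(1)] .
  have comp_id: "\<epsilon> x (b (f x) (a (f x) (\<eta> x u))) = u" if "x \<in> Field X" "u \<in> sp U x" for x u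
    using that a(2) b(2) hom_in[OF \<iota> that] j\<iota> by simp
  have "\<exists>h. pmod_hom P L R h \<and> (\<forall>x\<in>Field X. \<forall>u\<in>sp U x. \<epsilon> x (h (f x) (\<eta> x u)) = u)"
    using comp comp_id by blast
  from someI_ex[OF this] have \<theta>: "pmod_hom P L R \<theta>"
    and \<theta>_id: "\<And>x u. x \<in> Field X \<Longrightarrow> u \<in> sp U x \<Longrightarrow> \<epsilon> x (\<theta> (f x) (\<eta> x u)) = u"
    unfolding \<theta>_def'[symmetric] by blast+
  \<comment> \<open>Both \<open>\<theta>\<close> and \<open>b \<circ> a\<close> are inverted by \<open>\<epsilon>\<close> on the image of the unit. As \<open>\<epsilon>\<close> is injective, they agree
    there, and so everywhere by the uniqueness clause for the left adjoint.\<close>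
  define g where "g x u = \<theta> (f x) (\<eta> x u)" for x u
  have g: "pmod_hom X U (restr f R) g" unfolding g_def using hom_comp[OF \<eta> restr_hom[OF \<theta>]] .
  obtain e where e: "\<And>h' p v. pmod_hom P L R h' \<Longrightarrow> \<forall>x\<in>Field X. \<forall>u\<in>sp U x. h' (f x) (\<eta> x u) = g x u \<Longrightarrow>
      p \<in> Field P \<Longrightarrow> v \<in> sp L p \<Longrightarrow> h' p v = e p v"
    by (rule left_adj_induced[OF L Rm g]) blast
  have "b (f x) (a (f x) (\<eta> x u)) = g x u" if x: "x \<in> Field X" and u: "u \<in> sp U x" for x u
  proof (rule \<epsilon>_inj[OF x])
    have "\<eta> x u \<in> sp L (f x)" using hom_in[OF \<eta> x u] by simp
    then show "b (f x) (a (f x) (\<eta> x u)) \<in> sp R (f x)" using hom_in[OF comp f_in[OF x]] by blast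
    show "g x u \<in> sp R (f x)" using hom_in[OF g x u] by simp
    show "\<epsilon> x (b (f x) (a (f x) (\<eta> x u))) = \<epsilon> x (g x u)"
      using comp_id[OF x u] \<theta>_id[OF x u] by (simp add: g_def)
  qed
  then have \<theta>_eq: "\<theta> p v = b p (a p v)" if "p \<in> Field P" "v \<in> sp L p" for p v
    using e[OF comp _ that] e[OF \<theta> _ that] by (simp add: g_def)
  have a_surj: "a p ` sp L p = sp T p" if p: "p \<in> Field P" for p
  proof
    show "a p ` sp L p \<subseteq> sp T p" using hom_in[OF a(1) p] by blast
    show "sp T p \<subseteq> a p ` sp L p"
    proof
      fix v assume v: "v \<in> sp T p"
      show "v \<in> a p ` sp L p"
      proof (cases "v = 0")
        case True
        then show ?thesis using hom_0[OF Lm a(1) p] pmod_0_in[OF Lm p] by (metis image_eqI)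
      next
        case False
        then obtain x w where x: "x \<in> Field X" "(f x, p) \<in> P" and w: "w \<in> sp T (f x)" "tr T (f x) p w = v"
          using gen[OF p v] by blast
        have jw: "j x w \<in> sp U x" using hom_in[OF j x(1)] w(1) by simp
        have "\<eta> x (j x w) \<in> sp L (f x)" using hom_in[OF \<eta> x(1) jw] by simp
        moreover from this have "a p (tr L (f x) p (\<eta> x (j x w))) = v"
          using hom_tr[OF a(1) x(2)] a(2)[OF x(1) jw] \<iota>j[OF x(1) w(1)] w(2) by simp
        ultimately show ?thesis using pmod_tr_in[OF Lm x(2)] by (metis image_eqI)
      qed
    qed
  qed
  have b_inj: "inj_on (b p) (sp T p)" if p: "p \<in> Field P" for p
  proof (rule inj_onI, rule ccontr)
    fix v w assume v: "v \<in> sp T p" and w: "w \<in> sp T p" and eq: "b p v = b p w" and "v \<noteq> w"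
    note sub = pmod_subspace[OF T p]
    have d: "v - w \<in> sp T p" "v - w \<noteq> 0" using seqv.subspace_diff[OF sub v w] \<open>v \<noteq> w\<close> by auto
    have bd: "b p (v - w) = 0" using lin_map_diff[OF sub hom_lin[OF b(1) p] v w] eq by simp
    obtain x where x: "x \<in> Field X" "(p, f x) \<in> P" "tr T p (f x) (v - w) \<noteq> 0"
      using cogen[OF p d] by blast
    let ?y = "tr T p (f x) (v - w)"
    have y: "?y \<in> sp T (f x)" using pmod_tr_in[OF T x(2) d(1)] .
    have "b (f x) ?y = 0" using hom_tr[OF b(1) x(2) d(1)] bd pmod_tr_0[OF Rm x(2)] by simp
    then have "j x ?y = \<epsilon> x 0" using b(2)[OF x(1) y] by simp
    also have "\<epsilon> x 0 = 0" using hom_0[OF is_pmod_restr[OF Rm] \<epsilon> x(1)] .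
    finally have "?y = \<iota> x 0" using \<iota>j[OF x(1) y] by simp
    then show False using hom_0[OF U \<iota> x(1)] x(3) by simp
  qed
  have Theta: "Theta X P f U = image_pmod L R \<theta>" by (simp add: Theta_def LR \<theta>_def)
  have sp_Theta: "sp (Theta X P f U) p = b p ` sp T p" if "p \<in> Field P" for p
  proof -
    have "\<theta> p ` sp L p = b p ` a p ` sp L p"
      unfolding image_image by (rule image_cong[OF refl \<theta>_eq[OF that]])
    then show ?thesis using a_surj[OF that] by (simp add: Theta image_pmod_def)
  qed
  have tr_Theta: "tr (Theta X P f U) = tr R" by (simp add: Theta image_pmod_def)
  have hom_b: "pmod_hom P T (Theta X P f U) b"
    unfolding pmod_hom_def[of P T "Theta X P f U"]
  proof (intro conjI ballI)
    fix p assume p: "p \<in> Field P"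
    show "lin_map (sp T p) (sp (Theta X P f U) p) (b p)"
      unfolding sp_Theta[OF p] using hom_lin[OF b(1) p] by (simp add: lin_map_def)
  next
    fix z assume "z \<in> P"
    then show "case z of (p, q) \<Rightarrow> \<forall>v\<in>sp T p. b q (tr T p q v) = tr (Theta X P f U) p q (b p v)"
      unfolding tr_Theta using b(1) by (auto simp: pmod_hom_def)
  qed
  have "bij_betw (b p) (sp T p) (sp (Theta X P f U) p)" if "p \<in> Field P" for p
    unfolding bij_betw_def using b_inj[OF that] sp_Theta[OF that] by simp
  with hom_b show "pmod_iso P T (Theta X P f U)"
    unfolding pmod_iso_def by blast
  have sub_R: "sp (Theta X P f U) p \<subseteq> sp R p" if "p \<in> Field P" for p
    unfolding sp_Theta[OF that] using hom_in[OF b(1) that] by (rule image_subsetI)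
  show "is_pmod P (Theta X P f U)"
    unfolding is_pmod_def
  proof (intro conjI ballI allI impI)
    fix p assume p: "p \<in> Field P"
    show "fd_space (sp (Theta X P f U) p)"
      unfolding sp_Theta[OF p] by (rule fd_space_image[OF pmod_fd[OF T p] hom_lin[OF b(1) p]])
  next
    fix z assume "z \<in> P"
    then obtain p q where z: "z = (p, q)" and pq: "(p, q) \<in> P" by (cases z) auto
    have F: "p \<in> Field P" "q \<in> Field P" using pq by (auto simp: Field_def)
    have "tr R p q v \<in> sp (Theta X P f U) q" if "v \<in> sp (Theta X P f U) p" for v
    proof -
      obtain t where t: "t \<in> sp T p" "v = b p t"
        using \<open>v \<in> sp (Theta X P f U) p\<close> unfolding sp_Theta[OF F(1)] by blast
      show ?thesis
        unfolding sp_Theta[OF F(2)] t(2) hom_tr[OF b(1) pq t(1), symmetric]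
        using pmod_tr_in[OF T pq t(1)] by (rule imageI)
    qed
    then show "case z of (p, q) \<Rightarrow>
        lin_map (sp (Theta X P f U) p) (sp (Theta X P f U) q) (tr (Theta X P f U) p q)"
      unfolding z prod.case tr_Theta
      using pmod_lin[OF Rm pq] sub_R[OF F(1)] unfolding lin_map_def by blast
  next
    fix p v assume "p \<in> Field P" "v \<in> sp (Theta X P f U) p"
    then show "tr (Theta X P f U) p p v = v" using sub_R pmod_tr_id[OF Rm] by (auto simp: tr_Theta)
  next
    fix p q r v assume pq: "(p, q) \<in> P" and qr: "(q, r) \<in> P" and "v \<in> sp (Theta X P f U) p"
    then have "v \<in> sp R p" using sub_R[of p] by (auto simp: Field_def)
    then show "tr (Theta X P f U) q r (tr (Theta X P f U) p q v) = tr (Theta X P f U) p r v"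
      using pmod_tr_tr[OF Rm pq qr] by (simp add: tr_Theta)
  qed
qed

lemma convex_closure_superset: "A \<subseteq> Field P \<Longrightarrow> A \<subseteq> convex_closure P A"
  unfolding convex_closure_def using refl_P by blast

lemma convex_convex_closure: "convex_in P (convex_closure P A)"
  unfolding convex_in_def convex_closure_def using trans_P by blast

lemma convex_closure_mono_iff: "A \<subseteq> Field P \<Longrightarrow> convex_closure P A \<subseteq> convex_closure P B \<longleftrightarrow> A \<subseteq> convex_closure P B"
proof
  assume "A \<subseteq> convex_closure P B"
  then show "convex_closure P A \<subseteq> convex_closure P B" unfolding convex_closure_def using trans_P by blast
qed (use convex_closure_superset in blast)

text \<open>Every point of the convex closure lies between two points of \<open>f ` S\<close>, and the structure maps there
  are identities; so the interval module is generated from below and cogenerated from above.\<close>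

lemma Theta_interval:
  fixes U :: "(nat, 'k::field) pmod"
  assumes U: "is_pmod X U" and iso: "pmod_iso X U (interval_pmod S)"
    and S: "S \<subseteq> Field X" "convex_in X S"
  shows "pmod_iso P (interval_pmod (convex_closure P (f ` S))) (Theta X P f U)" and "is_pmod P (Theta X P f U)"
proof -
  let ?T = "interval_pmod (convex_closure P (f ` S)) :: ('p, 'k) pmod"
  let ?K = "interval_pmod S :: (nat, 'k) pmod"
  have T: "is_pmod P ?T" using is_pmod_interval[OF convex_convex_closure] .
  have fS: "f x \<in> convex_closure P (f ` S) \<longleftrightarrow> x \<in> S" if x: "x \<in> Field X" for x
  proof
    assume "f x \<in> convex_closure P (f ` S)"
    then obtain s t where "s \<in> S" "t \<in> S" "(f s, f x) \<in> P" "(f x, f t) \<in> P" by (auto simp: convex_closure_def)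
    then show "x \<in> S" using S f_iff x unfolding convex_in_def by (meson subsetD)
  next
    assume "x \<in> S"
    moreover have "f ` S \<subseteq> Field P" using S f_in by blast
    ultimately show "f x \<in> convex_closure P (f ` S)" using convex_closure_superset by blast
  qed
  have sp_eq: "sp (restr f ?T) x = sp ?K x" if "x \<in> Field X" for x
    using fS[OF that] by (simp add: sp_interval)
  have tr_eq: "tr (restr f ?T) x y v = tr ?K x y v" if "(x, y) \<in> X" for x y v
    using fS that by (simp add: tr_interval FieldI1 FieldI2)
  obtain h g where h: "pmod_hom X U ?K h" and g: "pmod_hom X ?K U g"
    and gh: "\<And>p v. p \<in> Field X \<Longrightarrow> v \<in> sp U p \<Longrightarrow> g p (h p v) = v"
    and hg: "\<And>p v. p \<in> Field X \<Longrightarrow> v \<in> sp ?K p \<Longrightarrow> h p (g p v) = v"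
    using pmod_isoE[OF U iso] by metis
  have h': "pmod_hom X U (restr f ?T) h"
    unfolding pmod_hom_def[of X U "restr f ?T"]
  proof (intro conjI ballI)
    fix x assume x: "x \<in> Field X"
    show "lin_map (sp U x) (sp (restr f ?T) x) (h x)" unfolding sp_eq[OF x] by (rule hom_lin[OF h x])
  next
    fix z assume "z \<in> X"
    then obtain x y where z: "z = (x, y)" and xy: "(x, y) \<in> X" by (cases z) auto
    show "case z of (x, y) \<Rightarrow> \<forall>u\<in>sp U x. h y (tr U x y u) = tr (restr f ?T) x y (h x u)"
      unfolding z prod.case tr_eq[OF xy] using hom_tr[OF h xy] by blast
  qed
  have g': "pmod_hom X (restr f ?T) U g"
    unfolding pmod_hom_def[of X "restr f ?T" U]
  proof (intro conjI ballI)
    fix x assume x: "x \<in> Field X"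
    show "lin_map (sp (restr f ?T) x) (sp U x) (g x)" unfolding sp_eq[OF x] by (rule hom_lin[OF g x])
  next
    fix z assume "z \<in> X"
    then obtain x y where z: "z = (x, y)" and xy: "(x, y) \<in> X" by (cases z) auto
    have x: "x \<in> Field X" using xy by (auto simp: Field_def)
    show "case z of (x, y) \<Rightarrow> \<forall>v\<in>sp (restr f ?T) x. g y (tr (restr f ?T) x y v) = tr U x y (g x v)"
      unfolding z prod.case tr_eq[OF xy] sp_eq[OF x] using hom_tr[OF g xy] by blast
  qed
  have gen: "\<exists>x\<in>Field X. (f x, p) \<in> P \<and> (\<exists>w\<in>sp ?T (f x). tr ?T (f x) p w = v)"
    if "v \<in> sp ?T p" "v \<noteq> 0" for p v
  proof -
    have p: "p \<in> convex_closure P (f ` S)" and v: "v \<in> line" using that by (auto simp: sp_interval split: if_splits)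
    then obtain s where s: "s \<in> S" "(f s, p) \<in> P" by (auto simp: convex_closure_def)
    then show ?thesis
      using p v fS S by (intro bexI[of _ s] conjI bexI[of _ v]) (auto simp: sp_interval tr_interval)
  qed
  have cogen: "\<exists>x\<in>Field X. (p, f x) \<in> P \<and> tr ?T p (f x) v \<noteq> 0"
    if "v \<in> sp ?T p" "v \<noteq> 0" for p v
  proof -
    have p: "p \<in> convex_closure P (f ` S)" using that by (auto simp: sp_interval split: if_splits)
    then obtain s where s: "s \<in> S" "(p, f s) \<in> P" by (auto simp: convex_closure_def)
    then show ?thesis
      using p that fS S by (intro bexI[of _ s] conjI) (auto simp: tr_interval)
  qed
  have hg': "\<And>x v. x \<in> Field X \<Longrightarrow> v \<in> sp ?T (f x) \<Longrightarrow> h x (g x v) = v" using hg sp_eq by simp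
  show "pmod_iso P ?T (Theta X P f U)" "is_pmod P (Theta X P f U)"
    using Theta_unique[OF U T h' g' gh hg' gen cogen] by blast+
qed

end

section \<open>Integer bases in abelian groups\<close>

lemma (in comm_group) generate_combination:
  fixes b :: "'i \<Rightarrow> 'a"
  assumes F: "finite F" and b: "b ` F \<subseteq> carrier G" and g: "g \<in> generate G (b ` F)"
  shows "\<exists>c :: 'i \<Rightarrow> int. g = (\<Otimes>J\<in>F. b J [^] c J)"
proof -
  have bc: "\<And>J. J \<in> F \<Longrightarrow> b J \<in> carrier G" using b by blast
  have unit: "(\<Otimes>J\<in>F. b J [^] (if J = I then n else 0 :: int)) = b I [^] n" if "I \<in> F" for I n
  proof -
    have "(\<Otimes>J\<in>F. b J [^] (if J = I then n else 0 :: int)) = (\<Otimes>J\<in>F. if J = I then b J [^] n else \<one>)"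
      using bc by (intro finprod_cong) (auto simp: simp_implies_def)
    also have "\<dots> = b I [^] n" using bc that F by (intro finprod_singleton_swap) auto
    finally show ?thesis .
  qed
  from g show ?thesis
  proof induction
    case one
    show ?case by (rule exI[of _ "\<lambda>_. 0"]) (simp add: finprod_one_eqI)
  next
    case (incl h)
    then obtain I where "I \<in> F" "h = b I" by blast
    then show ?case using unit[of I 1] bc by (metis int_pow_1)
  next
    case (inv h)
    then obtain I where I: "I \<in> F" "h = b I" by blast
    have "b I [^] (- 1 :: int) = inv (b I)" using int_pow_neg[OF bc[OF I(1)], of 1] bc[OF I(1)] by simp
    then show ?case using unit[OF I(1), of "- 1"] I(2) by metis
  next
    case (eng g h)
    then obtain c d where cd: "g = (\<Otimes>J\<in>F. b J [^] (c J :: int))" "h = (\<Otimes>J\<in>F. b J [^] (d J :: int))" by blast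
    have "(\<Otimes>J\<in>F. b J [^] (c J + d J)) = (\<Otimes>J\<in>F. b J [^] c J \<otimes> b J [^] d J)"
      using bc by (intro finprod_cong) (auto simp: int_pow_mult simp_implies_def)
    also have "\<dots> = g \<otimes> h" unfolding cd using bc by (intro finprod_multf) auto
    finally show ?case by metis
  qed
qed

lemma (in comm_group) combination_in_generate:
  fixes b :: "'i \<Rightarrow> 'a" and c :: "'i \<Rightarrow> int"
  assumes "finite F" "b ` F \<subseteq> carrier G"
  shows "(\<Otimes>J\<in>F. b J [^] c J) \<in> generate G (b ` F)"
proof -
  have sub: "subgroup (generate G (b ` F)) G" using assms(2) by (rule generate_is_subgroup)
  have "(\<Otimes>J\<in>E. b J [^] c J) \<in> generate G (b ` F)" if "E \<subseteq> F" for E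
    using finite_subset[OF that assms(1)] that
  proof (induction E rule: finite_induct)
    case empty
    show ?case by (simp add: generate.one)
  next
    case (insert I E)
    have "b I [^] c I \<in> generate G (b ` F)"
      using insert.prems by (intro subgroup_int_pow_closed[OF sub]) (auto intro: generate.incl)
    moreover have "(\<Otimes>J\<in>insert I E. b J [^] c J) = b I [^] c I \<otimes> (\<Otimes>J\<in>E. b J [^] c J)"
      using insert.hyps insert.prems assms(2) by (intro finprod_insert) auto
    ultimately show ?case using insert.IH insert.prems by (auto intro: generate.eng)
  qed
  then show ?thesis by blast
qed

lemma (in comm_group) hom_combination:
  fixes b :: "'i \<Rightarrow> 'a" and c :: "'i \<Rightarrow> int"
  assumes "finite F" "b ` F \<subseteq> carrier G" "e \<in> hom G integer_group"
  shows "e (\<Otimes>J\<in>F. b J [^] c J) = (\<Sum>J\<in>F. c J * e (b J))"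
proof -
  interpret e: group_hom G integer_group e
    using assms(3) by (simp add: group_hom_def group_hom_axioms_def is_group)
  have "e (\<Otimes>J\<in>E. b J [^] c J) = (\<Sum>J\<in>E. c J * e (b J))" if "E \<subseteq> F" for E
    using finite_subset[OF that assms(1)] that
  proof (induction E rule: finite_induct)
    case empty
    show ?case using e.hom_one by simp
  next
    case (insert I E)
    have bI: "b I \<in> carrier G" and bE: "(\<lambda>J. b J [^] c J) \<in> E \<rightarrow> carrier G"
      using insert.prems assms(2) by auto
    have "(\<Otimes>J\<in>insert I E. b J [^] c J) = b I [^] c I \<otimes> (\<Otimes>J\<in>E. b J [^] c J)"
      using insert.hyps bI bE by (intro finprod_insert) auto
    then have "e (\<Otimes>J\<in>insert I E. b J [^] c J) = e (b I [^] c I) + e (\<Otimes>J\<in>E. b J [^] c J)"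
      using e.hom_mult[OF int_pow_closed[OF bI] finprod_closed[OF bE]] by simp
    also have "e (b I [^] c I) = c I * e (b I)" using e.hom_int_pow[OF bI] by simp
    finally show ?case using insert by simp
  qed
  then show ?thesis by blast
qed

text \<open>If the rows \<open>\<Psi> (b J)\<close> are independent over the integers and span the values of \<open>\<Psi>\<close> on a
  generating set, then the \<open>b J\<close> freely generate a subgroup that \<open>\<Psi>\<close> maps isomorphically onto its whole
  image.\<close>

lemma (in comm_group) basis_of_image:
  fixes \<Psi> :: "'a \<Rightarrow> 'n \<Rightarrow> int" and b :: "'i \<Rightarrow> 'a"
  assumes \<Psi>: "\<Psi> \<in> hom G (Zpow N)" and F: "finite F" and b: "b ` F \<subseteq> carrier G"
    and indep: "\<And>c J. (\<And>n. n \<in> N \<Longrightarrow> (\<Sum>J\<in>F. c J * \<Psi> (b J) n) = 0) \<Longrightarrow> J \<in> F \<Longrightarrow> c J = 0"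
    and Y: "carrier G = generate G Y" "Y \<subseteq> carrier G"
    and span: "\<And>y. y \<in> Y \<Longrightarrow> \<exists>c. \<forall>n\<in>N. \<Psi> y n = (\<Sum>J\<in>F. c J * \<Psi> (b J) n)"
  shows "\<Psi> \<in> iso (subgroup_generated G (b ` F)) (Zpow N \<lparr>carrier := \<Psi> ` carrier G\<rparr>)"
    and "\<exists>S. finite S \<and> S \<subseteq> carrier (Zpow N) \<and> generate (Zpow N) S = \<Psi> ` carrier G"
proof -
  have grpZ: "group (Zpow N :: ('n \<Rightarrow> int) monoid)" by (simp add: Zpow_def)
  interpret h: group_hom G "Zpow N" \<Psi>
    using \<Psi> grpZ by (simp add: group_hom_def group_hom_axioms_def is_group)
  let ?H = "generate G (b ` F)"
  have \<Psi>_mult: "\<Psi> (x \<otimes> y) n = \<Psi> x n + \<Psi> y n" if "n \<in> N" "x \<in> carrier G" "y \<in> carrier G" for x y n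
    using h.hom_mult[OF that(2,3)] that(1) by (simp add: Zpow_def)
  have e: "(\<lambda>x. \<Psi> x n) \<in> hom G integer_group" if "n \<in> N" for n
    using \<Psi>_mult[OF that] by (auto simp: hom_def)
  have \<Psi>_eqI: "\<Psi> x = \<Psi> y" if "x \<in> carrier G" "y \<in> carrier G" "\<And>n. n \<in> N \<Longrightarrow> \<Psi> x n = \<Psi> y n" for x y
    using h.hom_closed[OF that(1)] h.hom_closed[OF that(2)] that(3)
    by (auto simp: Zpow_def intro: PiE_ext)
  have \<Psi>_comb: "\<Psi> (\<Otimes>J\<in>F. b J [^] c J) n = (\<Sum>J\<in>F. c J * \<Psi> (b J) n)" if "n \<in> N" for c :: "'i \<Rightarrow> int" and n
    using hom_combination[OF F b e[OF that]] .
  have combc: "(\<Otimes>J\<in>F. b J [^] c J) \<in> carrier G" for c :: "'i \<Rightarrow> int"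
    using b by (intro finprod_closed) auto
  have H: "?H \<subseteq> carrier G" using generate_incl[OF b] .
  have all: "\<exists>c. \<forall>n\<in>N. \<Psi> x n = (\<Sum>J\<in>F. c J * \<Psi> (b J) n)" if "x \<in> generate G Y" for x
    using that
  proof induction
    case one
    have "\<Psi> \<one> n = 0" if "n \<in> N" for n using h.hom_one that by (simp add: Zpow_def)
    then show ?case by (intro exI[of _ "\<lambda>_. 0"]) simp
  next
    case (incl y)
    then show ?case using span by blast
  next
    case (inv y)
    then obtain c where c: "\<forall>n\<in>N. \<Psi> y n = (\<Sum>J\<in>F. c J * \<Psi> (b J) n)" using span by blast
    have yc: "y \<in> carrier G" using inv Y(2) by blast
    have "\<Psi> (inv y) n = - \<Psi> y n" if "n \<in> N" for n
    proof -
      have "\<Psi> (inv y \<otimes> y) n = 0" using h.hom_one that yc by (simp add: Zpow_def)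
      then show ?thesis using \<Psi>_mult[OF that inv_closed[OF yc] yc] by simp
    qed
    then show ?case using c by (intro exI[of _ "\<lambda>J. - c J"]) (simp add: sum_negf)
  next
    case (eng x y)
    then obtain c d where "\<forall>n\<in>N. \<Psi> x n = (\<Sum>J\<in>F. c J * \<Psi> (b J) n)"
      "\<forall>n\<in>N. \<Psi> y n = (\<Sum>J\<in>F. d J * \<Psi> (b J) n)" by blast
    moreover have "x \<in> carrier G" "y \<in> carrier G" using eng Y by auto
    ultimately show ?case
      using \<Psi>_mult by (intro exI[of _ "\<lambda>J. c J + d J"]) (simp add: algebra_simps sum.distrib)
  qed
  have surj: "\<Psi> ` ?H = \<Psi> ` carrier G"
  proof
    show "\<Psi> ` ?H \<subseteq> \<Psi> ` carrier G" using H by blast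
    show "\<Psi> ` carrier G \<subseteq> \<Psi> ` ?H"
    proof
      fix w assume "w \<in> \<Psi> ` carrier G"
      then obtain x where x: "x \<in> carrier G" "w = \<Psi> x" by blast
      then obtain c where c: "\<forall>n\<in>N. \<Psi> x n = (\<Sum>J\<in>F. c J * \<Psi> (b J) n)" using all Y(1) by blast
      then have "w = \<Psi> (\<Otimes>J\<in>F. b J [^] c J)"
        unfolding x(2) using x(1) combc \<Psi>_comb by (intro \<Psi>_eqI) simp_all
      then show "w \<in> \<Psi> ` ?H" using combination_in_generate[OF F b] by blast
    qed
  qed
  have inj: "inj_on \<Psi> ?H"
  proof (rule inj_onI)
    fix x y assume "x \<in> ?H" "y \<in> ?H" and eq: "\<Psi> x = \<Psi> y"
    then obtain c d where x: "x = (\<Otimes>J\<in>F. b J [^] (c J :: int))" and y: "y = (\<Otimes>J\<in>F. b J [^] (d J :: int))"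
      using generate_combination[OF F b] by metis
    have "(\<Sum>J\<in>F. (c J - d J) * \<Psi> (b J) n) = 0" if "n \<in> N" for n
      using \<Psi>_comb[OF that, of c] \<Psi>_comb[OF that, of d] eq
      by (simp add: x y left_diff_distrib sum_subtractf)
    then have "c J = d J" if "J \<in> F" for J using indep[of "\<lambda>J. c J - d J" J] that by simp
    then show "x = y" unfolding x y using b by (intro finprod_cong) (auto simp: simp_implies_def)
  qed
  have carr: "carrier (subgroup_generated G (b ` F)) = ?H"
    using b by (simp add: carrier_subgroup_generated Int_absorb1)
  show "\<Psi> \<in> iso (subgroup_generated G (b ` F)) (Zpow N \<lparr>carrier := \<Psi> ` carrier G\<rparr>)"
    unfolding iso_def
  proof (intro CollectI conjI)
    show "\<Psi> \<in> hom (subgroup_generated G (b ` F)) (Zpow N \<lparr>carrier := \<Psi> ` carrier G\<rparr>)"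
      using H by (auto simp: hom_def carr subset_iff)
    show "bij_betw \<Psi> (carrier (subgroup_generated G (b ` F)))
        (carrier (Zpow N \<lparr>carrier := \<Psi> ` carrier G\<rparr>))"
      using inj surj by (simp add: bij_betw_def carr)
  qed
  show "\<exists>S. finite S \<and> S \<subseteq> carrier (Zpow N) \<and> generate (Zpow N) S = \<Psi> ` carrier G"
  proof (intro exI[of _ "\<Psi> ` b ` F"] conjI)
    show "\<Psi> ` b ` F \<subseteq> carrier (Zpow N)" using b h.hom_closed by blast
    show "generate (Zpow N) (\<Psi> ` b ` F) = \<Psi> ` carrier G" using h.generate_img[OF b] surj by simp
  qed (use F in simp)
qed

section \<open>Invariants from additive functions on modules\<close>

lemma k0_gens_comm_group: "comm_group (k0_gens P)"
  unfolding k0_gens_def by (rule abelian_free_Abelian_group)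

lemma k0_rels_subgroup: "subgroup (k0_rels P :: (('p, 'k::field) pmod set \<Rightarrow>\<^sub>0 int) set) (k0_gens P)"
proof -
  interpret comm_group "k0_gens P :: (('p, 'k) pmod set \<Rightarrow>\<^sub>0 int) monoid" by (rule k0_gens_comm_group)
  have "frag_of (isoclass P (pmod_sum M N)) - (frag_of (isoclass P M) + frag_of (isoclass P N))
      \<in> carrier (k0_gens P)" if "is_pmod P M" "is_pmod P N" for M N :: "('p, 'k) pmod"
  proof -
    let ?C = "isoclass P ` {M :: ('p, 'k) pmod. is_pmod P M}"
    have "Poly_Mapping.keys (frag_of (isoclass P M) + frag_of (isoclass P N)) \<subseteq> ?C"
      using that keys_add[of "frag_of (isoclass P M)" "frag_of (isoclass P N)"] by auto
    moreover have "Poly_Mapping.keys (frag_of (isoclass P (pmod_sum M N))) \<subseteq> ?C"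
      using that is_pmod_sum by auto
    ultimately show ?thesis
      using keys_diff[of "frag_of (isoclass P (pmod_sum M N))" "frag_of (isoclass P M) + frag_of (isoclass P N)"]
      by (auto simp: k0_gens_def)
  qed
  then show ?thesis unfolding k0_rels_def by (intro generate_is_subgroup) auto
qed

lemma K0sp_comm_group: "comm_group (K0sp P :: ('p, 'k::field) k0_elem monoid)"
  unfolding K0sp_def by (rule comm_group.abelian_FactGroup[OF k0_gens_comm_group k0_rels_subgroup])

lemma k0_class_hom:
  "(\<lambda>x. k0_rels P #>\<^bsub>k0_gens P\<^esub> x) \<in> hom (k0_gens P) (K0sp P :: ('p, 'k::field) k0_elem monoid)"
proof -
  interpret comm_group "k0_gens P :: (('p, 'k) pmod set \<Rightarrow>\<^sub>0 int) monoid" by (rule k0_gens_comm_group)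
  show ?thesis
    unfolding K0sp_def by (rule normal.r_coset_hom_Mod[OF subgroup_imp_normal[OF k0_rels_subgroup]])
qed

lemma frag_of_carrier: "is_pmod P M \<Longrightarrow> frag_of (isoclass P M) \<in> carrier (k0_gens P)"
  by (simp add: k0_gens_def)

lemma k0_class_carrier:
  "is_pmod P M \<Longrightarrow> k0_class P (isoclass P M) \<in> carrier (K0sp P)"
  unfolding k0_class_def using hom_carrier[OF k0_class_hom] frag_of_carrier by blast

lemma K0sp_generated:
  "carrier (K0sp P) = generate (K0sp P) (k0_class P ` isoclass P ` {M :: ('p, 'k::field) pmod. is_pmod P M})"
    (is "_ = generate _ ?Y")
proof
  let ?G = "K0sp P :: ('p, 'k) k0_elem monoid" and ?Q = "k0_gens P :: (('p, 'k) pmod set \<Rightarrow>\<^sub>0 int) monoid"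
  interpret G: comm_group ?G by (rule K0sp_comm_group)
  interpret Q: comm_group ?Q by (rule k0_gens_comm_group)
  interpret \<pi>: group_hom ?Q ?G "\<lambda>x. k0_rels P #>\<^bsub>k0_gens P\<^esub> x"
    using k0_class_hom by (simp add: group_hom_def group_hom_axioms_def G.is_group Q.is_group)
  have Y: "?Y \<subseteq> carrier ?G" using k0_class_carrier by blast
  show "generate ?G ?Y \<subseteq> carrier ?G" using G.generate_incl[OF Y] .
  have sub: "subgroup (generate ?G ?Y) ?G" using G.generate_is_subgroup[OF Y] .
  show "carrier ?G \<subseteq> generate ?G ?Y"
  proof
    fix g assume "g \<in> carrier ?G"
    then obtain x where x: "x \<in> carrier ?Q" "g = k0_rels P #>\<^bsub>?Q\<^esub> x"
      by (auto simp: K0sp_def carrier_FactGroup)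
    have keys: "Poly_Mapping.keys x \<subseteq> isoclass P ` {M. is_pmod P M}" using x(1) by (simp add: k0_gens_def)
    have "k0_rels P #>\<^bsub>?Q\<^esub> x \<in> generate ?G ?Y"
    proof (rule free_Abelian_group_induct[OF keys])
      have "k0_rels P #>\<^bsub>?Q\<^esub> \<one>\<^bsub>?Q\<^esub> = \<one>\<^bsub>?G\<^esub>" by (rule \<pi>.hom_one)
      then show "k0_rels P #>\<^bsub>?Q\<^esub> 0 \<in> generate ?G ?Y" by (simp add: k0_gens_def generate.one)
    next
      fix x y :: "('p, 'k) pmod set \<Rightarrow>\<^sub>0 int"
      assume keys: "Poly_Mapping.keys x \<subseteq> isoclass P ` {M. is_pmod P M}"
          "Poly_Mapping.keys y \<subseteq> isoclass P ` {M. is_pmod P M}"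
        and in_Y: "k0_rels P #>\<^bsub>?Q\<^esub> x \<in> generate ?G ?Y" "k0_rels P #>\<^bsub>?Q\<^esub> y \<in> generate ?G ?Y"
      then have xy: "x \<in> carrier ?Q" "y \<in> carrier ?Q" by (simp_all add: k0_gens_def)
      have "x - y = x \<otimes>\<^bsub>?Q\<^esub> inv\<^bsub>?Q\<^esub> y" using xy by (simp add: k0_gens_def)
      then have "k0_rels P #>\<^bsub>?Q\<^esub> (x - y) =
          (k0_rels P #>\<^bsub>?Q\<^esub> x) \<otimes>\<^bsub>?G\<^esub> inv\<^bsub>?G\<^esub> (k0_rels P #>\<^bsub>?Q\<^esub> y)"
        using \<pi>.hom_mult[OF xy(1) Q.inv_closed[OF xy(2)]] \<pi>.hom_inv[OF xy(2)] by simp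
      then show "k0_rels P #>\<^bsub>?Q\<^esub> (x - y) \<in> generate ?G ?Y"
        using subgroup.m_closed[OF sub in_Y(1) subgroup.m_inv_closed[OF sub in_Y(2)]] by simp
    next
      fix a :: "('p, 'k) pmod set" assume "a \<in> isoclass P ` {M. is_pmod P M}"
      then show "k0_rels P #>\<^bsub>?Q\<^esub> frag_of a \<in> generate ?G ?Y"
        by (intro generate.incl) (auto simp: k0_class_def)
    qed
    then show "g \<in> generate ?G ?Y" using x(2) by simp
  qed
qed

text \<open>The universal property of the split Grothendieck group.\<close>

lemma additive_invariant_exists:
  fixes \<phi> :: "('p, 'k::field) pmod \<Rightarrow> 'n \<Rightarrow> int"
  assumes iso: "\<And>M M' n. is_pmod P M \<Longrightarrow> is_pmod P M' \<Longrightarrow> pmod_iso P M M' \<Longrightarrow> n \<in> N \<Longrightarrow> \<phi> M n = \<phi> M' n"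
    and add: "\<And>M M' n. is_pmod P M \<Longrightarrow> is_pmod P M' \<Longrightarrow> n \<in> N \<Longrightarrow> \<phi> (pmod_sum M M') n = \<phi> M n + \<phi> M' n"
  shows "\<exists>\<Psi>. is_invariant P N \<Psi> \<and> (\<forall>M. is_pmod P M \<longrightarrow> (\<forall>n\<in>N. \<Psi> (k0_class P (isoclass P M)) n = \<phi> M n))"
proof -
  let ?Q = "k0_gens P :: (('p, 'k) pmod set \<Rightarrow>\<^sub>0 int) monoid" and ?H = "Zpow N :: ('n \<Rightarrow> int) monoid"
  let ?C = "isoclass P ` {M :: ('p, 'k) pmod. is_pmod P M}"
  interpret Q: comm_group ?Q by (rule k0_gens_comm_group)
  have grpH: "group ?H" by (simp add: Zpow_def)
  have "comm_group ?H"
    by (rule group.group_comm_groupI[OF grpH]) (auto simp: Zpow_def fun_eq_iff)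
  then interpret H: comm_group ?H .
  define v where "v C = (\<lambda>n\<in>N. \<phi> (SOME M. M \<in> C) n)" for C :: "('p, 'k) pmod set"
  have v: "v (isoclass P M) = (\<lambda>n\<in>N. \<phi> M n)" if M: "is_pmod P M" for M
  proof -
    have "M \<in> isoclass P M" using M by (simp add: isoclass_def pmod_iso_refl)
    then have "(SOME M'. M' \<in> isoclass P M) \<in> isoclass P M" by (rule someI)
    then have "is_pmod P (SOME M'. M' \<in> isoclass P M)" "pmod_iso P M (SOME M'. M' \<in> isoclass P M)"
      by (simp_all add: isoclass_def)
    then show ?thesis using iso[OF M] by (auto simp: v_def)
  qed
  have "v ` ?C \<subseteq> carrier ?H" by (auto simp: v_def Zpow_def)
  then obtain h where h: "h \<in> hom ?Q ?H" and h_v: "\<And>C. C \<in> ?C \<Longrightarrow> h (frag_of C) = v C"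
    unfolding k0_gens_def by (rule H.free_Abelian_group_universal) blast
  interpret h: group_hom ?Q ?H h
    using h by (simp add: group_hom_def group_hom_axioms_def Q.is_group H.is_group)
  have ker: "k0_rels P \<subseteq> kernel ?Q ?H h"
    unfolding k0_rels_def
  proof (rule Q.generate_subgroup_incl[OF _ h.subgroup_kernel], rule subsetI)
    fix r assume "r \<in> {frag_of (isoclass P (pmod_sum M N)) - (frag_of (isoclass P M) + frag_of (isoclass P N))
        | M N :: ('p, 'k) pmod. is_pmod P M \<and> is_pmod P N}"
    then obtain M N' :: "('p, 'k) pmod" where MN: "is_pmod P M" "is_pmod P N'"
      and r: "r = frag_of (isoclass P (pmod_sum M N')) - (frag_of (isoclass P M) + frag_of (isoclass P N'))"
      by blast
    let ?s = "frag_of (isoclass P (pmod_sum M N'))" and ?a = "frag_of (isoclass P M)"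
      and ?b = "frag_of (isoclass P N')"
    note c = frag_of_carrier[OF is_pmod_sum[OF MN]] frag_of_carrier[OF MN(1)] frag_of_carrier[OF MN(2)]
    have ab: "?a \<otimes>\<^bsub>?Q\<^esub> ?b = ?a + ?b" by (simp add: k0_gens_def)
    then have abc: "?a + ?b \<in> carrier ?Q" using Q.m_closed[OF c(2,3)] by simp
    have r': "r = ?s \<otimes>\<^bsub>?Q\<^esub> inv\<^bsub>?Q\<^esub> (?a + ?b)" using abc by (simp add: r k0_gens_def)
    have "h (?a + ?b) = h ?a \<otimes>\<^bsub>?H\<^esub> h ?b" using h.hom_mult[OF c(2,3)] ab by simp
    also have "\<dots> = h ?s"
      using MN is_pmod_sum[OF MN] add[OF MN] by (simp add: h_v v) (auto simp: Zpow_def fun_eq_iff)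
    finally have "h r = h ?s \<otimes>\<^bsub>?H\<^esub> inv\<^bsub>?H\<^esub> (h ?s)" using c(1) abc by (simp add: r')
    also have "\<dots> = \<one>\<^bsub>?H\<^esub>" using h.hom_closed[OF c(1)] by (rule H.r_inv)
    finally show "r \<in> kernel ?Q ?H h" using c(1) abc by (simp add: kernel_def r')
  qed
  obtain \<Psi> where \<Psi>: "\<Psi> \<in> hom (?Q Mod k0_rels P) ?H"
    and \<Psi>_h: "\<And>x. x \<in> carrier ?Q \<Longrightarrow> \<Psi> (k0_rels P #>\<^bsub>?Q\<^esub> x) = h x"
    using h.FactGroup_universal_kernel[OF Q.subgroup_imp_normal[OF k0_rels_subgroup] ker] by blast
  have "\<Psi> (k0_class P (isoclass P M)) n = \<phi> M n" if M: "is_pmod P M" and n: "n \<in> N" for M n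
    using \<Psi>_h[OF frag_of_carrier[OF M]] h_v[of "isoclass P M"] v[OF M] M n by (simp add: k0_class_def)
  moreover have "is_invariant P N \<Psi>" using \<Psi> by (simp add: is_invariant_def K0sp_def)
  ultimately show ?thesis by blast
qed

section \<open>Multiplicities along embeddings\<close>

context height_two_poset
begin

context
  assumes dec: "\<And>N :: ('x, 'k::field) pmod. is_pmod X N \<Longrightarrow> \<exists>m. decomposes X N m"
begin

lemma multiplicity_iso:
  fixes N M :: "('x, 'k) pmod"
  assumes "U \<in> Ind X" "is_pmod X N" "pmod_iso X N M" "is_pmod X M"
  shows "multiplicity X U N = multiplicity X U M"
proof -
  obtain S where S: "S \<in> stars X" "is_pmod X U" "pmod_iso X U (interval_pmod S)"
    using Ind_star[OF dec assms(1)] by blast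
  obtain m where m: "decomposes X M m" using dec[OF assms(4)] by blast
  show ?thesis
    using multiplicity_decomposes[OF dec decomposes_iso[OF m assms(2,3)] S]
      multiplicity_decomposes[OF dec m S] by simp
qed

lemma multiplicity_sum:
  fixes N M :: "('x, 'k) pmod"
  assumes "U \<in> Ind X" "is_pmod X N" "is_pmod X M"
  shows "multiplicity X U (pmod_sum N M) = multiplicity X U N + multiplicity X U M"
proof -
  obtain S where S: "S \<in> stars X" "is_pmod X U" "pmod_iso X U (interval_pmod S)"
    using Ind_star[OF dec assms(1)] by blast
  obtain m m' where m: "decomposes X N m" "decomposes X M m'" using dec assms(2,3) by blast
  show ?thesis
    using multiplicity_decomposes[OF dec decomposes_sum[OF m] S]
      multiplicity_decomposes[OF dec m(1) S] multiplicity_decomposes[OF dec m(2) S] by simp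
qed

definition star_rep :: "'x set \<Rightarrow> ('x, 'k) pmod" where
  "star_rep S = (SOME U. U \<in> Ind X \<and> is_pmod X U \<and> pmod_iso X U (interval_pmod S))"

lemma star_rep:
  assumes "S \<in> stars X"
  shows "star_rep S \<in> Ind X" "is_pmod X (star_rep S)" "pmod_iso X (star_rep S) (interval_pmod S)"
proof -
  have "\<exists>U. U \<in> (Ind X :: ('x, 'k) pmod set) \<and> is_pmod X U \<and> pmod_iso X U (interval_pmod S)"
    using star_Ind[OF assms] by metis
  from someI_ex[OF this] show "star_rep S \<in> Ind X" "is_pmod X (star_rep S)"
      "pmod_iso X (star_rep S) (interval_pmod S)"
    unfolding star_rep_def by blast+
qed

text \<open>For a decomposed module this is the rank over \<open>S\<close> in terms of multiplicities.\<close>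

definition star_rank :: "'x set \<Rightarrow> ('x, 'k) pmod \<Rightarrow> nat" where
  "star_rank S N = (\<Sum>T\<in>{T \<in> stars X. S \<subseteq> T}. multiplicity X (star_rep T) N)"

lemma star_rank:
  fixes N :: "('x, 'k) pmod"
  assumes "is_pmod X N" "star X S x"
  shows "rank_ge X S N n \<longleftrightarrow> n \<le> star_rank S N"
proof -
  obtain m where m: "decomposes X N m" using dec[OF assms(1)] by blast
  have "star_rank S N = (\<Sum>T\<in>{T \<in> stars X. S \<subseteq> T}. m T)"
    unfolding star_rank_def
    using multiplicity_decomposes[OF dec m] star_rep by (intro sum.cong) auto
  then show ?thesis using decomposes_rank[OF m assms(2)] by simp
qed

lemma multiplicity_star_rep:
  fixes U :: "('x, 'k) pmod"
  assumes "U \<in> Ind X"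
  obtains S where "S \<in> stars X" "pmod_iso X U (interval_pmod S)" "is_pmod X U"
    "\<And>N :: ('x, 'k) pmod. is_pmod X N \<Longrightarrow> multiplicity X U N = multiplicity X (star_rep S) N"
proof -
  obtain S where S: "S \<in> stars X" "is_pmod X U" "pmod_iso X U (interval_pmod S)"
    using Ind_star[OF dec assms(1)] by blast
  have "multiplicity X U N = multiplicity X (star_rep S) N" if N: "is_pmod X N" for N :: "('x, 'k) pmod"
  proof -
    obtain m where m: "decomposes X N m" using dec[OF N] by blast
    show ?thesis
      using multiplicity_decomposes[OF dec m S] multiplicity_decomposes[OF dec m S(1) star_rep(2,3)[OF S(1)]]
      by simp
  qed
  with S that show ?thesis by blast
qed

end

end

context poset_embedding
begin

text \<open>As \<open>f\<close> is an isomorphism from \<open>S\<close> to \<open>f ` S\<close>, sections and cosections correspond. So a rank of the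
  restriction only depends on the subset \<open>f ` S\<close> of \<open>P\<close>.\<close>

lemma rank_ge_restr:
  fixes M :: "('p, 'k::field) pmod"
  assumes X: "Partial_order X" and S: "S \<subseteq> Field X"
  shows "rank_ge X S (restr f M) n \<longleftrightarrow> rank_ge P (f ` S) M n"
proof -
  have "antisym X" using X by (simp add: order_on_defs)
  have inj: "inj_on f S"
  proof (rule inj_onI)
    fix x y assume "x \<in> S" "y \<in> S" "f x = f y"
    moreover have "(f x, f x) \<in> P" "(f y, f y) \<in> P"
      using f_in refl_P S \<open>x \<in> S\<close> \<open>y \<in> S\<close> by blast+
    ultimately have "(x, y) \<in> X" "(y, x) \<in> X" using f_iff S by (metis subsetD)+
    then show "x = y" using \<open>antisym X\<close> by (simp add: antisymD)
  qed
  have iff: "(x, y) \<in> X \<longleftrightarrow> (f x, f y) \<in> P" if "x \<in> S" "y \<in> S" for x y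
    using f_iff S that by (meson subsetD)
  have sec: "section_on X S (restr f M) (\<lambda>x. u (f x)) \<longleftrightarrow> section_on P (f ` S) M u" for u
    using iff by (auto simp: section_on_def)
  have cosec: "cosection_on X S (restr f M) (\<lambda>x. \<phi> (f x)) \<longleftrightarrow> cosection_on P (f ` S) M \<phi>" for \<phi>
    using iff by (auto simp: cosection_on_def)
  show ?thesis
  proof
    assume "rank_ge P (f ` S) M n"
    then obtain R u \<phi> where R: "finite R" "card R = n" and dual: "dual_system P (f ` S) M R u \<phi>"
      unfolding rank_ge_def by blast
    note D = dual_systemD[OF dual]
    show "rank_ge X S (restr f M) n"
      by (rule rank_geI[OF R, of X S "restr f M" "\<lambda>r x. u r (f x)" "\<lambda>r x. \<phi> r (f x)"])
        (use D in \<open>auto simp: sec cosec\<close>)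
  next
    assume "rank_ge X S (restr f M) n"
    then obtain R u \<phi> where R: "finite R" "card R = n" and dual: "dual_system X S (restr f M) R u \<phi>"
      unfolding rank_ge_def by blast
    note D = dual_systemD[OF dual]
    let ?i = "inv_into S f"
    have i: "?i (f x) = x" if "x \<in> S" for x using inv_into_f_f[OF inj that] .
    have "section_on X S (restr f M) (\<lambda>x. u r (?i (f x)))" if "r \<in> R" for r
      using D(1)[OF that] i by (simp add: section_on_def)
    moreover have "cosection_on X S (restr f M) (\<lambda>x. \<phi> r (?i (f x)))" if "r \<in> R" for r
      using D(2)[OF that] i by (simp add: cosection_on_def)
    ultimately show "rank_ge P (f ` S) M n"
      by (intro rank_geI[OF R, of P "f ` S" M "\<lambda>r p. u r (?i p)" "\<lambda>r p. \<phi> r (?i p)"])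
        (use D(3) i in \<open>auto simp flip: sec cosec\<close>)
  qed
qed

lemma star_image: "star X S x \<Longrightarrow> star P (f ` S) (f x)"
  unfolding star_def using f_in f_mono by blast

lemma indecomposable_convex_closure:
  assumes "star X S x"
  shows "indecomposable P (interval_pmod (convex_closure P (f ` S)) :: ('p, 'k::field) pmod)"
proof -
  let ?A = "f ` S" and ?J = "convex_closure P (f ` S)"
  have A: "star P ?A (f x)" using star_image[OF assms] .
  then have AJ: "?A \<subseteq> ?J" using convex_closure_superset by (simp add: star_def)
  have conn: "(f x, p) \<in> ((P \<union> P\<inverse>) \<inter> ?J \<times> ?J)\<^sup>*" if p: "p \<in> ?J" for p
  proof -
    obtain a where a: "a \<in> ?A" "(a, p) \<in> P" using p by (auto simp: convex_closure_def)
    have "(f x, a) \<in> (P \<union> P\<inverse>) \<inter> ?J \<times> ?J" using A AJ a(1) unfolding star_def by blast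
    moreover have "(a, p) \<in> (P \<union> P\<inverse>) \<inter> ?J \<times> ?J" using a AJ p by blast
    ultimately show ?thesis by (meson rtrancl.rtrancl_into_rtrancl r_into_rtrancl)
  qed
  show ?thesis
    using indecomposable_interval[OF convex_convex_closure _ _ conn] A AJ unfolding star_def by blast
qed

end

text \<open>Convex closure creates no new minimal or maximal elements, so a set of extremal elements can be
  read off from its closure.\<close>

lemma convex_closure_extremal:
  assumes A: "A \<subseteq> Field P" and A': "A' \<subseteq> Field P" and P: "Partial_order P"
    and eq: "convex_closure P A = convex_closure P A'"
    and extremal: "\<And>a. a \<in> A \<Longrightarrow> (\<forall>b\<in>A. (b, a) \<in> P \<longrightarrow> b = a) \<or> (\<forall>b\<in>A. (a, b) \<in> P \<longrightarrow> b = a)"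
  shows "A \<subseteq> A'"
proof
  fix a assume a: "a \<in> A"
  have refl: "\<And>p. p \<in> Field P \<Longrightarrow> (p, p) \<in> P" and trans: "\<And>p q r. (p, q) \<in> P \<Longrightarrow> (q, r) \<in> P \<Longrightarrow> (p, r) \<in> P"
    and antisym: "\<And>p q. (p, q) \<in> P \<Longrightarrow> (q, p) \<in> P \<Longrightarrow> p = q"
    using P by (auto simp: order_on_defs refl_on_def dest: transD antisymD)
  have "a \<in> convex_closure P A'" using a A refl eq[symmetric] by (auto simp: convex_closure_def)
  then obtain c d where cd: "c \<in> A'" "d \<in> A'" "(c, a) \<in> P" "(a, d) \<in> P" by (auto simp: convex_closure_def)
  have "c \<in> convex_closure P A" "d \<in> convex_closure P A"
    unfolding eq using cd A' refl by (auto simp: convex_closure_def)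
  then obtain b e where be: "b \<in> A" "(b, c) \<in> P" "e \<in> A" "(d, e) \<in> P" by (auto simp: convex_closure_def)
  from extremal[OF a] show "a \<in> A'"
  proof
    assume "\<forall>b\<in>A. (b, a) \<in> P \<longrightarrow> b = a"
    then have "b = a" using be trans cd by blast
    then show ?thesis using antisym[of c a] be cd by simp
  next
    assume "\<forall>b\<in>A. (a, b) \<in> P \<longrightarrow> b = a"
    then have "e = a" using be trans cd by blast
    then show ?thesis using antisym[of d a] be cd by simp
  qed
qed

lemma Emb_order_embeddings:
  assumes "f \<in> Emb X P" shows "f \<in> order_embeddings X P"
proof -
  obtain g where g: "g \<in> order_embeddings X P" "f = emb_rep X P g" using assms by (auto simp: Emb_def)
  let ?s = "\<lambda>x\<in>Field X. x"
  have "?s \<in> poset_auts X"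
    by (auto simp: poset_auts_def order_embeddings_def bij_betw_def inj_on_def)
  moreover have "g = compose (Field X) g ?s"
    using g(1) by (auto simp: order_embeddings_def compose_def PiE_iff extensional_def fun_eq_iff)
  ultimately have "\<exists>h. h \<in> order_embeddings X P \<and> (\<exists>s\<in>poset_auts X. h = compose (Field X) g s)"
    using g(1) by blast
  from someI_ex[OF this] show ?thesis unfolding g(2) emb_rep_def by blast
qed

section \<open>The basis theorem\<close>

lemma eq_if_same_lower_bounds: "(\<And>n :: nat. n \<le> a \<longleftrightarrow> n \<le> b) \<Longrightarrow> a = b"
  by (meson order_antisym order_refl)

text \<open>The set \<open>F\<close> of convex closures indexes both the candidates for the basis and, through the ranks
  over the sets \<open>f ` S\<close>, the rows of a zeta matrix.\<close>

theorem Theta_basis: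
  fixes P :: "'p rel" and X :: "nat rel"
  assumes X: "height_two_poset X"
    and dec: "\<And>N :: (nat, 'k::field) pmod. is_pmod X N \<Longrightarrow> \<exists>m. decomposes X N m"
    and P: "Partial_order P" and fin: "finite (Field P)"
  shows "is_basis P (Emb X P \<times> Ind X) (mult_inv X P)
           {isoclass P (Theta X P f U) | f U. (f, U) \<in> Emb X P \<times> (Ind X :: (nat, 'k) pmod set)}"
proof -
  interpret X: height_two_poset X by (rule X)
  let ?N = "Emb X P \<times> (Ind X :: (nat, 'k) pmod set)"
  let ?\<Psi> = "mult_inv X P :: ('p, 'k) k0_elem \<Rightarrow> _"
  let ?G = "K0sp P :: ('p, 'k) k0_elem monoid"
  let ?cl = "\<lambda>M :: ('p, 'k) pmod. k0_class P (isoclass P M)"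
  interpret G: comm_group ?G by (rule K0sp_comm_group)
  have emb: "poset_embedding X P f" if "f \<in> Emb X P" for f
    using X.finite_X P Emb_order_embeddings[OF that] by unfold_locales
  have restr: "is_pmod X (restr f M)" if "f \<in> Emb X P" "is_pmod P M" for f and M :: "('p, 'k) pmod"
    using poset_embedding.is_pmod_restr[OF emb[OF that(1)] that(2)] .
  have "\<exists>\<Psi>. is_invariant P ?N \<Psi> \<and> (\<forall>M. is_pmod P M \<longrightarrow> (\<forall>n\<in>?N. \<Psi> (?cl M) n =
      (case n of (f, U) \<Rightarrow> int (multiplicity X U (restr f M)))))"
  proof (rule additive_invariant_exists)
    fix M M' :: "('p, 'k) pmod" and n :: "(nat \<Rightarrow> 'p) \<times> (nat, 'k) pmod"
    assume M: "is_pmod P M" "is_pmod P M'" and n: "n \<in> ?N"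
    obtain f U where fU: "n = (f, U)" "f \<in> Emb X P" "U \<in> Ind X" using n by auto
    interpret f: poset_embedding X P f by (rule emb[OF fU(2)])
    show "(case n of (f, U) \<Rightarrow> int (multiplicity X U (restr f (pmod_sum M M')))) =
        (case n of (f, U) \<Rightarrow> int (multiplicity X U (restr f M))) +
        (case n of (f, U) \<Rightarrow> int (multiplicity X U (restr f M')))"
      using X.multiplicity_sum[OF dec fU(3) restr[OF fU(2) M(1)] restr[OF fU(2) M(2)]]
      by (simp add: fU(1) f.restr_sum)
    show "(case n of (f, U) \<Rightarrow> int (multiplicity X U (restr f M))) =
        (case n of (f, U) \<Rightarrow> int (multiplicity X U (restr f M')))" if "pmod_iso P M M'"
      using X.multiplicity_iso[OF dec fU(3) restr[OF fU(2) M(1)] f.restr_iso[OF M(1) that] restr[OF fU(2) M(2)]]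
      by (simp add: fU(1))
  qed
  then have "\<exists>\<Psi> :: ('p, 'k) k0_elem \<Rightarrow> _. is_invariant P ?N \<Psi> \<and>
     (\<forall>M. is_pmod P M \<longrightarrow> (\<forall>f\<in>Emb X P. \<forall>U\<in>Ind X. \<Psi> (?cl M) (f, U) = int (multiplicity X U (restr f M))))"
    by fastforce
  from someI_ex[OF this, folded mult_inv_def]
  have inv: "is_invariant P ?N ?\<Psi>"
    and val: "\<And>M f U. is_pmod P M \<Longrightarrow> f \<in> Emb X P \<Longrightarrow> U \<in> Ind X \<Longrightarrow>
      ?\<Psi> (?cl M) (f, U) = int (multiplicity X U (restr f M))"
    by blast+
  have \<Psi>_hom: "?\<Psi> \<in> hom ?G (Zpow ?N)" using inv by (simp add: is_invariant_def)

  let ?rep = "X.star_rep :: nat set \<Rightarrow> (nat, 'k) pmod"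
  let ?rank = "X.star_rank :: nat set \<Rightarrow> (nat, 'k) pmod \<Rightarrow> nat"
  let ?hull = "\<lambda>f S. convex_closure P (f ` S)"
  define F where "F = {?hull f S | f S. f \<in> Emb X P \<and> S \<in> stars X}"
  define b where "b J = ?cl (interval_pmod J)" for J
  have "F \<subseteq> Pow (Field P)"
    unfolding F_def convex_closure_def by (auto simp: Field_def)
  then have finF: "finite F" using fin by (meson finite_Pow_iff finite_subset)
  have convF: "convex_in P J" if "J \<in> F" for J
    using that poset_embedding.convex_convex_closure[OF emb] unfolding F_def by blast
  have pmodF: "is_pmod P (interval_pmod J :: ('p, 'k) pmod)" if "J \<in> F" for J
    using is_pmod_interval[OF convF[OF that]] .
  have bG: "b ` F \<subseteq> carrier ?G" unfolding b_def using k0_class_carrier pmodF by blast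

  have rank_eq: "n \<le> ?rank S (restr f M) \<longleftrightarrow> rank_ge P (f ` S) M n"
    if "f \<in> Emb X P" "S \<in> stars X" "is_pmod P M" for f S n and M :: "('p, 'k) pmod"
  proof -
    obtain x where x: "star X S x" using \<open>S \<in> stars X\<close> by (auto simp: stars_def)
    then have "S \<subseteq> Field X" by (simp add: star_def)
    then show ?thesis
      using X.star_rank[OF dec restr[OF that(1,3)] x]
        poset_embedding.rank_ge_restr[OF emb[OF that(1)] X.order_X] by metis
  qed
  have same_image: "f ` S = f' ` S'"
    if "f \<in> Emb X P" "S \<in> stars X" "f' \<in> Emb X P" "S' \<in> stars X" "?hull f S = ?hull f' S'" for f S f' S'
  proof -
    have sub: "g ` T \<subseteq> g' ` T'"
      if g: "g \<in> Emb X P" and T: "T \<in> stars X" and g': "g' \<in> Emb X P" and T': "T' \<in> stars X"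
        and eq: "?hull g T = ?hull g' T'" for g T g' T'
    proof (rule convex_closure_extremal[OF _ _ P eq])
      interpret g: poset_embedding X P g by (rule emb[OF g])
      interpret g': poset_embedding X P g' by (rule emb[OF g'])
      have TF: "T \<subseteq> Field X" "T' \<subseteq> Field X" using T T' by (auto simp: stars_def star_def)
      then show "g ` T \<subseteq> Field P" "g' ` T' \<subseteq> Field P" using g.f_in g'.f_in by auto
      fix a assume "a \<in> g ` T"
      then obtain x where x: "x \<in> T" "a = g x" by blast
      show "(\<forall>b\<in>g ` T. (b, a) \<in> P \<longrightarrow> b = a) \<or> (\<forall>b\<in>g ` T. (a, b) \<in> P \<longrightarrow> b = a)"
      proof (rule ccontr)
        assume "\<not> ?thesis"
        then obtain y z where "y \<in> T" "z \<in> T" "(g y, g x) \<in> P" "g y \<noteq> g x" "(g x, g z) \<in> P" "g z \<noteq> g x"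
          using x(2) by blast
        moreover from this have "(y, x) \<in> X" "(x, z) \<in> X" using g.f_iff TF x(1) by (meson subsetD)+
        ultimately show False using X.height[of y x z] by auto
      qed
    qed
    show ?thesis using sub[OF that] sub[OF that(3,4,1,2) that(5)[symmetric]] by blast
  qed
  have rank_interval: "?rank S (restr f (interval_pmod J)) = (if ?hull f S \<subseteq> J then 1 else 0)"
    if "f \<in> Emb X P" "S \<in> stars X" "J \<in> F" for f S J
  proof -
    interpret f: poset_embedding X P f by (rule emb[OF that(1)])
    obtain x where x: "star X S x" using \<open>S \<in> stars X\<close> by (auto simp: stars_def)
    have fS: "f ` S \<subseteq> Field P" using f.star_image[OF x] by (simp add: star_def)
    obtain A where J: "J = convex_closure P A" using \<open>J \<in> F\<close> by (auto simp: F_def)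
    have "n \<le> ?rank S (restr f (interval_pmod J)) \<longleftrightarrow> n \<le> (if f ` S \<subseteq> J then 1 else 0)" for n
      unfolding rank_eq[OF that(1,2) pmodF[OF that(3)]]
      by (rule rank_ge_interval[OF f.star_image[OF x] convF[OF that(3)]])
    then have "?rank S (restr f (interval_pmod J)) = (if f ` S \<subseteq> J then 1 else 0)"
      by (rule eq_if_same_lower_bounds)
    moreover have "f ` S \<subseteq> J \<longleftrightarrow> ?hull f S \<subseteq> J" unfolding J using f.convex_closure_mono_iff[OF fS] by simp
    ultimately show ?thesis by simp
  qed
  have b_val: "?\<Psi> (b J) (f, U) = int (multiplicity X U (restr f (interval_pmod J)))"
    if "J \<in> F" "f \<in> Emb X P" "U \<in> Ind X" for J f U
    using val[OF pmodF[OF that(1)] that(2,3)] by (simp add: b_def)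

  have indep: "c J = 0"
    if zero: "\<And>n. n \<in> ?N \<Longrightarrow> (\<Sum>J\<in>F. c J * ?\<Psi> (b J) n) = 0" and J: "J \<in> F" for c J
  proof (rule zeta_inj[OF finF _ J])
    fix I assume "I \<in> F"
    then obtain f S where fS: "f \<in> Emb X P" "S \<in> stars X" "I = ?hull f S" by (auto simp: F_def)
    let ?Q = "{T \<in> stars X. S \<subseteq> T}"
    have "0 = (\<Sum>T\<in>?Q. \<Sum>J\<in>F. c J * ?\<Psi> (b J) (f, ?rep T))"
      using zero fS(1) X.star_rep(1)[OF dec] by (intro sum.neutral[symmetric]) auto
    also have "\<dots> = (\<Sum>J\<in>F. \<Sum>T\<in>?Q. c J * ?\<Psi> (b J) (f, ?rep T))" by (rule sum.swap)
    also have "\<dots> = (\<Sum>J\<in>F. c J * int (?rank S (restr f (interval_pmod J))))"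
      using b_val[OF _ fS(1) X.star_rep(1)[OF dec]]
      by (intro sum.cong) (auto simp: X.star_rank_def[OF dec] sum_distrib_left)
    also have "\<dots> = (\<Sum>J\<in>F. if I \<subseteq> J then c J else 0)"
      using rank_interval[OF fS(1,2)] fS(3) by (intro sum.cong) auto
    also have "\<dots> = (\<Sum>J\<in>{J \<in> F. I \<subseteq> J}. c J)" using finF by (simp add: sum.inter_filter)
    finally show "(\<Sum>J\<in>{J \<in> F. I \<subseteq> J}. c J) = 0" by simp
  qed

  have span: "\<exists>c. \<forall>n\<in>?N. ?\<Psi> (?cl M) n = (\<Sum>J\<in>F. c J * ?\<Psi> (b J) n)" if M: "is_pmod P M" for M
  proof -
    \<comment> \<open>The rank of \<open>M\<close> that belongs to \<open>J\<close>. It does not depend on the choice of \<open>f\<close> and \<open>S\<close>, because \<open>J\<close>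
      determines \<open>f ` S\<close>.\<close>
    define r where "r J = (SOME k. \<exists>f\<in>Emb X P. \<exists>S\<in>stars X. J = ?hull f S \<and> k = ?rank S (restr f M))" for J
    have r: "r (?hull f S) = ?rank S (restr f M)" if "f \<in> Emb X P" "S \<in> stars X" for f S
    proof -
      have "\<exists>f'\<in>Emb X P. \<exists>S'\<in>stars X. ?hull f S = ?hull f' S' \<and> r (?hull f S) = ?rank S' (restr f' M)"
        unfolding r_def by (rule someI_ex) (use that in blast)
      then obtain f' S' where *: "f' \<in> Emb X P" "S' \<in> stars X" "?hull f S = ?hull f' S'"
        "r (?hull f S) = ?rank S' (restr f' M)" by blast
      have "n \<le> ?rank S' (restr f' M) \<longleftrightarrow> n \<le> ?rank S (restr f M)" for n
        using rank_eq[OF *(1,2) M] rank_eq[OF that M] same_image[OF that *(1-3)] by simp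
      from eq_if_same_lower_bounds[OF this] show ?thesis using *(4) by simp
    qed
    obtain c where c: "\<And>I. I \<in> F \<Longrightarrow> int (r I) = (\<Sum>J\<in>{J \<in> F. I \<subseteq> J}. c J)"
      using zeta_surj[OF finF, of "\<lambda>I. int (r I)"] by blast
    have "?\<Psi> (?cl M) n = (\<Sum>J\<in>F. c J * ?\<Psi> (b J) n)" if n_in: "n \<in> ?N" for n
    proof -
      obtain f U where n: "n = (f, U)" and f: "f \<in> Emb X P" and U: "U \<in> Ind X" using n_in by auto
      \<comment> \<open>The error of the proposed combination. Its sums over the stars containing a given star vanish,
        hence it is zero.\<close>
      define d where "d T = int (multiplicity X (?rep T) (restr f M)) -
          (\<Sum>J\<in>F. c J * int (multiplicity X (?rep T) (restr f (interval_pmod J))))" for T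
      have "(\<Sum>T\<in>{T \<in> stars X. S \<subseteq> T}. d T) = 0" if S: "S \<in> stars X" for S
      proof -
        let ?Q = "{T \<in> stars X. S \<subseteq> T}"
        have "(\<Sum>T\<in>?Q. \<Sum>J\<in>F. c J * int (multiplicity X (?rep T) (restr f (interval_pmod J)))) =
            (\<Sum>J\<in>F. \<Sum>T\<in>?Q. c J * int (multiplicity X (?rep T) (restr f (interval_pmod J))))"
          by (rule sum.swap)
        also have "\<dots> = (\<Sum>J\<in>F. c J * int (?rank S (restr f (interval_pmod J))))"
          by (simp add: X.star_rank_def[OF dec] sum_distrib_left)
        also have "\<dots> = (\<Sum>J\<in>F. if ?hull f S \<subseteq> J then c J else 0)"
          using rank_interval[OF f S] by (intro sum.cong) auto
        also have "\<dots> = (\<Sum>J\<in>{J \<in> F. ?hull f S \<subseteq> J}. c J)" using finF by (simp add: sum.inter_filter)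
        also have "\<dots> = int (r (?hull f S))"
        proof (rule c[symmetric])
          show "?hull f S \<in> F" using f S by (auto simp: F_def)
        qed
        also have "\<dots> = (\<Sum>T\<in>?Q. int (multiplicity X (?rep T) (restr f M)))"
          using r[OF f S] by (simp add: X.star_rank_def[OF dec])
        finally show ?thesis by (simp add: d_def sum_subtractf)
      qed
      then have d: "d T = 0" if "T \<in> stars X" for T using zeta_inj[OF X.finite_stars] that by blast
      obtain S where S: "S \<in> stars X"
        and mult: "\<And>N :: (nat, 'k) pmod. is_pmod X N \<Longrightarrow> multiplicity X U N = multiplicity X (?rep S) N"
        using X.multiplicity_star_rep[OF dec U] by metis
      have "?\<Psi> (?cl M) n = int (multiplicity X (?rep S) (restr f M))"
        using val[OF M f U] mult[OF restr[OF f M]] n by simp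
      also have "\<dots> = (\<Sum>J\<in>F. c J * int (multiplicity X (?rep S) (restr f (interval_pmod J))))"
        using d[OF S] by (simp add: d_def)
      also have "\<dots> = (\<Sum>J\<in>F. c J * ?\<Psi> (b J) n)"
        using b_val[OF _ f U] mult[OF restr[OF f pmodF]] n by (intro sum.cong) auto
      finally show ?thesis .
    qed
    then show ?thesis by blast
  qed

  let ?R = "{isoclass P (Theta X P f U) | f U. (f, U) \<in> ?N}"
  have Theta: "isoclass P (Theta X P f U) = isoclass P (interval_pmod (?hull f S))"
    if "f \<in> Emb X P" "S \<in> stars X" "is_pmod X U" "pmod_iso X U (interval_pmod S)" for f S and U :: "(nat, 'k) pmod"
  proof -
    interpret f: poset_embedding X P f by (rule emb[OF that(1)])
    have "S \<subseteq> Field X" using that(2) by (auto simp: stars_def star_def)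
    note T = f.Theta_interval[OF that(3,4) this X.convex_X]
    show ?thesis
      using isoclass_eq_iff[OF is_pmod_interval[OF f.convex_convex_closure] T(2)] T(1) by metis
  qed
  have R: "?R = (\<lambda>J. isoclass P (interval_pmod J :: ('p, 'k) pmod)) ` F"
  proof (intro equalityI subsetI)
    fix C assume "C \<in> ?R"
    then obtain f U where f: "f \<in> Emb X P" and U: "U \<in> Ind X" and C: "C = isoclass P (Theta X P f U)" by blast
    obtain S where S: "S \<in> stars X" "is_pmod X U" "pmod_iso X U (interval_pmod S)"
      using X.Ind_star[OF dec U] by metis
    then show "C \<in> (\<lambda>J. isoclass P (interval_pmod J :: ('p, 'k) pmod)) ` F"
      using Theta[OF f S] f C unfolding F_def by blast
  next
    fix C assume "C \<in> (\<lambda>J. isoclass P (interval_pmod J :: ('p, 'k) pmod)) ` F"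
    then obtain f S where f: "f \<in> Emb X P" and S: "S \<in> stars X"
      and C: "C = isoclass P (interval_pmod (?hull f S))" by (auto simp: F_def)
    obtain U :: "(nat, 'k) pmod" where "U \<in> Ind X" "is_pmod X U" "pmod_iso X U (interval_pmod S)"
      using X.star_Ind[OF S] by metis
    then show "C \<in> ?R" using Theta[OF f S] f C by auto
  qed
  have bR: "k0_class P ` ?R = b ` F" unfolding R b_def image_image ..
  have "?R \<subseteq> isoclass P ` {M. indecomposable P M}"
  proof -
    have "indecomposable P (interval_pmod J :: ('p, 'k) pmod)" if "J \<in> F" for J
    proof -
      obtain f S where f: "f \<in> Emb X P" "S \<in> stars X" "J = ?hull f S" using \<open>J \<in> F\<close> by (auto simp: F_def)
      then show ?thesis using poset_embedding.indecomposable_convex_closure[OF emb] by (auto simp: stars_def)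
    qed
    then show ?thesis unfolding R by blast
  qed
  moreover
  let ?Y = "?cl ` {M. is_pmod P M}"
  have gen: "carrier ?G = generate ?G ?Y" using K0sp_generated by (simp add: image_image)
  have Y: "?Y \<subseteq> carrier ?G" using k0_class_carrier by blast
  have spanY: "\<exists>c. \<forall>n\<in>?N. ?\<Psi> y n = (\<Sum>J\<in>F. c J * ?\<Psi> (b J) n)" if "y \<in> ?Y" for y
    using that span by auto
  have "?\<Psi> \<in> iso (subgroup_generated ?G (b ` F)) (Zpow ?N \<lparr>carrier := ?\<Psi> ` carrier ?G\<rparr>)"
    by (rule G.basis_of_image(1)[OF \<Psi>_hom finF bG _ gen Y]) (fact indep, fact spanY)
  moreover have "\<exists>S. finite S \<and> S \<subseteq> carrier (Zpow ?N) \<and> generate (Zpow ?N) S = ?\<Psi> ` carrier ?G"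
    by (rule G.basis_of_image(2)[OF \<Psi>_hom finF bG _ gen Y]) (fact indep, fact spanY)
  ultimately show ?thesis
    using inv unfolding is_basis_def finite_invariant_def bR by blast
qed

theorem theorem1p1:
  fixes P :: "'p rel" and X :: "nat rel"
  assumes "Partial_order P" and "finite (Field P)" and "connected_poset P"
    and "X = X3' \<or> X = X3''"
    and "\<forall>a b. (a, b) \<in> P \<and> a \<noteq> b \<longrightarrow> (\<exists>f\<in>Emb X P. {a, b} \<subseteq> f ` Field X)"
  shows "is_basis P (Emb X P \<times> Ind X) (mult_inv X P)
           {isoclass P (Theta X P f U) | f U. (f, U) \<in> Emb X P \<times> (Ind X :: (nat, 'k::field) pmod set)}"
proof (rule Theta_basis[OF _ _ assms(1,2)])
  show X: "height_two_poset X" using assms(4) height_two_X3' height_two_X3'' by blast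
  show "\<exists>m. decomposes X N m" if "is_pmod X N" for N :: "(nat, 'k) pmod"
    using assms(4)
  proof
    assume X: "X = X3'"
    show ?thesis
      using height_two_poset.decomposes_exists[OF height_two_X3' split_X3'] that X by blast
  next
    assume X: "X = X3''"
    show ?thesis
      using height_two_poset.decomposes_exists[OF height_two_X3'' split_X3''] that X by blast
  qed
qed

end
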